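(* The theory $\mathbf{RCA}_0$ proves that the following are equivalent for any Goodstein dilator $D$: (i) (the extended Goodstein theorem without coefficient changes) for any non-decreasing function $b:\mathbb N\to\mathbb N$ with $b(0)>0$ and any number $m\in D(b(0))$, there is an $i\in\mathbb N$ with $G^D_{b,m}(i)=0$; (ii) the linear order $\overline D(\mathbb N)$ is well founded.
   Context: $\mathbf{RCA}_0$ is the usual base theory of reverse mathematics; in it, linear orders and Goodstein dilators are coded by subsets of $\mathbb N$. Categories: $\mathsf{LO}$ is the category of linear orders with order embeddings (strictly increasing functions) as morphisms. $\mathsf{Nat}$ is its full subcategory with objects $b:=\{0,\dots,b-1\}$ for $b\in\mathbb N$ (usual order). Goodstein dilator: a functor $D:\mathsf{Nat}\to\mathsf{LO}$ such that (1) each order $D(b)$ is equal to an initial segment of $\mathbb N$ with the usual order (possibly $\mathbb N$ itself); (2) $D$ preserves pullbacks; (3) $0\in D(0)$ and $D(\mathrm{emp}_b)(0)=0\in D(b)$ for all $b\in\mathbb N$, where $\mathrm{emp}_b:0=\emptyset\to b$ is the empty function. Supports: $[X]^{<\omega}$ is the set of finite subsets of $X$, and $[f]^{<\omega}(a)=\{f(x)\mid x\in a\}$. A functor $D:\mathsf{Nat}\to\mathsf{LO}$ that preserves pullbacks admits a unique natural transformation $\mathrm{supp}:D\Rightarrow[\cdot]^{<\omega}$ (of set-valued functors) such that, for any morphism $f:m\to n$ and $\sigma\in D(n)$, $\mathrm{supp}_n(\sigma)\subseteq\mathrm{rng}(f)$ implies $\sigma\in\mathrm{rng}(D(f))$.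 Extension $\overline D$: for a finite linear order $a$ let $|a|$ be its cardinality, identified with $\{0,\dots,|a|-1\}$; for an embedding $f:a\to b$ of finite orders let $|f|:|a|\to|b|$ be the morphism corresponding to $f$ under the unique isomorphisms $a\cong|a|$ and $b\cong|b|$; let $\iota_a^b:a\hookrightarrow b$ be the inclusion for $a\subseteq b$. For a linear order $X$ put $\overline D(X)=\{(a,\sigma)\mid a\in[X]^{<\omega},\ \sigma\in D(|a|),\ \mathrm{supp}_{|a|}(\sigma)=|a|\}$, with $(a,\sigma)<_{\overline D(X)}(b,\tau)$ iff $D(|\iota_a^{a\cup b}|)(\sigma)<_{D(|a\cup b|)}D(|\iota_b^{a\cup b}|)(\tau)$. This is a linear order. Goodstein sequence without coefficient changes: for a Goodstein dilator $D$, a non-decreasing $b:\mathbb N\to\mathbb N$ with $b(0)>0$, and $m\in D(b(0))$, let $c_i:b(i)\to b(i+1)$ be the inclusion, $c_i(n)=n$. Put $G^D_{b,m}(0)=m$, and $G^D_{b,m}(i+1)=0$ if $G^D_{b,m}(i)=0$, and $G^D_{b,m}(i+1)=D(c_i)(G^D_{b,m}(i))-1$ otherwise. *)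

theory Defs
  imports Main
begin

section \<open>Second-order arithmetic: syntax and provability\<close>

text \<open>
  The language has a sort of numbers and a sort of sets. Each sort has its own de Bruijn
  indices, so \<open>AllN\<close> binds number index 0 and \<open>AllS\<close> binds set index 0. The only terms of set
  sort are variables, and equality is primitive for numbers only.
\<close>

datatype tm = Var nat | Zero | One | Add tm tm | Mul tm tm

datatype fm =
    Fls
  | Eq tm tm
  | Less tm tm
  | Mem tm nat
  | Imp fm fm
  | AllN fm
  | AllS fm

abbreviation Neg :: "fm \<Rightarrow> fm" where "Neg p \<equiv> Imp p Fls"
abbreviation Or :: "fm \<Rightarrow> fm \<Rightarrow> fm" where "Or p q \<equiv> Imp (Neg p) q"
abbreviation And :: "fm \<Rightarrow> fm \<Rightarrow> fm" where "And p q \<equiv> Neg (Imp p (Neg q))"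
abbreviation Iff :: "fm \<Rightarrow> fm \<Rightarrow> fm" where "Iff p q \<equiv> And (Imp p q) (Imp q p)"
abbreviation ExN :: "fm \<Rightarrow> fm" where "ExN p \<equiv> Neg (AllN (Neg p))"
abbreviation ExS :: "fm \<Rightarrow> fm" where "ExS p \<equiv> Neg (AllS (Neg p))"

text \<open>Simultaneous capture-avoiding substitution for both sorts.\<close>

primrec subst_tm :: "(nat \<Rightarrow> tm) \<Rightarrow> tm \<Rightarrow> tm" where
  "subst_tm \<sigma> (Var i) = \<sigma> i"
| "subst_tm \<sigma> Zero = Zero"
| "subst_tm \<sigma> One = One"
| "subst_tm \<sigma> (Add s t) = Add (subst_tm \<sigma> s) (subst_tm \<sigma> t)"
| "subst_tm \<sigma> (Mul s t) = Mul (subst_tm \<sigma> s) (subst_tm \<sigma> t)"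

abbreviation shift_tm :: "tm \<Rightarrow> tm" where
  "shift_tm \<equiv> subst_tm (\<lambda>i. Var (Suc i))"

primrec subst :: "(nat \<Rightarrow> tm) \<Rightarrow> (nat \<Rightarrow> nat) \<Rightarrow> fm \<Rightarrow> fm" where
  "subst \<sigma> \<rho> Fls = Fls"
| "subst \<sigma> \<rho> (Eq s t) = Eq (subst_tm \<sigma> s) (subst_tm \<sigma> t)"
| "subst \<sigma> \<rho> (Less s t) = Less (subst_tm \<sigma> s) (subst_tm \<sigma> t)"
| "subst \<sigma> \<rho> (Mem t X) = Mem (subst_tm \<sigma> t) (\<rho> X)"
| "subst \<sigma> \<rho> (Imp p q) = Imp (subst \<sigma> \<rho> p) (subst \<sigma> \<rho> q)"
| "subst \<sigma> \<rho> (AllN p) = AllN (subst (case_nat (Var 0) (\<lambda>i. shift_tm (\<sigma> i))) \<rho> p)"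
| "subst \<sigma> \<rho> (AllS p) = AllS (subst \<sigma> (case_nat 0 (\<lambda>i. Suc (\<rho> i))) p)"

definition shiftN :: "fm \<Rightarrow> fm" where
  "shiftN = subst (\<lambda>i. Var (Suc i)) id"

definition shiftS :: "fm \<Rightarrow> fm" where
  "shiftS = subst Var Suc"

definition instN :: "tm \<Rightarrow> fm \<Rightarrow> fm" where
  "instN t = subst (case_nat t Var) id"

definition instS :: "nat \<Rightarrow> fm \<Rightarrow> fm" where
  "instS X = subst Var (case_nat X id)"

text \<open>Classical natural deduction for two-sorted first-order logic with equality.\<close>

inductive proves :: "fm set \<Rightarrow> fm \<Rightarrow> bool" (infix "\<turnstile>" 40) where
  Assm: "p \<in> \<Gamma> \<Longrightarrow> \<Gamma> \<turnstile> p"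
| ImpI: "insert p \<Gamma> \<turnstile> q \<Longrightarrow> \<Gamma> \<turnstile> Imp p q"
| ImpE: "\<Gamma> \<turnstile> Imp p q \<Longrightarrow> \<Gamma> \<turnstile> p \<Longrightarrow> \<Gamma> \<turnstile> q"
| RAA: "insert (Neg p) \<Gamma> \<turnstile> Fls \<Longrightarrow> \<Gamma> \<turnstile> p"
| AllNI: "shiftN ` \<Gamma> \<turnstile> p \<Longrightarrow> \<Gamma> \<turnstile> AllN p"
| AllNE: "\<Gamma> \<turnstile> AllN p \<Longrightarrow> \<Gamma> \<turnstile> instN t p"
| AllSI: "shiftS ` \<Gamma> \<turnstile> p \<Longrightarrow> \<Gamma> \<turnstile> AllS p"
| AllSE: "\<Gamma> \<turnstile> AllS p \<Longrightarrow> \<Gamma> \<turnstile> instS X p"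
| EqI: "\<Gamma> \<turnstile> Eq t t"
| EqE: "\<Gamma> \<turnstile> Eq s t \<Longrightarrow> \<Gamma> \<turnstile> instN s p \<Longrightarrow> \<Gamma> \<turnstile> instN t p"

section \<open>The theory RCA0\<close>

inductive bounded_fm :: "fm \<Rightarrow> bool" where
  "bounded_fm Fls"
| "bounded_fm (Eq s t)"
| "bounded_fm (Less s t)"
| "bounded_fm (Mem t X)"
| "bounded_fm p \<Longrightarrow> bounded_fm q \<Longrightarrow> bounded_fm (Imp p q)"
| "bounded_fm p \<Longrightarrow> bounded_fm (AllN (Imp (Less (Var 0) (shift_tm t)) p))"

definition Sigma01 :: "fm set" where
  "Sigma01 = {ExN p | p. bounded_fm p}"

definition Pi01 :: "fm set" where
  "Pi01 = {AllN p | p. bounded_fm p}"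

definition basic_axioms :: "fm set" where
  "basic_axioms =
    (let m = Var 0; n = Var 1 in
     {Neg (Eq (Add n One) Zero),
      Imp (Eq (Add m One) (Add n One)) (Eq m n),
      Eq (Add m Zero) m,
      Eq (Add m (Add n One)) (Add (Add m n) One),
      Eq (Mul m Zero) Zero,
      Eq (Mul m (Add n One)) (Add (Mul m n) m),
      Neg (Less m Zero),
      Iff (Less m (Add n One)) (Or (Less m n) (Eq m n))})"

definition induction_axiom :: "fm \<Rightarrow> fm" where
  "induction_axiom p =
    Imp (And (instN Zero p)
             (AllN (Imp p (subst (case_nat (Add (Var 0) One) (\<lambda>i. Var (Suc i))) id p))))
        (AllN p)"

definition comprehension_axiom :: "fm \<Rightarrow> fm \<Rightarrow> fm" where
  "comprehension_axiom p q =
    Imp (AllN (Iff p q)) (ExS (AllN (Iff (Mem (Var 0) 0) (shiftS p))))"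

primrec closed_tm :: "nat \<Rightarrow> tm \<Rightarrow> bool" where
  "closed_tm k (Var i) = (i < k)"
| "closed_tm k Zero = True"
| "closed_tm k One = True"
| "closed_tm k (Add s t) = (closed_tm k s \<and> closed_tm k t)"
| "closed_tm k (Mul s t) = (closed_tm k s \<and> closed_tm k t)"

primrec closed_fm :: "nat \<Rightarrow> nat \<Rightarrow> fm \<Rightarrow> bool" where
  "closed_fm k l Fls = True"
| "closed_fm k l (Eq s t) = (closed_tm k s \<and> closed_tm k t)"
| "closed_fm k l (Less s t) = (closed_tm k s \<and> closed_tm k t)"
| "closed_fm k l (Mem t X) = (closed_tm k t \<and> X < l)"
| "closed_fm k l (Imp p q) = (closed_fm k l p \<and> closed_fm k l q)"
| "closed_fm k l (AllN p) = closed_fm (Suc k) l p"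
| "closed_fm k l (AllS p) = closed_fm k (Suc l) p"

text \<open>The axioms are the universal closures of the following formulas with parameters.\<close>

definition RCA0 :: "fm set" where
  "RCA0 =
    {(AllN ^^ k) ((AllS ^^ l) p) | k l p.
       closed_fm k l p \<and>
       p \<in> basic_axioms
         \<union> {induction_axiom q | q. q \<in> Sigma01}
         \<union> {comprehension_axiom q r | q r. q \<in> Sigma01 \<and> r \<in> Pi01}}"

section \<open>Named-variable notation for formulas\<close>

text \<open>
  To write formulas with bound variables as HOL variables, terms and formulas are given as
  functions of the number of enclosing quantifiers of each sort: the variable bound at level
  \<open>k\<close> has index \<open>d - Suc k\<close> at depth \<open>d\<close>. A sentence is obtained by evaluation at depth 0.
\<close>

type_synonym nterm = "nat \<Rightarrow> tm"
type_synonym sterm = "nat \<Rightarrow> nat"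
type_synonym frm = "nat \<Rightarrow> nat \<Rightarrow> fm"

definition sentence :: "frm \<Rightarrow> fm" where
  "sentence p = p 0 0"

definition f_alln :: "(nterm \<Rightarrow> frm) \<Rightarrow> frm" (binder "\<^bold>\<forall>" 10) where
  "f_alln F = (\<lambda>n m. AllN (F (\<lambda>d. Var (d - Suc n)) (Suc n) m))"
definition f_alls :: "(sterm \<Rightarrow> frm) \<Rightarrow> frm" (binder "\<^bold>\<forall>\<^sub>S" 10) where
  "f_alls F = (\<lambda>n m. AllS (F (\<lambda>d. d - Suc m) n (Suc m)))"
definition f_exn :: "(nterm \<Rightarrow> frm) \<Rightarrow> frm" (binder "\<^bold>\<exists>" 10) where
  "f_exn F = (\<lambda>n m. ExN (F (\<lambda>d. Var (d - Suc n)) (Suc n) m))"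
definition f_exs :: "(sterm \<Rightarrow> frm) \<Rightarrow> frm" (binder "\<^bold>\<exists>\<^sub>S" 10) where
  "f_exs F = (\<lambda>n m. ExS (F (\<lambda>d. d - Suc m) n (Suc m)))"

definition f_imp :: "frm \<Rightarrow> frm \<Rightarrow> frm" (infixr "\<^bold>\<longrightarrow>" 25) where
  "(p \<^bold>\<longrightarrow> q) = (\<lambda>n m. Imp (p n m) (q n m))"
definition f_or :: "frm \<Rightarrow> frm \<Rightarrow> frm" (infixr "\<^bold>\<or>" 30) where
  "(p \<^bold>\<or> q) = (\<lambda>n m. Or (p n m) (q n m))"
definition f_and :: "frm \<Rightarrow> frm \<Rightarrow> frm" (infixr "\<^bold>\<and>" 35) where
  "(p \<^bold>\<and> q) = (\<lambda>n m. And (p n m) (q n m))"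
definition f_iff :: "frm \<Rightarrow> frm \<Rightarrow> frm" (infixr "\<^bold>\<longleftrightarrow>" 25) where
  "(p \<^bold>\<longleftrightarrow> q) = (\<lambda>n m. Iff (p n m) (q n m))"
definition f_not :: "frm \<Rightarrow> frm" ("\<^bold>\<not> _" [40] 40) where
  "(\<^bold>\<not> p) = (\<lambda>n m. Neg (p n m))"
definition f_eq :: "nterm \<Rightarrow> nterm \<Rightarrow> frm" (infix "\<^bold>=" 50) where
  "(s \<^bold>= t) = (\<lambda>n m. Eq (s n) (t n))"
definition f_less :: "nterm \<Rightarrow> nterm \<Rightarrow> frm" (infix "\<^bold><" 50) where
  "(s \<^bold>< t) = (\<lambda>n m. Less (s n) (t n))"
definition f_mem :: "nterm \<Rightarrow> sterm \<Rightarrow> frm" (infix "\<^bold>\<in>" 50) where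
  "(t \<^bold>\<in> X) = (\<lambda>n m. Mem (t n) (X m))"

definition t_zero :: nterm ("\<^bold>0") where "\<^bold>0 = (\<lambda>n. Zero)"
definition t_one :: nterm ("\<^bold>1") where "\<^bold>1 = (\<lambda>n. One)"
definition t_add :: "nterm \<Rightarrow> nterm \<Rightarrow> nterm" (infixl "\<^bold>+" 65) where
  "(s \<^bold>+ t) = (\<lambda>n. Add (s n) (t n))"
definition t_mul :: "nterm \<Rightarrow> nterm \<Rightarrow> nterm" (infixl "\<^bold>*" 70) where
  "(s \<^bold>* t) = (\<lambda>n. Mul (s n) (t n))"

definition f_ex1n :: "(nterm \<Rightarrow> frm) \<Rightarrow> frm" (binder "\<^bold>\<exists>\<^bold>!" 10) where
  "f_ex1n F = (\<^bold>\<exists>x. F x \<^bold>\<and> (\<^bold>\<forall>y. F y \<^bold>\<longrightarrow> y \<^bold>= x))"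

section \<open>Coding pairs, finite sets and finite sequences by numbers\<close>

definition t_pair :: "nterm \<Rightarrow> nterm \<Rightarrow> nterm" ("\<^bold>\<langle>_, _\<^bold>\<rangle>") where
  "\<^bold>\<langle>x, y\<^bold>\<rangle> = (x \<^bold>+ y) \<^bold>* (x \<^bold>+ y) \<^bold>+ x"

text \<open>
  The triple \<open>(k, (m, n))\<close> represents the finite set of all \<open>x < k\<close> such that \<open>m (x + 1) + 1\<close>
  divides \<open>n\<close>. The code of a finite set is the least triple that represents it, so codes
  are unique.
\<close>

definition is_triple :: "nterm \<Rightarrow> frm" where
  "is_triple a = (\<^bold>\<exists>k m n. a \<^bold>= \<^bold>\<langle>k, \<^bold>\<langle>m, n\<^bold>\<rangle>\<^bold>\<rangle>)"

definition f_elem :: "nterm \<Rightarrow> nterm \<Rightarrow> frm" (infix "\<^bold>\<epsilon>" 50) where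
  "(x \<^bold>\<epsilon> a) = (\<^bold>\<exists>k m n d. a \<^bold>= \<^bold>\<langle>k, \<^bold>\<langle>m, n\<^bold>\<rangle>\<^bold>\<rangle> \<^bold>\<and> x \<^bold>< k
     \<^bold>\<and> (m \<^bold>* (x \<^bold>+ \<^bold>1) \<^bold>+ \<^bold>1) \<^bold>* d \<^bold>= n)"

definition finset :: "nterm \<Rightarrow> frm" where
  "finset a = (is_triple a \<^bold>\<and>
     (\<^bold>\<forall>b. b \<^bold>< a \<^bold>\<and> is_triple b \<^bold>\<longrightarrow> \<^bold>\<not> (\<^bold>\<forall>x. x \<^bold>\<epsilon> b \<^bold>\<longleftrightarrow> x \<^bold>\<epsilon> a)))"

text \<open>A finite sequence is (the code of) its graph, with domain an initial segment.\<close>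

definition finseq :: "nterm \<Rightarrow> frm" where
  "finseq s = (finset s
     \<^bold>\<and> (\<^bold>\<forall>x. x \<^bold>\<epsilon> s \<^bold>\<longrightarrow> (\<^bold>\<exists>i y. x \<^bold>= \<^bold>\<langle>i, y\<^bold>\<rangle>))
     \<^bold>\<and> (\<^bold>\<forall>i y z. \<^bold>\<langle>i, y\<^bold>\<rangle> \<^bold>\<epsilon> s \<^bold>\<and> \<^bold>\<langle>i, z\<^bold>\<rangle> \<^bold>\<epsilon> s \<^bold>\<longrightarrow> y \<^bold>= z)
     \<^bold>\<and> (\<^bold>\<exists>l. \<^bold>\<forall>i. i \<^bold>< l \<^bold>\<longleftrightarrow> (\<^bold>\<exists>y. \<^bold>\<langle>i, y\<^bold>\<rangle> \<^bold>\<epsilon> s)))"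

section \<open>Linear orders, embeddings and pullbacks\<close>

text \<open>
  Orders and maps are handled as formulas with distinguished arguments; this covers orders
  and maps coded by sets, numbers and finite sequences in a uniform way.
\<close>

datatype ord = Ord (elt: "nterm \<Rightarrow> frm") (lss: "nterm \<Rightarrow> nterm \<Rightarrow> frm")

type_synonym rel = "nterm \<Rightarrow> nterm \<Rightarrow> frm"

definition linear_order :: "ord \<Rightarrow> frm" where
  "linear_order A =
     ((\<^bold>\<forall>x. \<^bold>\<not> lss A x x)
     \<^bold>\<and> (\<^bold>\<forall>x y. lss A x y \<^bold>\<longrightarrow> elt A x \<^bold>\<and> elt A y)
     \<^bold>\<and> (\<^bold>\<forall>x y z. lss A x y \<^bold>\<and> lss A y z \<^bold>\<longrightarrow> lss A x z)
     \<^bold>\<and> (\<^bold>\<forall>x y. elt A x \<^bold>\<and> elt A y \<^bold>\<longrightarrow> lss A x y \<^bold>\<or> x \<^bold>= y \<^bold>\<or> lss A y x))"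

definition is_function :: "ord \<Rightarrow> ord \<Rightarrow> rel \<Rightarrow> frm" where
  "is_function A B f =
     ((\<^bold>\<forall>x y. f x y \<^bold>\<longrightarrow> elt A x \<^bold>\<and> elt B y)
     \<^bold>\<and> (\<^bold>\<forall>x. elt A x \<^bold>\<longrightarrow> (\<^bold>\<exists>\<^bold>!y. f x y)))"

definition embedding :: "ord \<Rightarrow> ord \<Rightarrow> rel \<Rightarrow> frm" where
  "embedding A B f = (is_function A B f
     \<^bold>\<and> (\<^bold>\<forall>x x' y y'. lss A x x' \<^bold>\<and> f x y \<^bold>\<and> f x' y' \<^bold>\<longrightarrow> lss B y y'))"

text \<open>\<open>compose f g\<close> is \<open>g\<close> after \<open>f\<close>.\<close>

definition compose :: "rel \<Rightarrow> rel \<Rightarrow> rel" where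
  "compose f g = (\<lambda>x z. \<^bold>\<exists>y. f x y \<^bold>\<and> g y z)"

definition same :: "rel \<Rightarrow> rel \<Rightarrow> frm" where
  "same f g = (\<^bold>\<forall>x y. f x y \<^bold>\<longleftrightarrow> g x y)"

text \<open>A set codes a linear order via \<open>\<le>\<close>, and a map via its graph.\<close>

definition set_ord :: "sterm \<Rightarrow> ord" where
  "set_ord X = Ord (\<lambda>x. \<^bold>\<langle>x, x\<^bold>\<rangle> \<^bold>\<in> X) (\<lambda>x y. \<^bold>\<langle>x, y\<^bold>\<rangle> \<^bold>\<in> X \<^bold>\<and> \<^bold>\<not> x \<^bold>= y)"

definition set_map :: "sterm \<Rightarrow> rel" where
  "set_map F = (\<lambda>x y. \<^bold>\<langle>x, y\<^bold>\<rangle> \<^bold>\<in> F)"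

definition seq_map :: "nterm \<Rightarrow> rel" where
  "seq_map s = (\<lambda>i y. \<^bold>\<langle>i, y\<^bold>\<rangle> \<^bold>\<epsilon> s)"

definition omega :: ord where
  "omega = Ord (\<lambda>x. x \<^bold>= x) (\<lambda>x y. x \<^bold>< y)"

definition nat_ord :: "nterm \<Rightarrow> ord" where
  "nat_ord b = Ord (\<lambda>x. x \<^bold>< b) (\<lambda>x y. x \<^bold>< y \<^bold>\<and> y \<^bold>< b)"

text \<open>\<open>s\<close> is a morphism from \<open>m\<close> to \<open>n\<close> in the category Nat.\<close>

definition mor :: "nterm \<Rightarrow> nterm \<Rightarrow> nterm \<Rightarrow> frm" where
  "mor m n s = (finseq s \<^bold>\<and> embedding (nat_ord m) (nat_ord n) (seq_map s))"

text \<open>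
  Universal properties of pullback squares, \<open>f\<close> after \<open>p\<close> being equal to \<open>g\<close> after \<open>q\<close>, with
  test objects from Nat and from LO, respectively.
\<close>

definition pullback_Nat ::
  "nterm \<Rightarrow> nterm \<Rightarrow> nterm \<Rightarrow> nterm \<Rightarrow> nterm \<Rightarrow> nterm \<Rightarrow> nterm \<Rightarrow> nterm \<Rightarrow> frm" where
  "pullback_Nat l a b c p q f g =
     (mor l a p \<^bold>\<and> mor l b q \<^bold>\<and> mor a c f \<^bold>\<and> mor b c g
     \<^bold>\<and> same (compose (seq_map p) (seq_map f)) (compose (seq_map q) (seq_map g))
     \<^bold>\<and> (\<^bold>\<forall>x h k. mor x a h \<^bold>\<and> mor x b k
          \<^bold>\<and> same (compose (seq_map h) (seq_map f)) (compose (seq_map k) (seq_map g)) \<^bold>\<longrightarrow>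
          (\<^bold>\<exists>\<^bold>!u. mor x l u
             \<^bold>\<and> same (compose (seq_map u) (seq_map p)) (seq_map h)
             \<^bold>\<and> same (compose (seq_map u) (seq_map q)) (seq_map k))))"

definition pullback_LO ::
  "ord \<Rightarrow> ord \<Rightarrow> ord \<Rightarrow> ord \<Rightarrow> rel \<Rightarrow> rel \<Rightarrow> rel \<Rightarrow> rel \<Rightarrow> frm" where
  "pullback_LO L A B C p q f g =
     (embedding L A p \<^bold>\<and> embedding L B q \<^bold>\<and> embedding A C f \<^bold>\<and> embedding B C g
     \<^bold>\<and> same (compose p f) (compose q g)
     \<^bold>\<and> (\<^bold>\<forall>\<^sub>S X H K. linear_order (set_ord X)
          \<^bold>\<and> embedding (set_ord X) A (set_map H) \<^bold>\<and> embedding (set_ord X) B (set_map K)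
          \<^bold>\<and> same (compose (set_map H) f) (compose (set_map K) g) \<^bold>\<longrightarrow>
          (let fits = (\<lambda>U. embedding (set_ord X) L (set_map U)
                 \<^bold>\<and> same (compose (set_map U) p) (set_map H)
                 \<^bold>\<and> same (compose (set_map U) q) (set_map K))
           in \<^bold>\<exists>\<^sub>S U. fits U \<^bold>\<and> (\<^bold>\<forall>\<^sub>S V. fits V \<^bold>\<longrightarrow> same (set_map V) (set_map U)))))"

section \<open>Goodstein dilators\<close>

text \<open>
  A set \<open>D\<close> codes a functor: \<open>(0, (b, \<sigma>)) \<in> D\<close> means \<open>\<sigma> \<in> D(b)\<close>, and for a morphism
  \<open>f : m \<rightarrow> n\<close> given by the sequence \<open>s\<close>, \<open>(1, ((s, n), (\<sigma>, \<tau>))) \<in> D\<close> means \<open>D(f)(\<sigma>) = \<tau>\<close>.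
  Note that \<open>s\<close> determines \<open>m\<close> but not \<open>n\<close>. Each \<open>D(b)\<close> carries the usual order of numbers.
\<close>

definition in_D :: "sterm \<Rightarrow> nterm \<Rightarrow> nterm \<Rightarrow> frm" where
  "in_D D b \<sigma> = (\<^bold>\<langle>\<^bold>0, \<^bold>\<langle>b, \<sigma>\<^bold>\<rangle>\<^bold>\<rangle> \<^bold>\<in> D)"

definition D_ord :: "sterm \<Rightarrow> nterm \<Rightarrow> ord" where
  "D_ord D b = Ord (in_D D b) (\<lambda>\<sigma> \<tau>. in_D D b \<sigma> \<^bold>\<and> in_D D b \<tau> \<^bold>\<and> \<sigma> \<^bold>< \<tau>)"

definition D_map :: "sterm \<Rightarrow> nterm \<Rightarrow> nterm \<Rightarrow> rel" where
  "D_map D n s = (\<lambda>\<sigma> \<tau>. \<^bold>\<langle>\<^bold>1, \<^bold>\<langle>\<^bold>\<langle>s, n\<^bold>\<rangle>, \<^bold>\<langle>\<sigma>, \<tau>\<^bold>\<rangle>\<^bold>\<rangle>\<^bold>\<rangle> \<^bold>\<in> D)"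

definition functor_Nat_LO :: "sterm \<Rightarrow> frm" where
  "functor_Nat_LO D =
     ((\<^bold>\<forall>b. linear_order (D_ord D b))
     \<^bold>\<and> (\<^bold>\<forall>m n s. mor m n s \<^bold>\<longrightarrow> embedding (D_ord D m) (D_ord D n) (D_map D n s))
     \<^bold>\<and> (\<^bold>\<forall>m s. mor m m s \<^bold>\<and> (\<^bold>\<forall>i. i \<^bold>< m \<^bold>\<longrightarrow> seq_map s i i) \<^bold>\<longrightarrow>
          (\<^bold>\<forall>\<sigma>. in_D D m \<sigma> \<^bold>\<longrightarrow> D_map D m s \<sigma> \<sigma>))
     \<^bold>\<and> (\<^bold>\<forall>k m n s t u. mor k m s \<^bold>\<and> mor m n t \<^bold>\<and> mor k n u
          \<^bold>\<and> same (seq_map u) (compose (seq_map s) (seq_map t)) \<^bold>\<longrightarrow>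
          same (D_map D n u) (compose (D_map D m s) (D_map D n t))))"

definition preserves_pullbacks :: "sterm \<Rightarrow> frm" where
  "preserves_pullbacks D =
     (\<^bold>\<forall>l a b c p q f g. pullback_Nat l a b c p q f g \<^bold>\<longrightarrow>
        pullback_LO (D_ord D l) (D_ord D a) (D_ord D b) (D_ord D c)
          (D_map D a p) (D_map D b q) (D_map D c f) (D_map D c g))"

text \<open>In the last clause, \<open>mor \<^bold>0 b s\<close> forces \<open>s\<close> to be the empty function.\<close>

definition goodstein_dilator :: "sterm \<Rightarrow> frm" where
  "goodstein_dilator D =
     (functor_Nat_LO D
     \<^bold>\<and> (\<^bold>\<forall>b \<sigma> \<tau>. in_D D b \<sigma> \<^bold>\<and> \<tau> \<^bold>< \<sigma> \<^bold>\<longrightarrow> in_D D b \<tau>)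
     \<^bold>\<and> preserves_pullbacks D
     \<^bold>\<and> in_D D \<^bold>0 \<^bold>0
     \<^bold>\<and> (\<^bold>\<forall>b s. mor \<^bold>0 b s \<^bold>\<longrightarrow> D_map D b s \<^bold>0 \<^bold>0))"

section \<open>Supports and the extension of a dilator\<close>

text \<open>The set \<open>S\<close> codes a family of functions; \<open>supp D S n \<sigma> a\<close> means \<open>supp_n(\<sigma>) = a\<close>.\<close>

definition supp :: "sterm \<Rightarrow> sterm \<Rightarrow> nterm \<Rightarrow> nterm \<Rightarrow> nterm \<Rightarrow> frm" where
  "supp D S n \<sigma> a = (in_D D n \<sigma> \<^bold>\<and> finset a \<^bold>\<and> \<^bold>\<langle>n, \<^bold>\<langle>\<sigma>, a\<^bold>\<rangle>\<^bold>\<rangle> \<^bold>\<in> S)"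

definition support_transformation :: "sterm \<Rightarrow> sterm \<Rightarrow> frm" where
  "support_transformation D S =
     ((\<^bold>\<forall>n \<sigma>. in_D D n \<sigma> \<^bold>\<longrightarrow> (\<^bold>\<exists>\<^bold>!a. supp D S n \<sigma> a))
     \<^bold>\<and> (\<^bold>\<forall>n \<sigma> a x. supp D S n \<sigma> a \<^bold>\<and> x \<^bold>\<epsilon> a \<^bold>\<longrightarrow> x \<^bold>< n)
     \<^bold>\<and> (\<^bold>\<forall>m n s \<sigma> \<tau> a b. mor m n s \<^bold>\<and> D_map D n s \<sigma> \<tau> \<^bold>\<and> supp D S m \<sigma> a \<^bold>\<and> supp D S n \<tau> b \<^bold>\<longrightarrow>
          (\<^bold>\<forall>y. y \<^bold>\<epsilon> b \<^bold>\<longleftrightarrow> (\<^bold>\<exists>x. x \<^bold>\<epsilon> a \<^bold>\<and> seq_map s x y)))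
     \<^bold>\<and> (\<^bold>\<forall>m n s \<tau> b. mor m n s \<^bold>\<and> supp D S n \<tau> b
          \<^bold>\<and> (\<^bold>\<forall>y. y \<^bold>\<epsilon> b \<^bold>\<longrightarrow> (\<^bold>\<exists>x. seq_map s x y)) \<^bold>\<longrightarrow>
          (\<^bold>\<exists>\<sigma>. D_map D n s \<sigma> \<tau>)))"

text \<open>
  \<open>enum X a l e\<close> says that \<open>a\<close> is a finite subset of \<open>X\<close>, that \<open>|a| = l\<close>, and that \<open>e\<close> is the
  isomorphism from \<open>|a|\<close> to \<open>a\<close>; \<open>incl X a c l n s\<close> says that \<open>s\<close> is \<open>|\<iota>|\<close> for the inclusion
  \<open>\<iota>\<close> of \<open>a\<close> in \<open>c\<close>, where \<open>|a| = l\<close> and \<open>|c| = n\<close>.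
\<close>

definition enum :: "ord \<Rightarrow> nterm \<Rightarrow> nterm \<Rightarrow> nterm \<Rightarrow> frm" where
  "enum X a l e = (finset a \<^bold>\<and> finseq e \<^bold>\<and> embedding (nat_ord l) X (seq_map e)
     \<^bold>\<and> (\<^bold>\<forall>x. x \<^bold>\<epsilon> a \<^bold>\<longleftrightarrow> (\<^bold>\<exists>i. seq_map e i x)))"

definition incl :: "ord \<Rightarrow> nterm \<Rightarrow> nterm \<Rightarrow> nterm \<Rightarrow> nterm \<Rightarrow> nterm \<Rightarrow> frm" where
  "incl X a c l n s = (mor l n s \<^bold>\<and> (\<^bold>\<exists>e e'. enum X a l e \<^bold>\<and> enum X c n e'
     \<^bold>\<and> same (compose (seq_map s) (seq_map e')) (seq_map e)))"

definition ext_elt :: "sterm \<Rightarrow> sterm \<Rightarrow> ord \<Rightarrow> nterm \<Rightarrow> frm" where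
  "ext_elt D S X x = (\<^bold>\<exists>a \<sigma> l e w. x \<^bold>= \<^bold>\<langle>a, \<sigma>\<^bold>\<rangle> \<^bold>\<and> enum X a l e \<^bold>\<and> supp D S l \<sigma> w
     \<^bold>\<and> (\<^bold>\<forall>i. i \<^bold>\<epsilon> w \<^bold>\<longleftrightarrow> i \<^bold>< l))"

definition ext_less :: "sterm \<Rightarrow> sterm \<Rightarrow> ord \<Rightarrow> rel" where
  "ext_less D S X = (\<lambda>x y. ext_elt D S X x \<^bold>\<and> ext_elt D S X y
     \<^bold>\<and> (\<^bold>\<exists>a \<sigma> b \<tau> c k l n s t \<sigma>' \<tau>'. x \<^bold>= \<^bold>\<langle>a, \<sigma>\<^bold>\<rangle> \<^bold>\<and> y \<^bold>= \<^bold>\<langle>b, \<tau>\<^bold>\<rangle>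
          \<^bold>\<and> finset c \<^bold>\<and> (\<^bold>\<forall>z. z \<^bold>\<epsilon> c \<^bold>\<longleftrightarrow> z \<^bold>\<epsilon> a \<^bold>\<or> z \<^bold>\<epsilon> b)
          \<^bold>\<and> incl X a c k n s \<^bold>\<and> D_map D n s \<sigma> \<sigma>'
          \<^bold>\<and> incl X b c l n t \<^bold>\<and> D_map D n t \<tau> \<tau>'
          \<^bold>\<and> \<sigma>' \<^bold>< \<tau>'))"

definition extension :: "sterm \<Rightarrow> sterm \<Rightarrow> ord \<Rightarrow> ord" where
  "extension D S X = Ord (ext_elt D S X) (ext_less D S X)"

definition well_founded :: "ord \<Rightarrow> frm" where
  "well_founded A = (\<^bold>\<not> (\<^bold>\<exists>\<^sub>S F. is_function omega A (set_map F)
     \<^bold>\<and> (\<^bold>\<forall>i x y. set_map F i x \<^bold>\<and> set_map F (i \<^bold>+ \<^bold>1) y \<^bold>\<longrightarrow> lss A y x)))"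

text \<open>\<open>S\<close> is determined by \<open>D\<close> up to irrelevant elements.\<close>

definition extension_omega_wf :: "sterm \<Rightarrow> frm" where
  "extension_omega_wf D =
     (\<^bold>\<exists>\<^sub>S S. support_transformation D S \<^bold>\<and> well_founded (extension D S omega))"

section \<open>Goodstein sequences\<close>

text \<open>
  \<open>goodstein_seq D B m G\<close> says that \<open>G\<close> is the sequence for \<open>D\<close>, the function \<open>b\<close> coded by \<open>B\<close>,
  and \<open>m\<close>. Subtraction is truncated: \<open>y\<close> is the predecessor of \<open>z\<close>, or \<open>y = z = 0\<close>.
\<close>

definition goodstein_seq :: "sterm \<Rightarrow> sterm \<Rightarrow> nterm \<Rightarrow> sterm \<Rightarrow> frm" where
  "goodstein_seq D B m G =
     (is_function omega omega (set_map G)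
     \<^bold>\<and> set_map G \<^bold>0 m
     \<^bold>\<and> (\<^bold>\<forall>i x y. set_map G i x \<^bold>\<and> set_map G (i \<^bold>+ \<^bold>1) y \<^bold>\<longrightarrow>
          (x \<^bold>= \<^bold>0 \<^bold>\<and> y \<^bold>= \<^bold>0)
          \<^bold>\<or> (\<^bold>\<not> x \<^bold>= \<^bold>0 \<^bold>\<and> (\<^bold>\<exists>p q c z. set_map B i p \<^bold>\<and> set_map B (i \<^bold>+ \<^bold>1) q
                \<^bold>\<and> mor p q c \<^bold>\<and> (\<^bold>\<forall>n. n \<^bold>< p \<^bold>\<longrightarrow> seq_map c n n) \<^bold>\<and> D_map D q c x z
                \<^bold>\<and> (z \<^bold>= y \<^bold>+ \<^bold>1 \<^bold>\<or> (z \<^bold>= \<^bold>0 \<^bold>\<and> y \<^bold>= \<^bold>0))))))"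

text \<open>The sequence is given by primitive recursion, so \<open>G\<close> exists and is unique.\<close>

definition extended_goodstein :: "sterm \<Rightarrow> frm" where
  "extended_goodstein D =
     (\<^bold>\<forall>\<^sub>S B. \<^bold>\<forall>m. is_function omega omega (set_map B)
        \<^bold>\<and> (\<^bold>\<forall>i j x y. i \<^bold>< j \<^bold>\<and> set_map B i x \<^bold>\<and> set_map B j y \<^bold>\<longrightarrow> x \<^bold>< y \<^bold>\<or> x \<^bold>= y)
        \<^bold>\<and> (\<^bold>\<exists>x. set_map B \<^bold>0 x \<^bold>\<and> \<^bold>0 \<^bold>< x \<^bold>\<and> in_D D x m) \<^bold>\<longrightarrow>
        (\<^bold>\<exists>\<^sub>S G. goodstein_seq D B m G \<^bold>\<and> (\<^bold>\<exists>i. set_map G i \<^bold>0)))"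

end

theory Submission
  imports Defs "HOL-Library.Countable"
begin

text \<open>
  By Henkin's completeness theorem for the calculus it suffices to verify the sentence in an
  arbitrary, possibly nonstandard, model of RCA0. There one argues as in ordinary mathematics, except
  that induction and the formation of sets have to be justified by the recursive or recursively
  enumerable form of the predicates at hand.

  For a dilator \<open>D\<close>, preservation of pullbacks implies that \<open>\<sigma> \<in> D(n)\<close> lies in the ranges of
  \<open>D(f)\<close> and \<open>D(g)\<close> iff it lies in the range of \<open>D(h)\<close>, where the range of \<open>h\<close> is the intersection
  of those of \<open>f\<close> and \<open>g\<close>. Hence the support of \<open>\<sigma>\<close> consists of the \<open>y < n\<close> such that \<open>\<sigma>\<close> is not
  in the range of \<open>D(f)\<close> for the map \<open>f\<close> that skips \<open>y\<close>. If a Goodstein sequence never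
  reaches 0, the normal forms of its values descend in the extension of \<open>D\<close> to the natural numbers.
  Conversely, a descending sequence of elements \<open>F(i)\<close> of the extension is realised in the orders
  \<open>D(b(i))\<close>, where \<open>b(i)\<close> bounds the \<open>F(j)\<close> with \<open>j \<le> i\<close>, and the Goodstein sequence for \<open>b\<close>
  that starts at the value of \<open>F(0)\<close> stays above the values of the \<open>F(i)\<close>, which are positive.
\<close>

section \<open>Completeness of the calculus\<close>

subsection \<open>Substitution\<close>

text \<open>Only Sigma01 induction and Delta01 comprehension are at hand, and two devices keep the
  argument within them. Inside the model, too, an embedding of initial segments never maps an
  element below itself. A preimage under D(f) is therefore bounded by its image, membership in a
  range is decided by bounded search, and the supports form a recursive family. This keeps the
  induction formula Sigma01 and avoids intersecting a possibly nonstandard number of ranges. Let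
  t(i) be the value of F(i) in D(b(i)), let g be the Goodstein sequence and c_i the inclusion. The
  comparison is t(i+1) < D(c_i)(t(i)) \<le> D(c_i)(g(i)) = g(i+1) + 1. Since D(c_i) maps 0 to 0, the
  first inequality excludes t(i) = 0, and it also shows that the subtraction of 1 is not truncated.
  Models form a type class, so that facts about ordered semirings apply to nonstandard
  numbers.\<close>

lemma subst_tm_comp: "subst_tm \<sigma> (subst_tm \<tau> t) = subst_tm (\<lambda>i. subst_tm \<sigma> (\<tau> i)) t"
  by (induction t) auto

lemma subst_comp:
  "subst \<sigma> \<rho> (subst \<tau> \<pi> p) = subst (\<lambda>i. subst_tm \<sigma> (\<tau> i)) (\<lambda>i. \<rho> (\<pi> i)) p"
proof (induction p arbitrary: \<sigma> \<rho> \<tau> \<pi>)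
  case (AllN p)
  have "(\<lambda>i. subst_tm (case_nat (Var 0) (\<lambda>i. shift_tm (\<sigma> i))) (case_nat (Var 0) (\<lambda>i. shift_tm (\<tau> i)) i))
      = case_nat (Var 0) (\<lambda>i. shift_tm (subst_tm \<sigma> (\<tau> i)))"
    by (rule ext) (simp add: subst_tm_comp split: nat.split)
  then show ?case by (simp add: AllN)
next
  case (AllS p)
  have "(\<lambda>i. case_nat 0 (\<lambda>i. Suc (\<rho> i)) (case_nat 0 (\<lambda>i. Suc (\<pi> i)) i))
      = case_nat 0 (\<lambda>i. Suc (\<rho> (\<pi> i)))"
    by (rule ext) (simp split: nat.split)
  then show ?case by (simp add: AllS)
qed (auto simp: subst_tm_comp)

lemma subst_tm_cong:
  "closed_tm k t \<Longrightarrow> (\<And>i. i < k \<Longrightarrow> \<sigma> i = \<tau> i) \<Longrightarrow> subst_tm \<sigma> t = subst_tm \<tau> t"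
  by (induction t) auto

lemma subst_cong:
  "closed_fm k l p \<Longrightarrow> (\<And>i. i < k \<Longrightarrow> \<sigma> i = \<tau> i) \<Longrightarrow> (\<And>i. i < l \<Longrightarrow> \<rho> i = \<pi> i)
    \<Longrightarrow> subst \<sigma> \<rho> p = subst \<tau> \<pi> p"
proof (induction p arbitrary: k l \<sigma> \<rho> \<tau> \<pi>)
  case (Imp p q)
  have "subst \<sigma> \<rho> p = subst \<tau> \<pi> p"
    by (rule Imp.IH(1)[of k l]) (use Imp.prems in simp_all)
  moreover have "subst \<sigma> \<rho> q = subst \<tau> \<pi> q"
    by (rule Imp.IH(2)[of k l]) (use Imp.prems in simp_all)
  ultimately show ?case by simp
next
  case (AllN p)
  show ?case unfolding subst.simps fm.inject
    by (rule AllN.IH[of "Suc k" l]) (use AllN.prems in \<open>simp_all split: nat.split\<close>)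
next
  case (AllS p)
  show ?case unfolding subst.simps fm.inject
    by (rule AllS.IH[of k "Suc l"]) (use AllS.prems in \<open>simp_all split: nat.split\<close>)
qed (simp_all, (metis subst_tm_cong)+)

lemma subst_tm_Var [simp]: "subst_tm Var t = t"
  by (induction t) auto

lemma subst_Var [simp]: "subst Var (\<lambda>i. i) p = p"
proof (induction p)
  case (AllN p)
  have "case_nat (Var 0) (\<lambda>i. shift_tm (Var i)) = Var"
    by (rule ext) (simp split: nat.split)
  with AllN show ?case by simp
next
  case (AllS p)
  have "case_nat 0 (\<lambda>i. Suc i) = (\<lambda>i. i)"
    by (rule ext) (simp split: nat.split)
  with AllS show ?case by simp
qed auto

lemma subst_closed: "closed_fm 0 0 p \<Longrightarrow> subst \<sigma> \<rho> p = p"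
  using subst_cong[of 0 0 p \<sigma> Var \<rho> "\<lambda>i. i"] by simp

lemma closed_tm_mono: "closed_tm k t \<Longrightarrow> k \<le> k' \<Longrightarrow> closed_tm k' t"
  by (induction t) auto

lemma closed_fm_mono: "closed_fm k l p \<Longrightarrow> k \<le> k' \<Longrightarrow> l \<le> l' \<Longrightarrow> closed_fm k' l' p"
proof (induction p arbitrary: k l k' l')
  case (AllN p)
  then show ?case using AllN.IH[of "Suc k" l "Suc k'" l'] by simp
next
  case (AllS p)
  then show ?case using AllS.IH[of k "Suc l" k' "Suc l'"] by simp
next
  case (Imp p q)
  then show ?case using Imp.IH[of k l k' l'] by simp
qed (auto elim: closed_tm_mono)

text \<open>Arguing with "eventually" combines the bounds for subterms and subformulas without
  computing maxima.\<close>

lemma eventually_closed_tm: "\<forall>\<^sub>F k in sequentially. closed_tm k t"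
  by (induction t) (auto simp: eventually_conj_iff eventually_gt_at_top)

lemma eventually_closed_fm: "\<forall>\<^sub>F k in sequentially. closed_fm k k p"
proof (induction p)
  case (AllN p)
  then show ?case by (rule eventually_mono) (auto elim: closed_fm_mono)
next
  case (AllS p)
  then show ?case by (rule eventually_mono) (auto elim: closed_fm_mono)
qed (auto simp: eventually_conj_iff eventually_closed_tm eventually_gt_at_top)

lemma ex_closed_fm: "finite F \<Longrightarrow> \<exists>k. \<forall>p\<in>F. closed_fm k k p"
  by (rule eventually_happens'[OF sequentially_bot])
    (simp add: eventually_ball_finite eventually_closed_fm)

lemma case_nat_comp: "(\<lambda>i. f (case_nat a g i)) = case_nat (f a) (\<lambda>i. f (g i))"
  by (rule ext) (simp split: nat.split)

lemma instN_subst: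
  "instN t (subst (case_nat (Var 0) (\<lambda>i. shift_tm (\<sigma> i))) \<rho> p) = subst (case_nat t \<sigma>) \<rho> p"
proof -
  have "(\<lambda>i. subst_tm (case_nat t Var) (case_nat (Var 0) (\<lambda>i. shift_tm (\<sigma> i)) i)) = case_nat t \<sigma>"
    by (rule ext) (simp add: subst_tm_comp split: nat.split)
  then show ?thesis by (simp add: instN_def subst_comp)
qed

lemma instS_subst:
  "instS X (subst \<sigma> (case_nat 0 (\<lambda>i. Suc (\<rho> i))) p) = subst \<sigma> (case_nat X \<rho>) p"
proof -
  have "(\<lambda>i. case_nat X id (case_nat 0 (\<lambda>i. Suc (\<rho> i)) i)) = case_nat X \<rho>"
    by (rule ext) (simp split: nat.split)
  then show ?thesis by (simp add: instS_def subst_comp)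
qed

lemma subst_instN: "subst \<sigma> \<rho> (instN t p) = subst (case_nat (subst_tm \<sigma> t) \<sigma>) \<rho> p"
  by (simp add: instN_def subst_comp case_nat_comp cong: nat.case_cong)

lemma subst_instS: "subst \<sigma> \<rho> (instS X p) = subst \<sigma> (case_nat (\<rho> X) \<rho>) p"
  by (simp add: instS_def subst_comp case_nat_comp cong: nat.case_cong)

subsection \<open>Derivability\<close>

lemma proves_mono: "\<Gamma> \<turnstile> p \<Longrightarrow> \<Gamma> \<subseteq> \<Delta> \<Longrightarrow> \<Delta> \<turnstile> p"
proof (induction arbitrary: \<Delta> rule: proves.induct)
  case (ImpI p \<Gamma> q)
  then show ?case by (auto intro!: proves.ImpI)
next
  case (RAA p \<Gamma>)
  then show ?case by (auto intro!: proves.RAA[of p])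
next
  case (AllNI \<Gamma> p)
  then show ?case by (auto intro!: proves.AllNI)
next
  case (AllSI \<Gamma> p)
  then show ?case by (auto intro!: proves.AllSI)
qed (blast intro: proves.intros)+

text \<open>Serves to replace a fresh free variable by the bound variable of a quantifier rule. In
  the quantifier cases the substitution lifted under the binder commutes with the shift of the
  context.\<close>

lemma proves_subst: "\<Gamma> \<turnstile> p \<Longrightarrow> subst \<sigma> \<rho> ` \<Gamma> \<turnstile> subst \<sigma> \<rho> p"
proof (induction arbitrary: \<sigma> \<rho> rule: proves.induct)
  case (ImpI p \<Gamma> q)
  then show ?case by (simp add: proves.ImpI)
next
  case (ImpE \<Gamma> p q)
  then show ?case by (simp, metis proves.ImpE)
next
  case (RAA p \<Gamma>)
  then show ?case by (simp add: proves.RAA)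
next
  case (AllNI \<Gamma> p)
  let ?s = "case_nat (Var 0) (\<lambda>i. shift_tm (\<sigma> i))"
  have "subst ?s \<rho> ` shiftN ` \<Gamma> = shiftN ` subst \<sigma> \<rho> ` \<Gamma>"
    by (simp add: image_comp shiftN_def subst_comp comp_def)
  with AllNI.IH[of ?s \<rho>] show ?case by (simp add: proves.AllNI)
next
  case (AllNE \<Gamma> p t)
  then show ?case
    using proves.AllNE[of _ "subst (case_nat (Var 0) (\<lambda>i. shift_tm (\<sigma> i))) \<rho> p" "subst_tm \<sigma> t"]
    by (simp add: subst_instN instN_subst)
next
  case (AllSI \<Gamma> p)
  let ?r = "case_nat 0 (\<lambda>i. Suc (\<rho> i))"
  have "subst \<sigma> ?r ` shiftS ` \<Gamma> = shiftS ` subst \<sigma> \<rho> ` \<Gamma>"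
    by (simp add: image_comp shiftS_def subst_comp comp_def)
  with AllSI.IH[of \<sigma> ?r] show ?case by (simp add: proves.AllSI)
next
  case (AllSE \<Gamma> p X)
  then show ?case
    using proves.AllSE[of _ "subst \<sigma> (case_nat 0 (\<lambda>i. Suc (\<rho> i))) p" "\<rho> X"]
    by (simp add: subst_instS instS_subst)
next
  case (EqE \<Gamma> s t p)
  then show ?case
    using proves.EqE[of _ "subst_tm \<sigma> s" "subst_tm \<sigma> t" "subst (case_nat (Var 0) (\<lambda>i. shift_tm (\<sigma> i))) \<rho> p"]
    by (simp add: subst_instN instN_subst)
qed (auto intro: proves.intros)

lemma proves_finite: "\<Gamma> \<turnstile> p \<Longrightarrow> \<exists>F. finite F \<and> F \<subseteq> \<Gamma> \<and> F \<turnstile> p"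
proof (induction rule: proves.induct)
  case (Assm p \<Gamma>)
  then show ?case by (intro exI[of _ "{p}"]) (auto intro: proves.Assm)
next
  case (ImpI p \<Gamma> q)
  then obtain F where "finite F" "F \<subseteq> insert p \<Gamma>" "F \<turnstile> q" by blast
  then show ?case
    by (intro exI[of _ "F - {p}"]) (auto intro!: proves.ImpI elim!: proves_mono)
next
  case (ImpE \<Gamma> p q)
  then obtain F G where "finite F" "F \<subseteq> \<Gamma>" "F \<turnstile> Imp p q" "finite G" "G \<subseteq> \<Gamma>" "G \<turnstile> p" by blast
  then show ?case
    by (intro exI[of _ "F \<union> G"])
      (auto intro!: proves.ImpE[of "F \<union> G" p q] elim: proves_mono)
next
  case (RAA p \<Gamma>)
  then obtain F where "finite F" "F \<subseteq> insert (Neg p) \<Gamma>" "F \<turnstile> Fls" by blast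
  then show ?case
    by (intro exI[of _ "F - {Neg p}"]) (auto intro!: proves.RAA[of p] elim!: proves_mono)
next
  case (AllNI \<Gamma> p)
  then obtain F where "finite F" "F \<subseteq> shiftN ` \<Gamma>" "F \<turnstile> p" by blast
  then show ?case by (metis finite_subset_image proves.AllNI)
next
  case (AllSI \<Gamma> p)
  then obtain F where "finite F" "F \<subseteq> shiftS ` \<Gamma>" "F \<turnstile> p" by blast
  then show ?case by (metis finite_subset_image proves.AllSI)
next
  case (EqE \<Gamma> s t p)
  then obtain F G where "finite F" "F \<subseteq> \<Gamma>" "F \<turnstile> Eq s t" "finite G" "G \<subseteq> \<Gamma>" "G \<turnstile> instN s p" by blast
  then show ?case
    by (intro exI[of _ "F \<union> G"])
      (auto intro!: proves.EqE[of "F \<union> G" s t p] elim: proves_mono)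
next
  case (EqI \<Gamma> t)
  then show ?case by (intro exI[of _ "{}"]) (auto intro: proves.EqI)
qed (blast intro: proves.intros)+

text \<open>The substitution that sends index \<open>k\<close> to 0 and shifts all others acts on
  the context like the shift of rule \<open>AllNI\<close>, because \<open>k\<close> does not occur
  there, and it undoes the instantiation of \<open>p\<close>.\<close>

lemma AllN_fresh:
  assumes "\<Gamma> \<turnstile> instN (Var k) p" "\<And>q. q \<in> \<Gamma> \<Longrightarrow> closed_fm k l q" "closed_fm k l p"
  shows "\<Gamma> \<turnstile> AllN p"
proof -
  let ?\<sigma> = "\<lambda>i. if i = k then Var 0 else Var (Suc i)"
  have "subst ?\<sigma> id q = shiftN q" if "q \<in> \<Gamma>" for q
    unfolding shiftN_def using assms(2)[OF that] by (rule subst_cong) auto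
  then have "subst ?\<sigma> id ` \<Gamma> = shiftN ` \<Gamma>" by simp
  moreover have "subst ?\<sigma> id (instN (Var k) p) = subst Var (\<lambda>i. i) p"
    unfolding instN_def subst_comp
    by (rule subst_cong[OF assms(3)]) (auto split: nat.split)
  ultimately have "shiftN ` \<Gamma> \<turnstile> p"
    using proves_subst[OF assms(1), of ?\<sigma> id] by simp
  then show ?thesis by (rule proves.AllNI)
qed

lemma AllS_fresh:
  assumes "\<Gamma> \<turnstile> instS X p" "\<And>q. q \<in> \<Gamma> \<Longrightarrow> closed_fm k X q" "closed_fm k X p"
  shows "\<Gamma> \<turnstile> AllS p"
proof -
  let ?\<rho> = "\<lambda>i. if i = X then 0 else Suc i"
  have "subst Var ?\<rho> q = shiftS q" if "q \<in> \<Gamma>" for q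
    unfolding shiftS_def using assms(2)[OF that] by (rule subst_cong) auto
  then have "subst Var ?\<rho> ` \<Gamma> = shiftS ` \<Gamma>" by simp
  moreover have "subst Var ?\<rho> (instS X p) = subst Var (\<lambda>i. i) p"
    unfolding instS_def subst_comp
    by (rule subst_cong[OF assms(3)]) (auto split: nat.split)
  ultimately have "shiftS ` \<Gamma> \<turnstile> p"
    using proves_subst[OF assms(1), of Var ?\<rho>] by simp
  then show ?thesis by (rule proves.AllSI)
qed

subsection \<open>Saturated sets\<close>

instance tm :: countable by countable_datatype
instance fm :: countable by countable_datatype

definition consistent :: "fm set \<Rightarrow> bool" where
  "consistent \<Gamma> \<longleftrightarrow> \<not> \<Gamma> \<turnstile> Fls"

lemma consistent_insert:
  "\<not> \<Gamma> \<turnstile> p \<Longrightarrow> consistent (insert (Neg p) \<Gamma>)"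
  unfolding consistent_def using proves.RAA by blast

lemma proves_cut: "\<Gamma> \<turnstile> p \<Longrightarrow> insert p \<Gamma> \<turnstile> q \<Longrightarrow> \<Gamma> \<turnstile> q"
  by (rule proves.ImpE[OF proves.ImpI])

text \<open>A rejected universal formula must come with a refuted instance. This is Henkin's witness
  property, on which the quantifier clauses of the truth lemma depend.\<close>

definition decides :: "fm set \<Rightarrow> fm \<Rightarrow> bool" where
  "decides \<Delta> p \<longleftrightarrow> (p \<in> \<Delta> \<or> Neg p \<in> \<Delta>)
    \<and> (\<forall>q. p = AllN q \<longrightarrow> p \<in> \<Delta> \<or> (\<exists>t. Neg (instN t q) \<in> \<Delta>))
    \<and> (\<forall>q. p = AllS q \<longrightarrow> p \<in> \<Delta> \<or> (\<exists>X. Neg (instS X q) \<in> \<Delta>))"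

definition saturated :: "fm set \<Rightarrow> bool" where
  "saturated \<Delta> \<longleftrightarrow> consistent \<Delta> \<and> (\<forall>p. decides \<Delta> p)"

lemma decides_mono: "decides \<Gamma> p \<Longrightarrow> \<Gamma> \<subseteq> \<Delta> \<Longrightarrow> decides \<Delta> p"
  unfolding decides_def by blast

text \<open>Only finitely many open formulas accompany the sentences of \<open>\<Gamma>\<close>, so
  fresh indices exist. If a fresh instance of a universal formula were derivable, so would be the
  formula, against the consistency of its negation.\<close>

lemma ex_decides:
  assumes "\<And>q. q \<in> \<Gamma> \<Longrightarrow> closed_fm 0 0 q" "finite F" "consistent (\<Gamma> \<union> F)"
  shows "\<exists>F'. finite F' \<and> F \<subseteq> F' \<and> consistent (\<Gamma> \<union> F') \<and> decides F' p"
proof (cases "\<Gamma> \<union> F \<turnstile> p")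
  case True
  then have "consistent (\<Gamma> \<union> insert p F)"
    using assms(3) proves_cut unfolding consistent_def by auto
  then show ?thesis using assms(2)
    by (intro exI[of _ "insert p F"]) (auto simp: decides_def)
next
  case nth: False
  let ?G = "insert (Neg p) F"
  have c: "consistent (\<Gamma> \<union> ?G)" using consistent_insert[OF nth] by simp
  obtain k where k: "\<forall>q\<in>insert p ?G. closed_fm k k q"
    using ex_closed_fm[of "insert p ?G"] assms(2) by auto
  have cl: "closed_fm (Suc k) k q" "closed_fm k (Suc k) q" if "q \<in> \<Gamma> \<union> ?G" for q
  proof -
    have "closed_fm k k q"
      using that k closed_fm_mono[OF assms(1)[of q], of k k] by auto
    then show "closed_fm (Suc k) k q" "closed_fm k (Suc k) q"
      by (auto elim: closed_fm_mono)
  qed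
  have np: "\<not> \<Gamma> \<union> ?G \<turnstile> p"
    using c unfolding consistent_def
    by (metis Un_iff insertI1 proves.Assm proves.ImpE)
  consider (N) q where "p = AllN q" | (S) q where "p = AllS q"
    | (other) "\<And>q. p \<noteq> AllN q" "\<And>q. p \<noteq> AllS q" by blast
  then show ?thesis
  proof cases
    case N
    \<comment> \<open>Freshness has to cover the matrix \<open>q\<close>, which may have one more
      free index than \<open>p\<close>; hence \<open>Suc k\<close> instead of
      \<open>k\<close>.\<close>
    have "\<not> \<Gamma> \<union> ?G \<turnstile> instN (Var (Suc k)) q"
    proof
      assume "\<Gamma> \<union> ?G \<turnstile> instN (Var (Suc k)) q"
      moreover have "closed_fm (Suc k) k q" using k N by auto
      ultimately show False using AllN_fresh np N cl by metis
    qed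
    then have "consistent (\<Gamma> \<union> insert (Neg (instN (Var (Suc k)) q)) ?G)"
      using consistent_insert by fastforce
    then show ?thesis using N assms(2)
      by (intro exI[of _ "insert (Neg (instN (Var (Suc k)) q)) ?G"]) (auto simp: decides_def)
  next
    case S
    have "\<not> \<Gamma> \<union> ?G \<turnstile> instS (Suc k) q"
    proof
      assume "\<Gamma> \<union> ?G \<turnstile> instS (Suc k) q"
      moreover have "closed_fm k (Suc k) q" using k S by auto
      ultimately show False using AllS_fresh np S cl by metis
    qed
    then have "consistent (\<Gamma> \<union> insert (Neg (instS (Suc k) q)) ?G)"
      using consistent_insert by fastforce
    then show ?thesis using S assms(2)
      by (intro exI[of _ "insert (Neg (instS (Suc k) q)) ?G"]) (auto simp: decides_def)
  next
    case other
    then show ?thesis using c assms(2)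
      by (intro exI[of _ ?G]) (auto simp: decides_def)
  qed
qed

text \<open>Lindenbaum's construction: each stage decides the next formula of an enumeration at the
  cost of finitely many additions, and a derivation of falsity from the union would already use a
  single stage.\<close>

theorem ex_saturated:
  assumes \<Gamma>: "\<And>q. q \<in> \<Gamma> \<Longrightarrow> closed_fm 0 0 q" "consistent (insert p \<Gamma>)"
  shows "\<exists>\<Delta>. saturated \<Delta> \<and> insert p \<Gamma> \<subseteq> \<Delta>"
proof -
  have "\<exists>F. \<forall>n. (finite (F n) \<and> p \<in> F n \<and> consistent (\<Gamma> \<union> F n))
      \<and> (F n \<subseteq> F (Suc n) \<and> decides (F (Suc n)) (from_nat n))"
  proof (rule dependent_nat_choice)
    show "\<exists>F. finite F \<and> p \<in> F \<and> consistent (\<Gamma> \<union> F)"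
      using \<Gamma>(2) by (intro exI[of _ "{p}"]) simp
  next
    fix F n assume "finite F \<and> p \<in> F \<and> consistent (\<Gamma> \<union> F)"
    then show "\<exists>F'. (finite F' \<and> p \<in> F' \<and> consistent (\<Gamma> \<union> F')) \<and> (F \<subseteq> F' \<and> decides F' (from_nat n))"
      using ex_decides[where \<Gamma> = \<Gamma> and F = F and p = "from_nat n", OF \<Gamma>(1)] by blast
  qed
  then obtain F where pF: "\<And>n. p \<in> F n" and F: "\<And>n. consistent (\<Gamma> \<union> F n)" "\<And>n. F n \<subseteq> F (Suc n)"
    "\<And>n. decides (F (Suc n)) (from_nat n)" by blast
  define \<Delta> where "\<Delta> = (\<Union>n. \<Gamma> \<union> F n)"
  have mono: "F m \<subseteq> F n" if "m \<le> n" for m n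
    using F(2) that by (rule lift_Suc_mono_le)
  have "decides \<Delta> q" for q
    using F(3)[of "to_nat q"] by (auto simp: \<Delta>_def elim!: decides_mono)
  moreover have "consistent \<Delta>"
    unfolding consistent_def
  proof
    assume "\<Delta> \<turnstile> Fls"
    then obtain A where A: "finite A" "A \<subseteq> \<Delta>" "A \<turnstile> Fls" using proves_finite by blast
    have "\<exists>n. A \<subseteq> \<Gamma> \<union> F n" using A(1,2)
    proof (induction rule: finite_induct)
      case (insert a A)
      then obtain m n where "A \<subseteq> \<Gamma> \<union> F m" "a \<in> \<Gamma> \<union> F n" unfolding \<Delta>_def by blast
      then show ?case using mono[of m "max m n"] mono[of n "max m n"]
        by (intro exI[of _ "max m n"]) auto
    qed auto
    then show False using A(3) F(1) proves_mono unfolding consistent_def by blast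
  qed
  ultimately show ?thesis using pF unfolding saturated_def \<Delta>_def by blast
qed

context
  fixes \<Delta> assumes sat: "saturated \<Delta>"
begin

section \<open>Truth conditions in saturated sets\<close>

lemma saturated_closed: "\<Delta> \<turnstile> p \<longleftrightarrow> p \<in> \<Delta>"
  using sat unfolding saturated_def decides_def consistent_def
  by (metis proves.Assm proves.ImpE)

lemma saturated_Fls: "Fls \<notin> \<Delta>"
  using sat unfolding saturated_def consistent_def by (metis proves.Assm)

lemma saturated_Imp: "Imp p q \<in> \<Delta> \<longleftrightarrow> (p \<in> \<Delta> \<longrightarrow> q \<in> \<Delta>)"
proof
  show "Imp p q \<in> \<Delta> \<Longrightarrow> p \<in> \<Delta> \<longrightarrow> q \<in> \<Delta>"
    using saturated_closed by (metis proves.ImpE)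
next
  assume a: "p \<in> \<Delta> \<longrightarrow> q \<in> \<Delta>"
  have "insert p \<Delta> \<turnstile> q"
  proof (cases "p \<in> \<Delta>")
    case True
    then show ?thesis using a by (auto intro: proves.Assm)
  next
    case False
    then have "Neg p \<in> \<Delta>" using sat unfolding saturated_def decides_def by blast
    then have "insert (Neg q) (insert p \<Delta>) \<turnstile> Fls"
      by (intro proves.ImpE[of _ p Fls] proves.Assm) auto
    then show ?thesis by (rule proves.RAA)
  qed
  then show "Imp p q \<in> \<Delta>" using saturated_closed proves.ImpI by blast
qed

lemma saturated_AllN: "AllN p \<in> \<Delta> \<longleftrightarrow> (\<forall>t. instN t p \<in> \<Delta>)"
proof
  show "AllN p \<in> \<Delta> \<Longrightarrow> \<forall>t. instN t p \<in> \<Delta>"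
    using saturated_closed by (metis proves.AllNE)
next
  assume "\<forall>t. instN t p \<in> \<Delta>"
  then show "AllN p \<in> \<Delta>"
    using sat saturated_Imp saturated_Fls unfolding saturated_def decides_def by metis
qed

lemma saturated_AllS: "AllS p \<in> \<Delta> \<longleftrightarrow> (\<forall>X. instS X p \<in> \<Delta>)"
proof
  show "AllS p \<in> \<Delta> \<Longrightarrow> \<forall>X. instS X p \<in> \<Delta>"
    using saturated_closed by (metis proves.AllSE)
next
  assume "\<forall>X. instS X p \<in> \<Delta>"
  then show "AllS p \<in> \<Delta>"
    using sat saturated_Imp saturated_Fls unfolding saturated_def decides_def by metis
qed

lemma saturated_Eq_refl: "Eq t t \<in> \<Delta>"
  using saturated_closed by (metis proves.EqI)

lemma saturated_Eq_subst: "Eq s t \<in> \<Delta> \<Longrightarrow> instN s p \<in> \<Delta> \<Longrightarrow> instN t p \<in> \<Delta>"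
  using saturated_closed by (metis proves.EqE)

text \<open>Here and below, replacement is applied to a formula with \<open>Var 0\<close> at the
  place to be rewritten; the other side is shifted so that the instantiation leaves it
  alone.\<close>

lemma saturated_Eq_sym: "Eq s t \<in> \<Delta> \<Longrightarrow> Eq t s \<in> \<Delta>"
  using saturated_Eq_subst[of s t "Eq (Var 0) (shift_tm s)"] saturated_Eq_refl
  by (simp add: instN_def subst_tm_comp)

lemma saturated_Eq_trans: "Eq s t \<in> \<Delta> \<Longrightarrow> Eq t u \<in> \<Delta> \<Longrightarrow> Eq s u \<in> \<Delta>"
  using saturated_Eq_subst[of t u "Eq (shift_tm s) (Var 0)"]
  by (simp add: instN_def subst_tm_comp)

lemma saturated_Eq_cong:
  "Eq s s' \<in> \<Delta> \<Longrightarrow> Eq (subst_tm (case_nat s Var) u) (subst_tm (case_nat s' Var) u) \<in> \<Delta>"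
  using saturated_Eq_subst[of s s' "Eq (shift_tm (subst_tm (case_nat s Var) u)) u"] saturated_Eq_refl
  by (simp add: instN_def subst_tm_comp)

lemma saturated_Eq_Add: "Eq s s' \<in> \<Delta> \<Longrightarrow> Eq t t' \<in> \<Delta> \<Longrightarrow> Eq (Add s t) (Add s' t') \<in> \<Delta>"
  using saturated_Eq_cong[of s s' "Add (Var 0) (shift_tm t)"]
    saturated_Eq_cong[of t t' "Add (shift_tm s') (Var 0)"]
  by (auto simp: subst_tm_comp intro: saturated_Eq_trans)

lemma saturated_Eq_Mul: "Eq s s' \<in> \<Delta> \<Longrightarrow> Eq t t' \<in> \<Delta> \<Longrightarrow> Eq (Mul s t) (Mul s' t') \<in> \<Delta>"
  using saturated_Eq_cong[of s s' "Mul (Var 0) (shift_tm t)"]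
    saturated_Eq_cong[of t t' "Mul (shift_tm s') (Var 0)"]
  by (auto simp: subst_tm_comp intro: saturated_Eq_trans)

lemma saturated_Less_subst:
  assumes "Eq s s' \<in> \<Delta>" "Eq t t' \<in> \<Delta>" "Less s t \<in> \<Delta>" shows "Less s' t' \<in> \<Delta>"
proof -
  have "Less s' t \<in> \<Delta>"
    using saturated_Eq_subst[OF assms(1), of "Less (Var 0) (shift_tm t)"] assms(3)
    by (simp add: instN_def subst_tm_comp)
  then show ?thesis
    using saturated_Eq_subst[OF assms(2), of "Less (shift_tm s') (Var 0)"]
    by (simp add: instN_def subst_tm_comp)
qed

lemma saturated_Mem_subst: "Eq s t \<in> \<Delta> \<Longrightarrow> Mem s X \<in> \<Delta> \<Longrightarrow> Mem t X \<in> \<Delta>"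
  using saturated_Eq_subst[of s t "Mem (Var 0) X"] by (simp add: instN_def)

end

section \<open>Models of RCA0\<close>

text \<open>The parameter \<open>SS\<close> is the range of the set quantifiers.\<close>

class rca0_ops = zero + one + plus + minus + times + ord +
  fixes SS :: "'a set set"
begin

primrec tval :: "(nat \<Rightarrow> 'a) \<Rightarrow> tm \<Rightarrow> 'a" where
  "tval e (Var i) = e i"
| "tval e Zero = 0"
| "tval e One = 1"
| "tval e (Add s t) = tval e s + tval e t"
| "tval e (Mul s t) = tval e s * tval e t"

primrec sat :: "(nat \<Rightarrow> 'a) \<Rightarrow> (nat \<Rightarrow> 'a set) \<Rightarrow> fm \<Rightarrow> bool" where
  "sat e E Fls \<longleftrightarrow> False"
| "sat e E (Eq s t) \<longleftrightarrow> tval e s = tval e t"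
| "sat e E (Less s t) \<longleftrightarrow> tval e s < tval e t"
| "sat e E (Mem t X) \<longleftrightarrow> tval e t \<in> E X"
| "sat e E (Imp p q) \<longleftrightarrow> (sat e E p \<longrightarrow> sat e E q)"
| "sat e E (AllN p) \<longleftrightarrow> (\<forall>v. sat (case_nat v e) E p)"
| "sat e E (AllS p) \<longleftrightarrow> (\<forall>A\<in>SS. sat e (case_nat A E) p)"

end

text \<open>\<open>\<le>\<close> and truncated subtraction are not in the formal language;
  \<open>le_iff\<close> and \<open>minus_eq\<close> fix them so that the class can be placed below
  \<open>linordered_semidom\<close>. The two schemes speak of formulas because RCA0 restricts the
  complexity of definitions.\<close>

class rca0 = rca0_ops +
  assumes add_one_neq_zero: "x + 1 \<noteq> 0"
    and add_one_inject: "x + 1 = y + 1 \<Longrightarrow> x = y"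
    and add_zero: "x + 0 = x"
    and add_add_one: "x + (y + 1) = (x + y) + 1"
    and mul_zero: "x * 0 = 0"
    and mul_add_one: "x * (y + 1) = x * y + x"
    and not_less_zero: "\<not> x < 0"
    and less_add_one_iff: "x < y + 1 \<longleftrightarrow> x < y \<or> x = y"
    and le_iff: "x \<le> y \<longleftrightarrow> x < y \<or> x = y"
    and minus_eq: "x - y = (if y \<le> x then THE z. z + y = x else 0)"
    and SS_nonempty: "SS \<noteq> {}"
    and sat_induction: "range E \<subseteq> SS \<Longrightarrow> bounded_fm p \<Longrightarrow> sat (case_nat 0 e) E (ExN p)
      \<Longrightarrow> (\<And>x. sat (case_nat x e) E (ExN p) \<Longrightarrow> sat (case_nat (x + 1) e) E (ExN p))
      \<Longrightarrow> sat (case_nat x e) E (ExN p)"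
    and sat_comprehension: "range E \<subseteq> SS \<Longrightarrow> bounded_fm p \<Longrightarrow> bounded_fm q
      \<Longrightarrow> (\<And>x. sat (case_nat x e) E (ExN p) \<longleftrightarrow> sat (case_nat x e) E (AllN q))
      \<Longrightarrow> {x. sat (case_nat x e) E (ExN p)} \<in> SS"

subsection \<open>Evaluation and substitution\<close>

lemma tval_subst: "tval e (subst_tm \<sigma> t) = tval (\<lambda>i. tval e (\<sigma> i)) t"
  by (induction t) auto

lemma sat_subst: "sat e E (subst \<sigma> \<rho> p) \<longleftrightarrow> sat (\<lambda>i. tval e (\<sigma> i)) (\<lambda>i. E (\<rho> i)) p"
proof (induction p arbitrary: e E \<sigma> \<rho>)
  case (AllN p)
  have "(\<lambda>i. tval (case_nat v e) (case_nat (Var 0) (\<lambda>i. shift_tm (\<sigma> i)) i))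
      = case_nat v (\<lambda>i. tval e (\<sigma> i))" for v
    by (rule ext) (simp add: tval_subst split: nat.split)
  then show ?case by (simp add: AllN)
next
  case (AllS p)
  have "(\<lambda>i. case_nat A E (case_nat 0 (\<lambda>i. Suc (\<rho> i)) i)) = case_nat A (\<lambda>i. E (\<rho> i))" for A
    by (rule ext) (simp split: nat.split)
  then show ?case by (simp add: AllS)
qed (simp_all add: tval_subst)

lemma sat_induction_axiom:
  "sat e E (induction_axiom p) \<longleftrightarrow> (sat (case_nat 0 e) E p
    \<and> (\<forall>x. sat (case_nat x e) E p \<longrightarrow> sat (case_nat (x + 1) e) E p) \<longrightarrow> (\<forall>x. sat (case_nat x e) E p))"
  by (auto simp: induction_axiom_def instN_def sat_subst case_nat_comp)

lemma sat_comprehension_axiom: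
  "sat e E (comprehension_axiom p q) \<longleftrightarrow>
    ((\<forall>x. sat (case_nat x e) E p \<longleftrightarrow> sat (case_nat x e) E q)
      \<longrightarrow> (\<exists>A\<in>SS. \<forall>x. x \<in> A \<longleftrightarrow> sat (case_nat x e) E p))"
  by (simp add: comprehension_axiom_def shiftS_def sat_subst) blast

lemma tval_cong: "closed_tm k t \<Longrightarrow> (\<And>i. i < k \<Longrightarrow> e i = e' i) \<Longrightarrow> tval e t = tval e' t"
  by (induction t) auto

lemma sat_cong:
  "closed_fm k l p \<Longrightarrow> (\<And>i. i < k \<Longrightarrow> e i = e' i) \<Longrightarrow> (\<And>i. i < l \<Longrightarrow> E i = E' i)
    \<Longrightarrow> sat e E p \<longleftrightarrow> sat e' E' p"
proof (induction p arbitrary: k l e e' E E')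
  case (Imp p q)
  have "sat e E p \<longleftrightarrow> sat e' E' p"
    by (rule Imp.IH(1)[of k l]) (use Imp.prems in simp_all)
  moreover have "sat e E q \<longleftrightarrow> sat e' E' q"
    by (rule Imp.IH(2)[of k l]) (use Imp.prems in simp_all)
  ultimately show ?case by simp
next
  case (AllN p)
  have "sat (case_nat v e) E p \<longleftrightarrow> sat (case_nat v e') E' p" for v
    by (rule AllN.IH[of "Suc k" l]) (use AllN.prems in \<open>simp_all split: nat.split\<close>)
  then show ?case by simp
next
  case (AllS p)
  have "sat e (case_nat A E) p \<longleftrightarrow> sat e' (case_nat A E') p" for A
    by (rule AllS.IH[of k "Suc l"]) (use AllS.prems in \<open>simp_all split: nat.split\<close>)
  then show ?case by simp
qed (simp_all, (metis tval_cong)+)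

lemma sat_AllN_pow:
  "sat e E ((AllN ^^ k) p) \<Longrightarrow> sat (\<lambda>i. if i < k then f i else e (i - k)) E p"
proof (induction k arbitrary: e)
  case (Suc k)
  \<comment> \<open>The outermost of the \<open>Suc k\<close> quantifiers governs the highest index
    \<open>k\<close>.\<close>
  then have "sat (case_nat (f k) e) E ((AllN ^^ k) p)" by simp
  from Suc.IH[OF this] show ?case
  proof (rule back_subst[of "\<lambda>e. sat e E p"], intro ext)
    fix i show "(if i < k then f i else case_nat (f k) e (i - k)) = (if i < Suc k then f i else e (i - Suc k))"
      by (cases i k rule: linorder_cases) (auto simp: less_Suc_eq diff_Suc split: nat.split)
  qed
qed auto

lemma sat_AllS_pow:
  assumes "range E' \<subseteq> SS"
  shows "sat e E ((AllS ^^ k) p) \<Longrightarrow> sat e (\<lambda>i. if i < k then E' i else E (i - k)) p"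
proof (induction k arbitrary: E)
  case (Suc k)
  then have "\<forall>A\<in>SS. sat e (case_nat A E) ((AllS ^^ k) p)" by simp
  then have "sat e (case_nat (E' k) E) ((AllS ^^ k) p)" using assms by blast
  from Suc.IH[OF this] show ?case
  proof (rule back_subst[of "\<lambda>E. sat e E p"], intro ext)
    fix i show "(if i < k then E' i else case_nat (E' k) E (i - k)) = (if i < Suc k then E' i else E (i - Suc k))"
      by (cases i k rule: linorder_cases) (auto simp: less_Suc_eq diff_Suc split: nat.split)
  qed
qed auto

lemma sat_closure:
  fixes e e' :: "nat \<Rightarrow> 'a :: rca0_ops"
  assumes "closed_fm k l p" "range E \<subseteq> SS" "sat e' E' ((AllN ^^ k) ((AllS ^^ l) p))"
  shows "sat e E p"
proof -
  have "sat (\<lambda>i. if i < k then e i else e' (i - k)) (\<lambda>i. if i < l then E i else E' (i - l)) p"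
    by (rule sat_AllS_pow[OF assms(2) sat_AllN_pow[OF assms(3)]])
  then show ?thesis using assms(1)
    by (subst (asm) sat_cong[of k l _ _ e _ E]) auto
qed

lemma closed_fm_closure: "closed_fm k l p \<Longrightarrow> closed_fm 0 0 ((AllN ^^ k) ((AllS ^^ l) p))"
proof -
  assume p: "closed_fm k l p"
  have "closed_fm k j ((AllS ^^ l') p)" if "j + l' = l" for j l'
    using that p by (induction l' arbitrary: j) auto
  then have "closed_fm k 0 ((AllS ^^ l) p)" by simp
  moreover have "closed_fm j 0 ((AllN ^^ k') q)" if "closed_fm k 0 q" "j + k' = k" for j k' q
    using that by (induction k' arbitrary: j) auto
  ultimately show ?thesis by simp
qed

subsection \<open>The countermodel\<close>

definition goal :: fm where
  "goal = sentence
    (\<^bold>\<forall>\<^sub>S D. goodstein_dilator D \<^bold>\<longrightarrow> (extended_goodstein D \<^bold>\<longleftrightarrow> extension_omega_wf D))"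

definition refutation :: "fm set \<Rightarrow> bool" where
  "refutation \<Delta> \<longleftrightarrow> saturated \<Delta> \<and> insert (Neg goal) RCA0 \<subseteq> \<Delta>"

text \<open>A constant and not a set obtained within a proof, because a type is built from it and
  types cannot depend on local assumptions.\<close>

definition Refut :: "fm set" where
  "Refut = (SOME \<Delta>. refutation \<Delta>)"

definition refuted :: bool where
  "refuted \<longleftrightarrow> (\<exists>\<Delta>. refutation \<Delta>)"

lemma Refut: "refuted \<Longrightarrow> saturated Refut" "refuted \<Longrightarrow> RCA0 \<subseteq> Refut" "refuted \<Longrightarrow> goal \<notin> Refut"
proof -
  assume "refuted"
  then have "refutation Refut" unfolding refuted_def Refut_def by (metis someI)
  then show "saturated Refut" "RCA0 \<subseteq> Refut" "goal \<notin> Refut"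
    unfolding refutation_def using saturated_Imp[of Refut goal Fls] saturated_Fls by auto
qed

lemma not_refuted: "\<not> refuted \<Longrightarrow> RCA0 \<turnstile> goal"
proof (rule ccontr)
  assume "\<not> refuted" "\<not> RCA0 \<turnstile> goal"
  moreover have "closed_fm 0 0 q" if "q \<in> RCA0" for q
    using that closed_fm_closure unfolding RCA0_def by blast
  ultimately show False
    using ex_saturated[of RCA0 "Neg goal"] consistent_insert
    unfolding refuted_def refutation_def by blast
qed

text \<open>
  A type of its own for the numbers of the model gives access to type classes. Without a
  countermodel it is a copy of the natural numbers, as it has to be of class \<open>rca0\<close> anyway.
\<close>

primrec nat_val :: "tm \<Rightarrow> nat" where
  "nat_val (Var i) = i"
| "nat_val Zero = 0"
| "nat_val One = 1"
| "nat_val (Add s t) = nat_val s + nat_val t"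
| "nat_val (Mul s t) = nat_val s * nat_val t"

definition model_eq :: "tm \<Rightarrow> tm \<Rightarrow> bool" where
  "model_eq s t \<longleftrightarrow> (if refuted then Eq s t \<in> Refut else nat_val s = nat_val t)"

quotient_type model = tm / model_eq
proof (rule equivpI)
  show "reflp model_eq"
    by (auto simp: reflp_def model_eq_def Refut saturated_Eq_refl)
  show "symp model_eq"
    using saturated_Eq_sym Refut by (auto simp: symp_def model_eq_def)
  show "transp model_eq"
    using saturated_Eq_trans Refut unfolding transp_def model_eq_def by metis
qed

lemma abs_model_eq: "abs_model s = abs_model t \<longleftrightarrow> model_eq s t"
  by (simp add: model.abs_eq_iff)

lemma model_eq_rep: "model_eq (rep_model (abs_model t)) t" "model_eq t (rep_model (abs_model t))"
  using Quotient3_rep_abs[OF Quotient3_model] abs_model_eq Quotient3_abs_rep[OF Quotient3_model]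
  by metis+

lemma abs_model_cases: obtains t where "x = abs_model t"
  using Quotient3_abs_rep[OF Quotient3_model] by metis

instantiation model :: rca0_ops
begin

definition "0 = abs_model Zero"
definition "1 = abs_model One"
definition "a + b = abs_model (Add (rep_model a) (rep_model b))"
definition "a * b = abs_model (Mul (rep_model a) (rep_model b))"
definition "a < b \<longleftrightarrow> (if refuted then Less (rep_model a) (rep_model b) \<in> Refut
  else nat_val (rep_model a) < nat_val (rep_model b))"
definition "a \<le> b \<longleftrightarrow> a < b \<or> a = (b :: model)"
definition "a - b = (if b \<le> a then THE z :: model. z + b = a else 0)"
definition "SS = (if refuted then range (\<lambda>X. {abs_model t |t. Mem t X \<in> Refut}) else UNIV)"

instance ..

end

lemma abs_model_simps:
  "abs_model Zero = 0" "abs_model One = 1"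
  "abs_model (Add s t) = abs_model s + abs_model t"
  "abs_model (Mul s t) = abs_model s * abs_model t"
proof -
  have "model_eq (Add s t) (Add s' t')" "model_eq (Mul s t) (Mul s' t')"
    if "model_eq s s'" "model_eq t t'" for s t s' t'
    using that saturated_Eq_Add saturated_Eq_Mul Refut(1) unfolding model_eq_def
    by (auto split: if_splits)
  then show "abs_model (Add s t) = abs_model s + abs_model t"
    "abs_model (Mul s t) = abs_model s * abs_model t"
    unfolding plus_model_def times_model_def abs_model_eq using model_eq_rep(2) by blast+
qed (simp_all add: zero_model_def one_model_def)

lemma model_less:
  "refuted \<Longrightarrow> abs_model s < abs_model t \<longleftrightarrow> Less s t \<in> Refut"
  "\<not> refuted \<Longrightarrow> abs_model s < abs_model t \<longleftrightarrow> nat_val s < nat_val t"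
  using model_eq_rep[of s] model_eq_rep[of t] saturated_Less_subst[OF Refut(1)]
  unfolding less_model_def model_eq_def by (metis, metis)

definition model_set :: "nat \<Rightarrow> model set" where
  "model_set X = {abs_model t |t. Mem t X \<in> Refut}"

lemma SS_model: "refuted \<Longrightarrow> SS = range model_set"
  by (auto simp: SS_model_def model_set_def)

lemma model_set: "refuted \<Longrightarrow> abs_model t \<in> model_set X \<longleftrightarrow> Mem t X \<in> Refut"
  using saturated_Mem_subst[OF Refut(1)] saturated_Eq_refl[OF Refut(1)] saturated_Eq_sym[OF Refut(1)]
  unfolding model_set_def mem_Collect_eq abs_model_eq model_eq_def by metis

lemma tval_model: "tval (\<lambda>i. abs_model (\<sigma> i)) t = abs_model (subst_tm \<sigma> t)"
  by (induction t) (simp_all add: abs_model_simps)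

text \<open>The truth lemma: assignments are represented by substitutions. The quantifier clauses
  hold because each number of the model is the class of a term and each set is named by a set
  index.\<close>

lemma sat_model:
  assumes r: refuted
  shows "sat (\<lambda>i. abs_model (\<sigma> i)) (\<lambda>X. model_set (\<rho> X)) p \<longleftrightarrow> subst \<sigma> \<rho> p \<in> Refut"
proof (induction p arbitrary: \<sigma> \<rho>)
  case (AllN p)
  have "sat (case_nat (abs_model t) (\<lambda>i. abs_model (\<sigma> i))) (\<lambda>X. model_set (\<rho> X)) p
      \<longleftrightarrow> instN t (subst (case_nat (Var 0) (\<lambda>i. shift_tm (\<sigma> i))) \<rho> p) \<in> Refut" for t
    using AllN.IH[of "case_nat t \<sigma>" \<rho>] by (simp add: instN_subst case_nat_comp)
  then show ?case
    using saturated_AllN[OF Refut(1)[OF r]] by simp (metis abs_model_cases)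
next
  case (AllS p)
  have "sat (\<lambda>i. abs_model (\<sigma> i)) (case_nat (model_set X) (\<lambda>X. model_set (\<rho> X))) p
      \<longleftrightarrow> instS X (subst \<sigma> (case_nat 0 (\<lambda>i. Suc (\<rho> i))) p) \<in> Refut" for X
    using AllS.IH[of \<sigma> "case_nat X \<rho>"] by (simp add: instS_subst case_nat_comp)
  then show ?case
    using saturated_AllS[OF Refut(1)[OF r]] r
    by (simp add: SS_model)
qed (use r saturated_Imp[OF Refut(1)[OF r]] saturated_Fls[OF Refut(1)[OF r]] in
  \<open>simp_all add: tval_model abs_model_eq model_eq_def model_less model_set\<close>)

lemma sat_model_closed:
  assumes "refuted" "p \<in> RCA0" and that: "range E \<subseteq> (SS :: model set set)"
  shows "sat e E p"
proof -
  have "\<forall>i. \<exists>t. e i = abs_model t" by (metis abs_model_cases)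
  then obtain \<sigma> where "e = (\<lambda>i. abs_model (\<sigma> i))" by metis
  moreover have "\<forall>i. \<exists>X. E i = model_set X"
    using that SS_model[OF assms(1)] by blast
  then obtain \<rho> where "E = (\<lambda>i. model_set (\<rho> i))" by metis
  moreover have "closed_fm 0 0 p" using assms(2) closed_fm_closure unfolding RCA0_def by blast
  ultimately show ?thesis
    using sat_model[OF assms(1), of \<sigma> \<rho> p] assms Refut(2) subst_closed by auto
qed

lemma sat_model_axiom:
  assumes "refuted" "range E \<subseteq> (SS :: model set set)"
    "p \<in> basic_axioms \<union> {induction_axiom q | q. q \<in> Sigma01}
         \<union> {comprehension_axiom q r | q r. q \<in> Sigma01 \<and> r \<in> Pi01}"
  shows "sat e E p"
proof -
  obtain k where kl: "closed_fm k k p" using ex_closed_fm[of "{p}"] by blast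
  then have "(AllN ^^ k) ((AllS ^^ k) p) \<in> RCA0" unfolding RCA0_def using assms(3) by blast
  then show ?thesis
    using sat_closure[OF kl assms(2) sat_model_closed[OF assms(1) _ assms(2)]] by blast
qed

lemma nat_iso:
  assumes r: "\<not> refuted"
  obtains v :: "model \<Rightarrow> nat" where "inj v" "surj v" "v 0 = 0" "v 1 = 1"
    "\<And>x y. v (x + y) = v x + v y" "\<And>x y. v (x * y) = v x * v y" "\<And>x y. x < y \<longleftrightarrow> v x < v y"
proof
  define v where "v x = nat_val (rep_model x)" for x
  have v_abs: "v (abs_model t) = nat_val t" for t
    using model_eq_rep(1)[of t] r by (simp add: v_def model_eq_def)
  show "inj v" by (rule injI) (metis abs_model_cases abs_model_eq model_eq_def r v_abs)
  show "surj v" by (rule surjI[of _ "\<lambda>n. abs_model (Var n)"]) (simp add: v_abs)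
  show "v 0 = 0" "v 1 = 1" "v (x + y) = v x + v y" "v (x * y) = v x * v y" "x < y \<longleftrightarrow> v x < v y" for x y
    unfolding zero_model_def one_model_def plus_model_def times_model_def less_model_def v_abs
    using r by (simp_all add: v_def)
qed

lemma sat_model_basic:
  "p \<in> basic_axioms \<Longrightarrow> sat (case_nat x (case_nat y e)) (\<lambda>_. model_set 0) p"
proof (cases refuted)
  case True
  then show "p \<in> basic_axioms \<Longrightarrow> ?thesis" by (intro sat_model_axiom) (auto simp: SS_model)
next
  case False
  then obtain v :: "model \<Rightarrow> nat" where v: "inj v" "v 0 = 0" "v 1 = 1"
    "\<And>x y. v (x + y) = v x + v y" "\<And>x y. v (x * y) = v x * v y" "\<And>x y. x < y \<longleftrightarrow> v x < v y"
    by (rule nat_iso) blast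
  then show "p \<in> basic_axioms \<Longrightarrow> ?thesis"
    by (auto simp: basic_axioms_def Let_def inj_eq[OF v(1), symmetric])
qed

lemma standard_induct:
  assumes r: "\<not> refuted" and P: "P 0" "\<And>x. P x \<Longrightarrow> P (x + 1)"
  shows "P (x :: model)"
proof -
  obtain v :: "model \<Rightarrow> nat" where v: "inj v" "surj v" "v 0 = 0" "v 1 = 1" "\<And>x y. v (x + y) = v x + v y"
    using r by (rule nat_iso) blast
  have "\<forall>x. v x = n \<longrightarrow> P x" for n
  proof (induction n)
    case 0
    then show ?case using P(1) v(3) injD[OF v(1)] by metis
  next
    case (Suc n)
    show ?case
    proof (intro allI impI)
      fix x assume x: "v x = Suc n"
      obtain y where y: "n = v y" using v(2) by (rule surjE)
      then have "v x = v (y + 1)" using x v(4,5) by simp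
      then show "P x" using injD[OF v(1)] P(2) Suc y by blast
    qed
  qed
  then show ?thesis by blast
qed

instance model :: rca0
proof
  fix x y :: model and E :: "nat \<Rightarrow> model set" and p q :: fm and e :: "nat \<Rightarrow> model"
  have "\<forall>p\<in>basic_axioms. sat (case_nat x (case_nat y e)) (\<lambda>_. model_set 0) p"
    using sat_model_basic by blast
  then show "y + 1 \<noteq> 0" "x + 1 = y + 1 \<Longrightarrow> x = y" "x + 0 = x" "x + (y + 1) = (x + y) + 1" "x * 0 = 0"
    "x * (y + 1) = x * y + x" "\<not> x < 0" "x < y + 1 \<longleftrightarrow> x < y \<or> x = y"
    unfolding basic_axioms_def Let_def by auto
  show "x \<le> y \<longleftrightarrow> x < y \<or> x = y" by (rule less_eq_model_def)
  show "x - y = (if y \<le> x then THE z. z + y = x else 0)" by (rule minus_model_def)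
  show "SS \<noteq> ({} :: model set set)" by (simp add: SS_model_def)
  assume E: "range E \<subseteq> SS" and p: "bounded_fm p"
  { assume "sat (case_nat 0 e) E (ExN p)"
      "\<And>x. sat (case_nat x e) E (ExN p) \<Longrightarrow> sat (case_nat (x + 1) e) E (ExN p)"
    moreover have "sat e E (induction_axiom (ExN p))" if refuted
      using p by (intro sat_model_axiom[OF that E]) (auto simp: Sigma01_def)
    ultimately show "sat (case_nat x e) E (ExN p)"
      unfolding sat_induction_axiom
      using standard_induct[of "\<lambda>x. sat (case_nat x e) E (ExN p)" x] by (cases refuted) blast+ }
  assume q: "bounded_fm q" and pq: "\<And>x. sat (case_nat x e) E (ExN p) \<longleftrightarrow> sat (case_nat x e) E (AllN q)"
  show "{x. sat (case_nat x e) E (ExN p)} \<in> SS"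
  proof (cases refuted)
    case True
    then have "sat e E (comprehension_axiom (ExN p) (AllN q))"
      using p q by (intro sat_model_axiom[OF _ E]) (auto simp: Sigma01_def Pi01_def)
    then obtain A where "A \<in> SS" "A = {x. sat (case_nat x e) E (ExN p)}"
      unfolding sat_comprehension_axiom using pq by blast
    then show ?thesis by simp
  qed (simp add: SS_model_def)
qed

text \<open>Were the sentence not derivable, the countermodel would satisfy it by assumption, and
  the truth lemma for the identity substitution would put it into \<open>Refut\<close>.\<close>

lemma goal_if_sat:
  assumes "\<And>e E. range E \<subseteq> (SS :: model set set) \<Longrightarrow> sat e E goal"
  shows "RCA0 \<turnstile> goal"
proof (rule not_refuted, rule notI)
  assume r: refuted
  have "subst Var (\<lambda>i. i) goal \<in> Refut"
    using r by (subst sat_model[OF r, symmetric], intro assms) (auto simp: SS_model r)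
  then show False using Refut(3)[OF r] by simp
qed

subsection \<open>Arithmetic in models of RCA0\<close>

text \<open>A dummy: the induction scheme asks for an environment of sets even if the formula
  mentions none.\<close>

definition E0 :: "nat \<Rightarrow> 'a::rca0 set" where "E0 = (\<lambda>_. SOME A. A \<in> SS)"

lemma E0: "range E0 \<subseteq> SS"
  using SS_nonempty by (auto simp: E0_def intro: someI_ex)

lemma formula_induct:
  assumes "bounded_fm p" "sat (case_nat 0 e) E0 (ExN p)"
    "\<And>x. sat (case_nat x e) E0 (ExN p) \<Longrightarrow> sat (case_nat (x + 1) e) E0 (ExN p)"
  shows "sat (case_nat (x::'a::rca0) e) E0 (ExN p)"
  using sat_induction[OF E0 assms] .

context begin

text \<open>In the formulas below, \<open>Var 0\<close> is bound by \<open>ExN\<close> and mostly a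
  dummy, \<open>Var 1\<close> is the induction variable, and \<open>Var 2\<close> and
  \<open>Var 3\<close> are the parameters.\<close>

private abbreviation (input) env :: "'a::rca0 \<Rightarrow> 'a \<Rightarrow> nat \<Rightarrow> 'a" where
  "env x y \<equiv> case_nat x (case_nat y (\<lambda>_. 0))"

lemma rca0_zero_add: "0 + x = (x::'a::rca0)"
  using formula_induct[of "Eq (Add Zero (Var 1)) (Var 1)" "env 0 0" x]
  by (simp add: bounded_fm.intros add_zero add_add_one)

lemma rca0_add_one_add: "(x + 1) + y = (x + y) + (1::'a::rca0)"
  using formula_induct[of "Eq (Add (Add (Var 2) One) (Var 1)) (Add (Add (Var 2) (Var 1)) One)" "env x 0" y]
  by (simp add: bounded_fm.intros add_zero add_add_one)

lemma rca0_add_commute: "x + y = y + (x::'a::rca0)"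
  using formula_induct[of "Eq (Add (Var 2) (Var 1)) (Add (Var 1) (Var 2))" "env x 0" y]
  by (simp add: bounded_fm.intros add_zero add_add_one rca0_zero_add rca0_add_one_add)

lemma rca0_add_assoc: "(x + y) + z = x + (y + (z::'a::rca0))"
  using formula_induct[of "Eq (Add (Add (Var 2) (Var 3)) (Var 1)) (Add (Var 2) (Add (Var 3) (Var 1)))" "env x y" z]
  by (simp add: bounded_fm.intros add_zero add_add_one numeral_3_eq_3)

lemma rca0_zero_mult: "0 * x = (0::'a::rca0)"
  using formula_induct[of "Eq (Mul Zero (Var 1)) Zero" "env 0 0" x]
  by (simp add: bounded_fm.intros mul_zero mul_add_one add_zero)

lemma rca0_add_left_commute: "x + (y + z) = y + (x + (z::'a::rca0))"
  using rca0_add_assoc rca0_add_commute by metis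

lemma rca0_add_one_mult: "(x + 1) * y = x * y + (y::'a::rca0)"
  using formula_induct[of "Eq (Mul (Add (Var 2) One) (Var 1)) (Add (Mul (Var 2) (Var 1)) (Var 1))" "env x 0" y]
  by (simp add: bounded_fm.intros add_zero mul_zero mul_add_one rca0_add_assoc rca0_add_left_commute
      rca0_add_commute)

lemma rca0_mult_commute: "x * y = y * (x::'a::rca0)"
  using formula_induct[of "Eq (Mul (Var 2) (Var 1)) (Mul (Var 1) (Var 2))" "env x 0" y]
  by (simp add: bounded_fm.intros mul_zero mul_add_one rca0_zero_mult rca0_add_one_mult)

lemma rca0_distrib: "x * (y + z) = x * y + x * (z::'a::rca0)"
  using formula_induct[of "Eq (Mul (Var 2) (Add (Var 3) (Var 1))) (Add (Mul (Var 2) (Var 3)) (Mul (Var 2) (Var 1)))" "env x y" z]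
  by (simp add: bounded_fm.intros add_zero mul_zero mul_add_one rca0_add_assoc[symmetric] numeral_3_eq_3)

lemma rca0_mult_one: "x * 1 = (x::'a::rca0)"
  using mul_add_one[of x 0] by (simp add: rca0_zero_add mul_zero)

lemma rca0_mult_assoc: "(x * y) * z = x * (y * (z::'a::rca0))"
  using formula_induct[of "Eq (Mul (Mul (Var 2) (Var 3)) (Var 1)) (Mul (Var 2) (Mul (Var 3) (Var 1)))" "env x y" z]
  by (simp add: bounded_fm.intros mul_zero rca0_mult_one rca0_distrib numeral_3_eq_3)

lemma rca0_add_left_cancel: "x + y = x + z \<Longrightarrow> y = (z::'a::rca0)"
proof -
  have "y + x = z + x \<longrightarrow> y = z"
    using formula_induct[of "Imp (Eq (Add (Var 2) (Var 1)) (Add (Var 3) (Var 1))) (Eq (Var 2) (Var 3))" "env y z" x]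
    by (simp add: bounded_fm.intros add_zero numeral_3_eq_3)
      (metis add_add_one add_one_inject)
  then show "x + y = x + z \<Longrightarrow> y = z" by (simp add: rca0_add_commute)
qed

lemma rca0_cases: "x = 0 \<or> (\<exists>y. x = y + (1::'a::rca0))"
  using formula_induct[of "Or (Eq (Var 1) Zero) (Eq (Var 1) (Add (Var 0) One))" "env 0 0" x]
  by (simp add: bounded_fm.intros) blast

text \<open>The axioms describe the order by recursion on its right argument. The reduction to
  addition gives irreflexivity, transitivity and monotonicity by algebra.\<close>

lemma rca0_less_iff: "x < y \<longleftrightarrow> (\<exists>z. y = x + z + (1::'a::rca0))"
proof
  have "\<exists>z. x < y \<longrightarrow> y = x + z + 1"
    using formula_induct[of "Imp (Less (Var 2) (Var 1)) (Eq (Var 1) (Add (Add (Var 2) (Var 0)) One))" "env x 0" y]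
    by (simp add: bounded_fm.intros not_less_zero less_add_one_iff) (metis add_zero add_add_one)
  then show "x < y \<Longrightarrow> \<exists>z. y = x + z + 1" by blast
next
  have "x < x + z + 1" for z
    using formula_induct[of "Less (Var 2) (Add (Add (Var 2) (Var 1)) One)" "env x 0" z]
    by (simp add: bounded_fm.intros add_zero add_add_one less_add_one_iff)
  then show "\<exists>z. y = x + z + 1 \<Longrightarrow> x < y" by blast
qed

lemma rca0_less_total: "x < y \<or> x = y \<or> y < (x::'a::rca0)"
proof -
  have 0: "0 < y \<or> 0 = y" for y :: 'a
    using rca0_cases[of y] by (auto simp: rca0_less_iff rca0_zero_add)
  have 1: "x + 1 < y \<or> x + 1 = y" if less: "x < y" for x y :: 'a
  proof -
    obtain z where z: "y = x + z + 1" using less unfolding rca0_less_iff by blast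
    from rca0_cases[of z] show ?thesis
    proof
      assume "\<exists>w. z = w + 1"
      then obtain w where "z = w + 1" ..
      then have "y = (x + 1) + w + 1"
        using z by (simp add: add_add_one rca0_add_one_add[of x w])
      then show ?thesis unfolding rca0_less_iff by blast
    qed (simp add: z add_zero)
  qed
  show ?thesis
    using formula_induct[of "Or (Less (Var 1) (Var 2)) (Or (Eq (Var 1) (Var 2)) (Less (Var 2) (Var 1)))" "env y 0" x]
    using 0[of y] 1 by (simp add: bounded_fm.intros less_add_one_iff) blast
qed

end

lemma rca0_less_irrefl: "\<not> x < (x::'a::rca0)"
  by (metis rca0_less_iff rca0_add_assoc rca0_add_left_cancel add_zero add_one_neq_zero)

lemma rca0_less_trans: "x < y \<Longrightarrow> y < z \<Longrightarrow> x < (z::'a::rca0)"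
  unfolding rca0_less_iff by (metis rca0_add_assoc)

lemma rca0_le_iff_add: "x \<le> y \<longleftrightarrow> (\<exists>z. y = x + (z::'a::rca0))"
  unfolding le_iff rca0_less_iff using rca0_cases add_zero rca0_add_assoc by metis

lemma rca0_less_add: "x < y \<Longrightarrow> z + x < z + (y::'a::rca0)"
  unfolding rca0_less_iff by (metis rca0_add_assoc)

lemma rca0_add_diff: "(x + y) - x = (y::'a::rca0)"
proof -
  have "x \<le> x + y" using rca0_le_iff_add by blast
  moreover have "(THE z. z + x = x + y) = y"
    by (rule the_equality) (metis rca0_add_commute rca0_add_left_cancel)+
  ultimately show ?thesis by (simp add: minus_eq)
qed

lemma rca0_diff_less: "x < y \<Longrightarrow> x - y = (0::'a::rca0)"
  unfolding minus_eq le_iff using rca0_less_irrefl rca0_less_trans by auto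

lemma rca0_diff_diff: "x - y - z = x - (y + (z::'a::rca0))"
proof -
  consider "x < y" | w where "x = y + w"
    using rca0_less_total[of x y] rca0_le_iff_add[of y x] unfolding le_iff by auto
  then show ?thesis
  proof cases
    case 1
    moreover have "x < y + z"
      using 1 unfolding rca0_less_iff by (metis rca0_add_assoc rca0_add_commute)
    ultimately show ?thesis
      using rca0_cases[of z] rca0_add_diff[of 0 0]
      by (auto simp: rca0_diff_less rca0_zero_add add_zero)
        (metis rca0_diff_less rca0_less_iff rca0_zero_add)
  next
    case w: 2
    consider "w < z" | v where "w = z + v"
      using rca0_less_total[of w z] rca0_le_iff_add[of z w] unfolding le_iff by auto
    then show ?thesis
    proof cases
      case 1
      then show ?thesis using rca0_less_add[of w z y] w by (simp add: rca0_diff_less rca0_add_diff)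
    next
      case 2
      then show ?thesis using w by (metis rca0_add_assoc rca0_add_diff)
    qed
  qed
qed

lemma rca0_less_mult: "0 < z \<Longrightarrow> x < y \<Longrightarrow> z * x < z * (y::'a::rca0)"
proof -
  assume "0 < z" "x < y"
  then obtain u v where "z = u + 1" "y = x + v + 1"
    unfolding rca0_less_iff rca0_zero_add by blast
  then have "z * y = z * x + (z * v + u) + 1"
    by (simp add: rca0_distrib rca0_mult_one rca0_add_assoc)
  then show ?thesis unfolding rca0_less_iff by blast
qed

lemma rca0_mult_diff: "x * (y - z) = x * y - x * (z::'a::rca0)"
proof -
  consider "y < z" | w where "y = z + w"
    using rca0_less_total[of y z] rca0_le_iff_add[of z y] unfolding le_iff by auto
  then show ?thesis
  proof cases
    case 1
    then have "x = 0 \<or> x * y < x * z"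
      using rca0_less_mult[of x y z] rca0_less_total[of 0 x] not_less_zero by auto
    then show ?thesis
      using 1 rca0_add_diff[of 0 0] by (auto simp: rca0_diff_less mul_zero rca0_zero_mult rca0_zero_add)
  qed (simp add: rca0_distrib rca0_add_diff)
qed

instance rca0 \<subseteq> linordered_semidom
proof
  fix a b c :: 'a
  show "a + b + c = a + (b + c)" by (rule rca0_add_assoc)
  show "a + b = b + a" by (rule rca0_add_commute)
  show "0 + a = a" by (rule rca0_zero_add)
  show "a * b * c = a * (b * c)" by (rule rca0_mult_assoc)
  show "a * b = b * a" by (rule rca0_mult_commute)
  show "1 * a = a" by (metis rca0_mult_commute rca0_mult_one)
  show "(a + b) * c = a * c + b * c" by (metis rca0_mult_commute rca0_distrib)
  show "a * (b + c) = a * b + a * c" by (rule rca0_distrib)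
  show "0 * a = 0" "a * 0 = 0" by (rule rca0_zero_mult mul_zero)+
  show "a * (b - c) = a * b - a * c" by (rule rca0_mult_diff)
  show "(0::'a) \<noteq> 1" by (metis rca0_zero_add add_one_neq_zero)
  show "a < b \<longleftrightarrow> a \<le> b \<and> \<not> b \<le> a"
    unfolding le_iff by (metis rca0_less_irrefl rca0_less_trans)
  show "a \<le> a" unfolding le_iff by simp
  show "a \<le> b \<Longrightarrow> b \<le> c \<Longrightarrow> a \<le> c"
    unfolding le_iff by (metis rca0_less_trans)
  show "a \<le> b \<Longrightarrow> b \<le> a \<Longrightarrow> a = b"
    unfolding le_iff by (metis rca0_less_irrefl rca0_less_trans)
  show "a \<le> b \<or> b \<le> a"
    unfolding le_iff using rca0_less_total[of a b] by auto
  show "a \<le> b \<Longrightarrow> c + a \<le> c + b" unfolding le_iff using rca0_less_add by auto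
  show "a + b - a = b" by (rule rca0_add_diff)
  show "0 < (1::'a)" unfolding rca0_less_iff by (metis rca0_zero_add)
  show "b \<le> a \<Longrightarrow> a - b + b = a"
    unfolding rca0_le_iff_add by (metis rca0_add_diff rca0_add_commute)
  show "a - b - c = a - (b + c)" by (rule rca0_diff_diff)
  show "0 < c \<Longrightarrow> a < b \<Longrightarrow> c * a < c * b"
    by (rule rca0_less_mult)
  show "a \<noteq> 0 \<Longrightarrow> b \<noteq> 0 \<Longrightarrow> a * b \<noteq> 0"
    using rca0_less_mult[of a 0 b] rca0_less_total[of 0 a] rca0_less_total[of 0 b]
    by (auto simp: not_less_zero mul_zero rca0_less_irrefl)
qed

instance rca0 \<subseteq> canonically_ordered_monoid_add
  by standard (rule rca0_le_iff_add)

lemma less_add_one_le: "x < y + 1 \<longleftrightarrow> x \<le> (y::'a::rca0)"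
  by (simp add: less_add_one_iff le_iff)

lemma add_one_le_iff: "x + 1 \<le> y \<longleftrightarrow> x < (y::'a::rca0)"
  using less_add_one_le[of y x] by (meson linorder_not_le)

lemma nonzero_add_one: "x \<noteq> 0 \<Longrightarrow> \<exists>y. x = y + (1::'a::rca0)"
  using rca0_cases by blast

lemma le_square: "x \<le> x * (x::'a::rca0)"
  using mult_left_mono[of 1 x x] add_one_le_iff[of 0 x] by (cases "x = 0") (auto simp: zero_less_iff_neq_zero)

subsection \<open>Pairs\<close>

definition pr :: "'a::rca0 \<Rightarrow> 'a \<Rightarrow> 'a" where
  "pr x y = (x + y) * (x + y) + x"

text \<open>With s = x + y, the code of the pair is at least s^2 and below (s + 1)^2.\<close>

lemma pr_mono: "x + y < x' + y' \<Longrightarrow> pr x y < pr x' y'"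
proof -
  assume "x + y < x' + y'"
  then have "(x + y + 1) * (x + y + 1) \<le> (x' + y') * (x' + y')"
    by (intro mult_mono) (auto simp: add_one_le_iff)
  moreover have "pr x y < (x + y + 1) * (x + y + 1)"
  proof -
    have "(x + y + 1) * (x + y + 1) = (pr x y + (x + y + y)) + 1"
      by (simp add: pr_def algebra_simps)
    then show ?thesis by (simp add: less_add_one_le)
  qed
  ultimately have "pr x y < (x' + y') * (x' + y')" by (rule less_le_trans[rotated])
  also have "\<dots> \<le> pr x' y'" by (simp add: pr_def)
  finally show ?thesis .
qed

lemma pr_inject [simp]: "pr x y = pr x' y' \<longleftrightarrow> x = x' \<and> y = y'"
proof
  assume e: "pr x y = pr x' y'"
  then have "x + y = x' + y'" using pr_mono[of x y x' y'] pr_mono[of x' y' x y]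
    by (metis less_irrefl linorder_neqE)
  then show "x = x' \<and> y = y'" using e by (simp add: pr_def)
qed simp

lemma le_pr: "x \<le> pr x y" "y \<le> pr x y"
proof -
  show "x \<le> pr x y" by (simp add: pr_def)
  have "y \<le> (x + y) * (x + y)" using le_square[of "x + y"] by (rule order_trans[rotated]) simp
  then show "y \<le> pr x y" by (simp add: pr_def add_increasing2)
qed

definition is_pr :: "'a::rca0 \<Rightarrow> bool" where
  "is_pr p \<longleftrightarrow> (\<exists>x y. p = pr x y)"

text \<open>Not every number codes a pair. The default 0 makes the projections total and keeps them
  bounded by their argument.\<close>

definition p1 :: "'a::rca0 \<Rightarrow> 'a" where
  "p1 p = (if is_pr p then THE x. \<exists>y. p = pr x y else 0)"

definition p2 :: "'a::rca0 \<Rightarrow> 'a" where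
  "p2 p = (if is_pr p then THE y. \<exists>x. p = pr x y else 0)"

lemma is_pr [simp]: "is_pr (pr x y)" by (auto simp: is_pr_def)
lemma p1 [simp]: "p1 (pr x y) = x" by (auto simp: p1_def)
lemma p2 [simp]: "p2 (pr x y) = y" by (auto simp: p2_def)

lemma pr_p: "is_pr p \<Longrightarrow> pr (p1 p) (p2 p) = p"
  by (auto simp: is_pr_def)

lemma p_le: "p1 p \<le> p" "p2 p \<le> p"
  using le_pr by (cases "is_pr p"; force simp: is_pr_def p1_def p2_def)+

subsection \<open>Recursive sets and functions\<close>

text \<open>Recursive relative to parameters from the model: by Delta01 comprehension such
  predicates have an extension in \<open>SS\<close>.\<close>

definition rec :: "('a::rca0 \<Rightarrow> bool) \<Rightarrow> bool" where
  "rec P \<longleftrightarrow> Collect P \<in> SS"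

definition BEx :: "tm \<Rightarrow> fm \<Rightarrow> fm" where
  "BEx t p = Neg (AllN (Imp (Less (Var 0) (shift_tm t)) (Neg p)))"

definition BAll :: "tm \<Rightarrow> fm \<Rightarrow> fm" where
  "BAll t p = AllN (Imp (Less (Var 0) (shift_tm t)) p)"

definition Pr :: "tm \<Rightarrow> tm \<Rightarrow> tm" where
  "Pr s t = Add (Mul (Add s t) (Add s t)) s"

lemma bounded_BEx [simp]: "bounded_fm p \<Longrightarrow> bounded_fm (BEx t p)"
  unfolding BEx_def by (intro bounded_fm.intros)

lemma bounded_BAll [simp]: "bounded_fm p \<Longrightarrow> bounded_fm (BAll t p)"
  unfolding BAll_def by (intro bounded_fm.intros)

lemma tval_shift [simp]: "tval (case_nat v e) (shift_tm t) = tval e t"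
  by (simp add: tval_subst)

lemma sat_BEx [simp]: "sat e E (BEx t p) \<longleftrightarrow> (\<exists>v<tval e t. sat (case_nat v e) E p)"
  by (auto simp: BEx_def)

lemma sat_BAll [simp]: "sat e E (BAll t p) \<longleftrightarrow> (\<forall>v<tval e t. sat (case_nat v e) E p)"
  by (auto simp: BAll_def)

lemma tval_Pr [simp]: "tval e (Pr s t) = pr (tval e s) (tval e t)"
  by (simp add: Pr_def pr_def)

text \<open>Delta01 comprehension with its variables fixed: \<open>Var 0\<close> is the unbounded
  quantified variable, \<open>Var 1\<close> the argument, and all higher number indices denote
  \<open>c\<close>; the set indices 0 and 1 denote \<open>A\<close> and \<open>B\<close>, all higher
  ones \<open>C\<close>.\<close>

lemma rec_by_formulas:
  assumes "bounded_fm p" "bounded_fm q" "A \<in> SS" "B \<in> SS" "C \<in> SS"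
    "\<And>x. (\<exists>y. sat (case_nat y (case_nat x (\<lambda>_. c))) (case_nat A (case_nat B (\<lambda>_. C))) p) \<longleftrightarrow> P x"
    "\<And>x. (\<forall>y. sat (case_nat y (case_nat x (\<lambda>_. c))) (case_nat A (case_nat B (\<lambda>_. C))) q) \<longleftrightarrow> P x"
  shows "rec P"
proof -
  have "range (case_nat A (case_nat B (\<lambda>_. C))) \<subseteq> SS"
    using assms(3-5) by (auto split: nat.split)
  from sat_comprehension[OF this assms(1,2), of "\<lambda>_. c"] show ?thesis
    using assms(6,7) by (simp add: rec_def)
qed

text \<open>A bounded formula needs no unbounded quantifier, so that variable is pinned to 0 in the
  existential and in the universal description.\<close>

lemma rec_by_formula:
  assumes "bounded_fm p" "A \<in> SS" "B \<in> SS" "C \<in> SS"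
    "\<And>x. sat (case_nat 0 (case_nat x (\<lambda>_. c))) (case_nat A (case_nat B (\<lambda>_. C))) p \<longleftrightarrow> P x"
  shows "rec P"
  by (rule rec_by_formulas[of "And (Eq (Var 0) Zero) p" "Imp (Eq (Var 0) Zero) p" A B C c])
    (use assms in \<open>auto intro!: bounded_fm.intros\<close>)

lemma ex_SS: "\<exists>A. A \<in> (SS :: 'a::rca0 set set)"
  using SS_nonempty by blast

named_theorems computable

lemma rec_const [computable]: "rec (\<lambda>_. b)"
proof -
  obtain A :: "'a set" where "A \<in> SS" using ex_SS by blast
  then show ?thesis
    by (intro rec_by_formula[of "if b then Imp Fls Fls else Fls" A A A]) (auto intro: bounded_fm.intros)
qed

lemma rec_imp [computable]: "rec P \<Longrightarrow> rec Q \<Longrightarrow> rec (\<lambda>x. P x \<longrightarrow> Q x)"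
  by (rule rec_by_formula[of "Imp (Mem (Var 1) 0) (Mem (Var 1) 1)" "Collect P" "Collect Q" "Collect Q"])
    (auto simp: rec_def intro: bounded_fm.intros)

lemma rec_not [computable]: "rec P \<Longrightarrow> rec (\<lambda>x. \<not> P x)"
  using rec_imp[OF _ rec_const[of False]] by simp

lemma rec_and [computable]: "rec P \<Longrightarrow> rec Q \<Longrightarrow> rec (\<lambda>x. P x \<and> Q x)"
  using rec_not[OF rec_imp[OF _ rec_not]] by simp

lemma rec_or [computable]: "rec P \<Longrightarrow> rec Q \<Longrightarrow> rec (\<lambda>x. P x \<or> Q x)"
  using rec_imp[OF rec_not] by (simp add: disj_imp)

lemma rec_iff [computable]: "rec P \<Longrightarrow> rec Q \<Longrightarrow> rec (\<lambda>x. P x \<longleftrightarrow> Q x)"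
  unfolding iff_conv_conj_imp by (intro computable)

definition graph :: "('a::rca0 \<Rightarrow> 'a) \<Rightarrow> 'a set" where
  "graph f = {pr x (f x) |x. True}"

definition cf :: "('a::rca0 \<Rightarrow> 'a) \<Rightarrow> bool" where
  "cf f \<longleftrightarrow> graph f \<in> SS"

lemma graph [simp]: "pr x y \<in> graph f \<longleftrightarrow> y = f x"
  by (auto simp: graph_def)

lemma cf_iff: "cf f \<longleftrightarrow> rec (\<lambda>p. is_pr p \<and> p2 p = f (p1 p))"
  by (auto simp: cf_def rec_def graph_def is_pr_def intro!: arg_cong[where f = "\<lambda>A. A \<in> SS"])

text \<open>The components of a pair do not exceed its code, which is why decoding stays within
  bounded formulas.\<close>

lemma bex_pr: "(\<exists>x<p + 1. \<exists>z<p + 1. p = pr x z \<and> P x z) \<longleftrightarrow> is_pr p \<and> P (p1 p) (p2 p)"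
  by (auto simp: less_add_one_le is_pr_def intro: le_pr)

lemma bex_pr_graph: "(\<exists>x<p + 1. f x < p + 1 \<and> p = pr x (f x)) \<longleftrightarrow> is_pr p \<and> p2 p = f (p1 p)"
  using bex_pr[of p "\<lambda>x z. z = f x"] by simp

text \<open>In \<open>p\<close>, \<open>Var 0\<close> is the value and \<open>Var 1\<close> the
  argument; \<open>Var 2\<close> is the dummy of \<open>rec_by_formula\<close>, \<open>Var 3\<close>
  the code of the pair, and \<open>Var 4\<close> onwards the parameter.\<close>

lemma cf_by_formula:
  assumes "bounded_fm p" "A \<in> SS" "B \<in> SS" "C \<in> SS"
    "\<And>u x z. sat (case_nat z (case_nat x (case_nat 0 (case_nat u (\<lambda>_. c)))))
        (case_nat A (case_nat B (\<lambda>_. C))) p \<longleftrightarrow> z = f x"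
  shows "cf f"
  unfolding cf_iff
  by (rule rec_by_formula[of "BEx (Add (Var 1) One) (BEx (Add (Var 2) One) (And (Eq (Var 3) (Pr (Var 1) (Var 0))) p))" A B C c])
    (use assms in \<open>auto simp: numeral_eq_Suc bex_pr bex_pr_graph intro!: bounded_fm.intros bounded_BEx\<close>)

lemma cf_id [computable]: "cf (\<lambda>x. x)"
proof -
  obtain A :: "'a set" where "A \<in> SS" using ex_SS by blast
  then show ?thesis
    by (intro cf_by_formula[of "Eq (Var 0) (Var 1)" A A A]) (auto intro: bounded_fm.intros)
qed

lemma cf_const [computable]: "cf (\<lambda>_. c)"
proof -
  obtain A :: "'a set" where "A \<in> SS" using ex_SS by blast
  then show ?thesis
    by (intro cf_by_formula[of "Eq (Var 0) (Var 4)" A A A c])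
      (auto simp: numeral_eq_Suc intro: bounded_fm.intros)
qed

lemma p12_eq:
  "z = p1 q \<longleftrightarrow> (\<forall>u<q + 1. \<forall>v<q + 1. q = pr u v \<longrightarrow> z = u)
    \<and> ((\<forall>u<q + 1. \<forall>v<q + 1. q \<noteq> pr u v) \<longrightarrow> z = 0)"
  "z = p2 q \<longleftrightarrow> (\<forall>u<q + 1. \<forall>v<q + 1. q = pr u v \<longrightarrow> z = v)
    \<and> ((\<forall>u<q + 1. \<forall>v<q + 1. q \<noteq> pr u v) \<longrightarrow> z = 0)"
proof -
  have "(\<forall>u<q + 1. \<forall>v<q + 1. q = pr u v \<longrightarrow> P u v) \<longleftrightarrow> (is_pr q \<longrightarrow> P (p1 q) (p2 q))" for P
    using bex_pr[of q "\<lambda>u v. \<not> P u v"] by blast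
  note e = this[of "\<lambda>u v. z = u"] this[of "\<lambda>u v. z = v"] this[of "\<lambda>u v. False"]
  show "z = p1 q \<longleftrightarrow> (\<forall>u<q + 1. \<forall>v<q + 1. q = pr u v \<longrightarrow> z = u)
      \<and> ((\<forall>u<q + 1. \<forall>v<q + 1. q \<noteq> pr u v) \<longrightarrow> z = 0)"
    "z = p2 q \<longleftrightarrow> (\<forall>u<q + 1. \<forall>v<q + 1. q = pr u v \<longrightarrow> z = v)
      \<and> ((\<forall>u<q + 1. \<forall>v<q + 1. q \<noteq> pr u v) \<longrightarrow> z = 0)"
    using e by (auto simp: p1_def p2_def)
qed

lemma cf_p1_base: "cf (p1 :: 'a::rca0 \<Rightarrow> 'a)" and cf_p2_base: "cf (p2 :: 'a \<Rightarrow> 'a)"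
proof -
  obtain A :: "'a set" where A: "A \<in> SS" using ex_SS by blast
  let ?p = "\<lambda>i. And (BAll (Add (Var 1) One) (BAll (Add (Var 2) One)
      (Imp (Eq (Var 3) (Pr (Var 1) (Var 0))) (Eq (Var 2) (Var i)))))
    (Imp (BAll (Add (Var 1) One) (BAll (Add (Var 2) One) (Neg (Eq (Var 3) (Pr (Var 1) (Var 0))))))
      (Eq (Var 0) Zero))"
  have b: "bounded_fm (?p i)" for i by (intro bounded_fm.intros bounded_BAll)
  show "cf (p1 :: 'a \<Rightarrow> 'a)"
    by (rule cf_by_formula[OF b[of 1] A A A]) (auto simp: p12_eq numeral_eq_Suc)
  show "cf (p2 :: 'a \<Rightarrow> 'a)"
    by (rule cf_by_formula[OF b[of 0] A A A]) (auto simp: p12_eq numeral_eq_Suc)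
qed

text \<open>The value of \<open>f\<close> has no bound in terms of the argument, so both forms of
  comprehension are used: some value in the graph satisfies \<open>P\<close>, or all of them
  do.\<close>

lemma rec_comp:
  assumes "rec P" "cf f" shows "rec (\<lambda>x. P (f x))"
  by (rule rec_by_formulas[of "And (Mem (Pr (Var 1) (Var 0)) 0) (Mem (Var 0) 1)"
        "Imp (Mem (Pr (Var 1) (Var 0)) 0) (Mem (Var 0) 1)" "graph f" "Collect P" "Collect P"])
    (use assms in \<open>auto simp: rec_def cf_def intro: bounded_fm.intros\<close>)

lemma rec_mem [computable]: "A \<in> SS \<Longrightarrow> cf f \<Longrightarrow> rec (\<lambda>x. f x \<in> A)"
  using rec_comp[of "\<lambda>x. x \<in> A" f] by (simp add: rec_def)

lemma cf_comp:
  assumes "cf g" "cf f" shows "cf (\<lambda>x. g (f x))"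
proof -
  let ?p = "\<lambda>q. BEx (Add (Var 1) One) (BEx (Add (Var 2) One) (And (Eq (Var 3) (Pr (Var 1) (Var 0))) q))"
  let ?F = "Mem (Pr (Var 1) (Var 2)) 0" and ?G = "Mem (Pr (Var 2) (Var 0)) 1"
  show ?thesis unfolding cf_iff
    by (rule rec_by_formulas[of "?p (And ?F ?G)" "?p (Imp ?F ?G)" "graph f" "graph g" "graph g"])
      (use assms in \<open>auto simp: cf_def numeral_eq_Suc bex_pr bex_pr_graph
        intro!: bounded_fm.intros bounded_BEx\<close>)
qed

lemma cf_pr [computable]:
  assumes "cf f" "cf g" shows "cf (\<lambda>x. pr (f x) (g x))"
proof -
  let ?p = "BEx (Add (Var 0) One) (BEx (Add (Var 1) One) (And (Eq (Var 2) (Pr (Var 1) (Var 0)))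
    (And (Mem (Pr (Var 3) (Var 1)) 0) (Mem (Pr (Var 3) (Var 0)) 1))))"
  show ?thesis
    by (rule cf_by_formula[of ?p "graph f" "graph g" "graph g"])
      (use assms in \<open>auto simp: cf_def numeral_eq_Suc less_add_one_le le_pr intro!: bounded_fm.intros bounded_BEx\<close>)
qed

text \<open>Binary operations are treated as unary ones on coded pairs; \<open>cf_comp\<close> and
  \<open>cf_pr\<close> then yield closure under the operation.\<close>

lemma cf_p12_op:
  assumes "bounded_fm p" "\<And>e E u v z. sat (case_nat v (case_nat u (case_nat z e))) E p \<longleftrightarrow> z = h u v"
  shows "cf (\<lambda>q. h (p1 q) (p2 q) :: 'a::rca0)"
proof -
  let ?p = "BEx (Add (Var 1) One) (BEx (Add (Var 2) One)
    (And (Mem (Pr (Var 3) (Var 1)) 0) (And (Mem (Pr (Var 3) (Var 0)) 1) p)))"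
  show ?thesis
    by (rule cf_by_formula[of ?p "graph p1" "graph p2" "graph p2"])
      (use assms cf_p1_base cf_p2_base in \<open>auto simp: cf_def numeral_eq_Suc less_add_one_le p_le
         intro!: bounded_fm.intros bounded_BEx\<close>)
qed

lemma rec_p12:
  assumes "bounded_fm p" "A \<in> SS"
    "\<And>e B C u v. sat (case_nat v (case_nat u e)) (case_nat B (case_nat C (\<lambda>_. A))) p \<longleftrightarrow> P u v"
  shows "rec (\<lambda>q. P (p1 q) (p2 q))"
proof -
  let ?p = "BEx (Add (Var 1) One) (BEx (Add (Var 2) One)
    (And (Mem (Pr (Var 3) (Var 1)) 0) (And (Mem (Pr (Var 3) (Var 0)) 1) p)))"
  show ?thesis
    by (rule rec_by_formula[of ?p "graph p1" "graph p2" A])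
      (use assms cf_p1_base cf_p2_base in \<open>auto simp: cf_def numeral_eq_Suc less_add_one_le p_le
         intro!: bounded_fm.intros bounded_BEx\<close>)
qed

lemma cf_p1 [computable]: "cf f \<Longrightarrow> cf (\<lambda>x. p1 (f x))"
  by (rule cf_comp[OF cf_p1_base])

lemma cf_p2 [computable]: "cf f \<Longrightarrow> cf (\<lambda>x. p2 (f x))"
  by (rule cf_comp[OF cf_p2_base])

lemma cf_add [computable]:
  assumes "cf f" "cf g" shows "cf (\<lambda>x. f x + g x)"
proof -
  have "cf (\<lambda>q. p1 q + p2 q :: 'a)"
    by (rule cf_p12_op[of "Eq (Var 2) (Add (Var 1) (Var 0))"])
      (auto simp: numeral_2_eq_2 intro: bounded_fm.intros)
  from cf_comp[OF this cf_pr[OF assms]] show ?thesis by simp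
qed

lemma cf_mult [computable]:
  assumes "cf f" "cf g" shows "cf (\<lambda>x. f x * g x)"
proof -
  have "cf (\<lambda>q. p1 q * p2 q :: 'a)"
    by (rule cf_p12_op[of "Eq (Var 2) (Mul (Var 1) (Var 0))"])
      (auto simp: numeral_2_eq_2 intro: bounded_fm.intros)
  from cf_comp[OF this cf_pr[OF assms]] show ?thesis by simp
qed

lemma rec_less [computable]:
  assumes "cf f" "cf g" shows "rec (\<lambda>x. f x < g x)"
proof -
  obtain A :: "'a set" where "A \<in> SS" using ex_SS by blast
  then have "rec (\<lambda>q. p1 q < (p2 q :: 'a))"
    by (intro rec_p12[of "Less (Var 1) (Var 0)" A]) (auto intro: bounded_fm.intros)
  from rec_comp[OF this cf_pr[OF assms]] show ?thesis by simp
qed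

lemma rec_le [computable]: "cf f \<Longrightarrow> cf g \<Longrightarrow> rec (\<lambda>x. f x \<le> g x)"
  using rec_not[OF rec_less[of g f]] by (simp add: not_less)

lemma rec_eq [computable]: "cf f \<Longrightarrow> cf g \<Longrightarrow> rec (\<lambda>x. f x = g x)"
  using rec_and[OF rec_le rec_le, of f g g f] by (simp add: order_eq_iff)

lemma rec_is_pr [computable]:
  assumes "cf f" shows "rec (\<lambda>x. is_pr (f x))"
proof -
  have "is_pr p \<longleftrightarrow> p = pr (p1 p) (p2 p)" for p :: 'a by (metis is_pr pr_p)
  then show ?thesis using assms by (simp, intro computable)
qed

lemma rec_ball [computable]:
  assumes "rec (\<lambda>p. P (p1 p) (p2 p))" "cf f" shows "rec (\<lambda>e. \<forall>x<f e. P x e)"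
proof -
  \<comment> \<open>The bound and the parameter are paired, so that a formula with a single argument
    suffices.\<close>
  have "rec (\<lambda>q. \<forall>x<p1 q. pr x (p2 q) \<in> {p. P (p1 p) (p2 p)})"
    by (rule rec_p12[of "BAll (Var 1) (Mem (Pr (Var 0) (Var 1)) 2)"])
      (use assms(1) in \<open>auto simp: rec_def numeral_2_eq_2 intro: bounded_fm.intros bounded_BAll\<close>)
  from rec_comp[OF this cf_pr[OF assms(2) cf_id]] show ?thesis by simp
qed

lemma rec_bex [computable]:
  assumes "rec (\<lambda>p. P (p1 p) (p2 p))" "cf f" shows "rec (\<lambda>e. \<exists>x<f e. P x e)"
  using rec_not[OF rec_ball[OF rec_not[OF assms(1)] assms(2)]] by simp

lemma cf_by_rec:
  assumes "rec (\<lambda>p. P (p1 p) (p2 p))" "\<And>x y. P x y \<longleftrightarrow> y = f x"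
  shows "cf f"
proof -
  have "rec (\<lambda>p. is_pr p \<and> P (p1 p) (p2 p))" by (intro computable assms(1))
  then show ?thesis unfolding cf_iff by (simp add: assms(2))
qed

lemma cf_if [computable]:
  assumes "rec P" "cf f" "cf g" shows "cf (\<lambda>x. if P x then f x else g x)"
proof (rule cf_by_rec)
  show "rec (\<lambda>p. P (p1 p) \<and> p2 p = f (p1 p) \<or> \<not> P (p1 p) \<and> p2 p = g (p1 p))"
    by (intro computable rec_comp[OF assms(1)] cf_comp[OF assms(2)] cf_comp[OF assms(3)])
qed auto

subsection \<open>Recursively enumerable predicates\<close>

text \<open>The Sigma01 predicates with parameters, that is, those to which the induction scheme
  applies.\<close>

definition re :: "('a::rca0 \<Rightarrow> bool) \<Rightarrow> bool" where
  "re P \<longleftrightarrow> (\<exists>R. rec R \<and> (\<forall>x. P x \<longleftrightarrow> (\<exists>y. R (pr x y))))"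

named_theorems enumerable

lemma re_rec: assumes "rec P" shows "re P"
  unfolding re_def by (intro exI[of _ "\<lambda>p. P (p1 p)"] conjI rec_comp[OF assms] computable) simp

lemma re_ex [enumerable]:
  assumes "re (\<lambda>p. P (p1 p) (p2 p))" shows "re (\<lambda>x. \<exists>y. P x y)"
proof -
  obtain R where R: "rec R" "\<And>p. P (p1 p) (p2 p) \<longleftrightarrow> (\<exists>y. R (pr p y))"
    using assms unfolding re_def by blast
  have "P x y \<longleftrightarrow> (\<exists>w. R (pr (pr x y) w))" for x y using R(2)[of "pr x y"] by simp
  then have "(\<exists>y. P x y) \<longleftrightarrow> (\<exists>v. R (pr (pr x (p1 v)) (p2 v)))" for x
    by (metis p1 p2)
  then show ?thesis unfolding re_def
    by (intro exI[of _ "\<lambda>q. R (pr (pr (p1 q) (p1 (p2 q))) (p2 (p2 q)))"] conjI rec_comp[OF R(1)] computable) simp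
qed

lemma re_and [enumerable]:
  assumes "re P" "re Q" shows "re (\<lambda>x. P x \<and> Q x)"
proof -
  obtain R S where R: "rec R" "\<And>x. P x \<longleftrightarrow> (\<exists>y. R (pr x y))"
    and S: "rec S" "\<And>x. Q x \<longleftrightarrow> (\<exists>y. S (pr x y))"
    using assms unfolding re_def by blast
  have "P x \<and> Q x \<longleftrightarrow> (\<exists>v. R (pr x (p1 v)) \<and> S (pr x (p2 v)))" for x
    unfolding R(2) S(2) by (metis p1 p2)
  then show ?thesis unfolding re_def
    by (intro exI[of _ "\<lambda>q. R (pr (p1 q) (p1 (p2 q))) \<and> S (pr (p1 q) (p2 (p2 q)))"] conjI
        rec_comp[OF R(1)] rec_comp[OF S(1)] computable) simp
qed

lemma re_induct:
  assumes "re P" "P 0" "\<And>x. P x \<Longrightarrow> P (x + 1)" shows "P (x::'a::rca0)"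
proof -
  obtain R where R: "rec R" "\<And>x. P x \<longleftrightarrow> (\<exists>y. R (pr x y))"
    using assms unfolding re_def by blast
  have "sat (case_nat x (\<lambda>_. 0)) (\<lambda>_. Collect R) (ExN (Mem (Pr (Var 1) (Var 0)) 0)) \<longleftrightarrow> P x" for x
    by (simp add: R(2))
  moreover have "range (\<lambda>_::nat. Collect R) \<subseteq> SS" using R(1) by (auto simp: rec_def)
  ultimately show ?thesis
    using sat_induction[of "\<lambda>_. Collect R" "Mem (Pr (Var 1) (Var 0)) 0" "\<lambda>_. 0" x] assms(2,3)
    by (simp only: bounded_fm.intros)
qed

lemma rec_induct:
  "rec P \<Longrightarrow> P 0 \<Longrightarrow> (\<And>x. P x \<Longrightarrow> P (x + 1)) \<Longrightarrow> P (x::'a::rca0)"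
  by (rule re_induct[OF re_rec])

lemma ex_least:
  assumes "rec P" "P (x::'a::rca0)" shows "\<exists>m. P m \<and> (\<forall>y<m. \<not> P y)"
proof (rule ccontr)
  assume n: "\<nexists>m. P m \<and> (\<forall>y<m. \<not> P y)"
  have "\<forall>y<x + 1. \<not> P y"
  proof (rule rec_induct[of "\<lambda>x. \<forall>y<x. \<not> P y"])
    show "rec (\<lambda>x. \<forall>y<x. \<not> P y)" by (intro computable rec_comp[OF assms(1)])
  qed (use n in \<open>auto simp: less_add_one_iff\<close>)
  then show False using assms(2) by (auto simp: less_add_one_le)
qed

text \<open>Minimisation. Leastness is part of the conclusion because it later makes the function
  \<open>b\<close> obtained from a descending sequence monotone.\<close>

lemma rec_choice:
  assumes "rec (\<lambda>p. P (p1 p) (p2 p))" "\<And>x. \<exists>y. P x y"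
  shows "\<exists>f. cf f \<and> (\<forall>x. P x (f x) \<and> (\<forall>y<f x. \<not> P x y))"
proof -
  have P: "rec (\<lambda>x. P (f x) (g x))" if "cf f" "cf g" for f g
    using rec_comp[OF assms(1) cf_pr[OF that]] by simp
  have "\<exists>y. P x y \<and> (\<forall>z<y. \<not> P x z)" for x
  proof -
    obtain y where "P x y" using assms(2) by blast
    then show ?thesis using ex_least[of "P x" y] P[OF cf_const cf_id] by metis
  qed
  then obtain f where f: "\<And>x. P x (f x) \<and> (\<forall>z<f x. \<not> P x z)" by metis
  have "cf f"
    by (rule cf_by_rec[of "\<lambda>x y. P x y \<and> (\<forall>z<y. \<not> P x z)"])
      (intro computable P, metis f linorder_neqE)
  then show ?thesis using f by blast
qed

text \<open>The search is for the code of a value together with a witness, which is a recursive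
  condition; the value is then projected out.\<close>

lemma re_choice:
  assumes "re (\<lambda>p. P (p1 p) (p2 p))" "\<And>x. \<exists>y. P x y"
  shows "\<exists>f. cf f \<and> (\<forall>x. P x (f x))"
proof -
  obtain R where R: "rec R" "\<And>p. P (p1 p) (p2 p) \<longleftrightarrow> (\<exists>y. R (pr p y))"
    using assms unfolding re_def by blast
  have PR: "P x y \<longleftrightarrow> (\<exists>w. R (pr (pr x y) w))" for x y using R(2)[of "pr x y"] by simp
  have "\<exists>v. R (pr (pr x (p1 v)) (p2 v))" for x
    using assms(2)[of x] unfolding PR by (metis p1 p2)
  moreover have "rec (\<lambda>p. R (pr (pr (p1 p) (p1 (p2 p))) (p2 (p2 p))))"
    by (intro rec_comp[OF R(1)] computable)
  ultimately obtain g where g: "cf g" "\<And>x. R (pr (pr x (p1 (g x))) (p2 (g x)))"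
    using rec_choice[of "\<lambda>x v. R (pr (pr x (p1 v)) (p2 v))"] by blast
  show ?thesis
    by (rule exI[of _ "\<lambda>x. p1 (g x)"], intro conjI allI computable g(1)) (use g(2) PR in blast)
qed

lemma SS_iff_rec: "A \<in> SS \<longleftrightarrow> rec (\<lambda>x. x \<in> A)"
  by (simp add: rec_def)

subsection \<open>Codes of finite sets\<close>

lemma rca0_dvd_le: "a dvd b \<Longrightarrow> b \<noteq> 0 \<Longrightarrow> a \<le> (b::'a::rca0)"
proof -
  assume "a dvd b" "b \<noteq> 0"
  then obtain d where d: "b = a * d" "d \<noteq> 0" by auto
  then have "1 \<le> d" using add_one_le_iff[of 0 d] by (simp add: zero_less_iff_neq_zero)
  then have "a * 1 \<le> a * d" by (rule mult_left_mono) simp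
  then show ?thesis by (simp add: d)
qed

lemma rec_dvd [computable]:
  assumes "cf f" "cf g" shows "rec (\<lambda>x. f x dvd g x)"
proof -
  have "a dvd b \<longleftrightarrow> (\<exists>d<b + 1. b = a * d)" for a b :: 'a
  proof
    assume "a dvd b"
    then obtain d where d: "b = a * d" by blast
    then have "d \<le> b \<or> b = a * 0" using rca0_dvd_le[of d b] by auto
    then show "\<exists>d<b + 1. b = a * d" using d less_add_one_le zero_le by blast
  qed auto
  then show ?thesis by (simp, intro computable cf_comp[OF assms(1)] cf_comp[OF assms(2)])
qed

definition triple :: "'a::rca0 \<Rightarrow> bool" where
  "triple a \<longleftrightarrow> (\<exists>k m n. a = pr k (pr m n))"

definition elem :: "'a::rca0 \<Rightarrow> 'a \<Rightarrow> bool" where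
  "elem x a \<longleftrightarrow> (\<exists>k m n d. a = pr k (pr m n) \<and> x < k \<and> (m * (x + 1) + 1) * d = n)"

definition fin :: "'a::rca0 \<Rightarrow> bool" where
  "fin a \<longleftrightarrow> triple a \<and> (\<forall>b. b < a \<and> triple b \<longrightarrow> \<not> (\<forall>x. elem x b \<longleftrightarrow> elem x a))"

lemma triple_iff: "triple a \<longleftrightarrow> is_pr a \<and> is_pr (p2 a)"
  unfolding triple_def by (metis is_pr p2 pr_p)

lemma elem_iff: "elem x a \<longleftrightarrow> triple a \<and> x < p1 a \<and> p1 (p2 a) * (x + 1) + 1 dvd p2 (p2 a)"
  unfolding elem_def triple_def dvd_def by auto

lemma rec_triple [computable]: "cf f \<Longrightarrow> rec (\<lambda>x. triple (f x))"
  unfolding triple_iff by (intro computable)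

lemma rec_elem [computable]: "cf f \<Longrightarrow> cf g \<Longrightarrow> rec (\<lambda>x. elem (f x) (g x))"
  unfolding elem_iff by (intro computable)

lemma elem_less: "elem x a \<Longrightarrow> x < a"
  unfolding elem_iff using p_le(1) less_le_trans by blast

lemma rec_fin [computable]: assumes "cf f" shows "rec (\<lambda>x. fin (f x))"
proof -
  have "fin a \<longleftrightarrow> triple a \<and> (\<forall>b<a. triple b \<longrightarrow> \<not> (\<forall>x<a. elem x b \<longleftrightarrow> elem x a))" for a :: 'a
    unfolding fin_def by (meson elem_less less_trans)
  then show ?thesis by (simp, intro computable cf_comp[OF assms])
qed

lemma fin_inject: "fin a \<Longrightarrow> fin b \<Longrightarrow> (\<And>x. elem x a \<longleftrightarrow> elem x b) \<Longrightarrow> a = b"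
  unfolding fin_def by (metis linorder_neqE)

lemma ex_common_multiple: "\<exists>m::'a::rca0. 0 < m \<and> (\<forall>j<k. j + 1 dvd m)"
proof (rule re_induct[of _ k])
  show "re (\<lambda>k::'a. \<exists>m. 0 < m \<and> (\<forall>j<k. j + 1 dvd m))"
    by (intro enumerable re_rec computable)
  show "\<exists>m::'a. 0 < m \<and> (\<forall>j<0. j + 1 dvd m)" by (intro exI[of _ 1]) simp
  fix k :: 'a assume "\<exists>m. 0 < m \<and> (\<forall>j<k. j + 1 dvd m)"
  then obtain m where m: "0 < m" "\<forall>j<k. j + 1 dvd m" by blast
  have "0 < m * (k + 1)" using m(1) by (simp add: add_nonneg_pos)
  moreover have "\<forall>j<k + 1. j + 1 dvd m * (k + 1)"
    using m(2) by (auto simp: less_add_one_iff)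
  ultimately show "\<exists>m. 0 < m \<and> (\<forall>j<k + 1. j + 1 dvd m)" by blast
qed

text \<open>The moduli \<open>m (x + 1) + 1\<close> are pairwise coprime if \<open>m\<close> is divisible by all differences.\<close>

lemma modulus_dvd_mult:
  assumes m: "\<And>j. j < k \<Longrightarrow> j + 1 dvd m" and k: "x < k" "y < k" "x \<noteq> y"
    and d: "m * (x + 1) + 1 dvd n * (m * (y + 1) + (1::'a::rca0))"
  shows "m * (x + 1) + 1 dvd n"
proof -
  let ?x = "m * (x + 1) + 1" and ?y = "m * (y + 1) + 1"
  \<comment> \<open>The identity (y + 1) (m (x + 1) + 1) - (x + 1) (m (y + 1) + 1) = y - x shows
    that the modulus of \<open>x\<close> divides \<open>n\<close> times the difference;
    \<open>c + 1\<close> is its absolute value.\<close>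
  have "\<exists>c<k. ?x dvd n * (c + 1)"
  proof (cases "x < y")
    case True
    then obtain c where c: "y = x + c + 1" using rca0_less_iff by blast
    have "n * (y + 1) * ?x = n * ?y * (x + 1) + n * (c + 1)" by (simp add: c algebra_simps)
    moreover have "?x dvd n * (y + 1) * ?x" "?x dvd n * ?y * (x + 1)" using d by auto
    ultimately have "?x dvd n * (c + 1)" by (metis dvd_add_right_iff)
    moreover have "c < k" using c k(2) le_less_trans[of c y k] by (simp add: add.assoc add_increasing)
    ultimately show ?thesis by blast
  next
    case False
    then obtain c where c: "x = y + c + 1" using k(3) rca0_less_iff linorder_neqE by metis
    have "n * ?y * (x + 1) = n * (y + 1) * ?x + n * (c + 1)" by (simp add: c algebra_simps)
    moreover have "?x dvd n * (y + 1) * ?x" "?x dvd n * ?y * (x + 1)" using d by auto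
    ultimately have "?x dvd n * (c + 1)" by (metis dvd_add_right_iff)
    moreover have "c < k" using c k(1) le_less_trans[of c x k] by (simp add: add.assoc add_increasing)
    ultimately show ?thesis by blast
  qed
  then obtain c where c: "c < k" "?x dvd n * (c + 1)" by blast
  \<comment> \<open>Since \<open>m\<close> is a multiple of \<open>c + 1\<close>, the modulus
    divides \<open>n * m * (x + 1)\<close>, which differs from its multiple \<open>n * ?x\<close> by
    \<open>n\<close>.\<close>
  obtain e where "m = (c + 1) * e" using m[OF c(1)] by blast
  then have "n * m * (x + 1) = n * (c + 1) * (e * (x + 1))" by (simp add: algebra_simps)
  then have "?x dvd n * m * (x + 1)" using c(2) by (metis dvd_mult2)
  moreover have "n * ?x = n * m * (x + 1) + n" by (simp add: algebra_simps)
  ultimately show ?thesis by (metis dvd_add_right_iff dvd_triv_right)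
qed

text \<open>Goedel's beta function: Sigma01 induction on \<open>l\<close> builds \<open>n\<close> as
  a product of the moduli of the elements, and coprimality prevents any other modulus below
  \<open>k\<close> from dividing it.\<close>

lemma ex_triple:
  assumes "A \<in> SS" shows "\<exists>a::'a::rca0. triple a \<and> (\<forall>x. elem x a \<longleftrightarrow> x < k \<and> x \<in> A)"
proof -
  obtain m :: 'a where m: "0 < m" "\<And>j. j < k \<Longrightarrow> j + 1 dvd m" using ex_common_multiple by blast
  have "\<exists>n. \<forall>x<k. m * (x + 1) + 1 dvd n \<longleftrightarrow> x < l \<and> x \<in> A" for l
  proof (rule re_induct[of _ l])
    show "re (\<lambda>l. \<exists>n. \<forall>x<k. m * (x + 1) + 1 dvd n \<longleftrightarrow> x < l \<and> x \<in> A)"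
      by (intro enumerable re_rec computable assms)
    have "\<not> m * (x + 1) + 1 dvd 1" for x
    proof
      assume "m * (x + 1) + 1 dvd 1"
      then have "m * (x + 1) + 1 \<le> 1" by (rule rca0_dvd_le) simp
      then show False using m(1) by (simp add: add_eq_0_iff_both_eq_0)
    qed
    then show "\<exists>n. \<forall>x<k. m * (x + 1) + 1 dvd n \<longleftrightarrow> x < 0 \<and> x \<in> A"
      by (intro exI[of _ 1]) simp
    fix l assume "\<exists>n. \<forall>x<k. m * (x + 1) + 1 dvd n \<longleftrightarrow> x < l \<and> x \<in> A"
    then obtain n where n: "\<And>x. x < k \<Longrightarrow> m * (x + 1) + 1 dvd n \<longleftrightarrow> x < l \<and> x \<in> A" by blast
    show "\<exists>n. \<forall>x<k. m * (x + 1) + 1 dvd n \<longleftrightarrow> x < l + 1 \<and> x \<in> A"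
    proof (cases "l < k \<and> l \<in> A")
      case True
      have "m * (x + 1) + 1 dvd n * (m * (l + 1) + 1) \<longleftrightarrow> x < l + 1 \<and> x \<in> A" if "x < k" for x
      proof (cases "x = l")
        case False
        then have "m * (x + 1) + 1 dvd n * (m * (l + 1) + 1) \<longleftrightarrow> m * (x + 1) + 1 dvd n"
          using modulus_dvd_mult[OF m(2), of k x l n] that True by auto
        then show ?thesis using n[OF that] False by (simp add: less_add_one_iff)
      qed (use True in \<open>simp add: less_add_one_iff\<close>)
      then show ?thesis by blast
    next
      case False
      then show ?thesis using n by (intro exI[of _ n]) (auto simp: less_add_one_iff)
    qed
  qed
  then obtain n where n: "\<And>x. x < k \<Longrightarrow> m * (x + 1) + 1 dvd n \<longleftrightarrow> x < k \<and> x \<in> A" by blast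
  show ?thesis
    by (rule exI[of _ "pr k (pr m n)"]) (use n in \<open>auto simp: elem_iff triple_iff\<close>)
qed

lemma ex_fin:
  assumes "rec P" "\<And>x. P x \<Longrightarrow> x < k" shows "\<exists>a::'a::rca0. fin a \<and> (\<forall>x. elem x a \<longleftrightarrow> P x)"
proof -
  have "\<exists>a. triple a \<and> (\<forall>x. elem x a \<longleftrightarrow> P x)"
    using ex_triple[of "Collect P" k] assms unfolding rec_def by auto
  \<comment> \<open>Elements of the coded set are below its code and those of \<open>P\<close> below
    \<open>k\<close>, so comparison below \<open>a + k\<close> suffices. This makes the condition
    recursive, and a least triple exists.\<close>
  then obtain a where a: "triple a \<and> (\<forall>x<a + k. elem x a \<longleftrightarrow> P x)" by blast
  have P: "rec (\<lambda>x. P (f x))" if "cf f" for f by (rule rec_comp[OF assms(1) that])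
  have "\<exists>a. (triple a \<and> (\<forall>x<a + k. elem x a \<longleftrightarrow> P x))
      \<and> (\<forall>b<a. \<not> (triple b \<and> (\<forall>x<b + k. elem x b \<longleftrightarrow> P x)))"
    by (rule ex_least[of "\<lambda>a. triple a \<and> (\<forall>x<a + k. elem x a \<longleftrightarrow> P x)", OF _ a])
      (intro computable P)
  moreover have "(\<forall>x<b + k. elem x b \<longleftrightarrow> P x) \<longleftrightarrow> (\<forall>x. elem x b \<longleftrightarrow> P x)" for b
    using elem_less[of _ b] assms(2) by (meson add_strict_increasing2 add_strict_increasing less_le_trans le_add_same_cancel1 le_add_same_cancel2 zero_le)
  ultimately show ?thesis unfolding fin_def by auto
qed

subsection \<open>Finite sequences\<close>

definition at :: "'a::rca0 \<Rightarrow> 'a \<Rightarrow> 'a \<Rightarrow> bool" where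
  "at s i y \<longleftrightarrow> elem (pr i y) s"

definition fseq :: "'a::rca0 \<Rightarrow> bool" where
  "fseq s \<longleftrightarrow> fin s \<and> (\<forall>x. elem x s \<longrightarrow> (\<exists>i y. x = pr i y))
    \<and> (\<forall>i y z. at s i y \<and> at s i z \<longrightarrow> y = z) \<and> (\<exists>l. \<forall>i. i < l \<longleftrightarrow> (\<exists>y. at s i y))"

lemma rec_at [computable]: "cf f \<Longrightarrow> cf g \<Longrightarrow> cf h \<Longrightarrow> rec (\<lambda>x. at (f x) (g x) (h x))"
  unfolding at_def by (intro computable)

lemma at_less: "at s i y \<Longrightarrow> i < s" "at s i y \<Longrightarrow> y < s"
  unfolding at_def by (erule le_less_trans[OF le_pr(1) elem_less] le_less_trans[OF le_pr(2) elem_less])+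

lemma fseq_inject: "fseq s \<Longrightarrow> fseq t \<Longrightarrow> (\<And>i y. at s i y \<longleftrightarrow> at t i y) \<Longrightarrow> s = t"
  unfolding fseq_def at_def by (metis fin_inject)

lemma ex_bound: "cf f \<Longrightarrow> \<exists>b. \<forall>i<l. f i < (b::'a::rca0)"
proof (rule re_induct[of _ l])
  assume f: "cf f"
  show "re (\<lambda>l. \<exists>b. \<forall>i<l. f i < b)"
    by (intro enumerable re_rec computable cf_comp[OF f])
  fix l assume "\<exists>b. \<forall>i<l. f i < b"
  then obtain b where b: "\<forall>i<l. f i < b" by blast
  have "\<forall>i<l + 1. f i < b + f l + 1"
  proof (intro allI impI)
    fix i assume "i < l + 1"
    then have "f i \<le> b \<or> f i \<le> f l" using b less_imp_le unfolding less_add_one_iff by blast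
    then show "f i < b + f l + 1"
      unfolding less_add_one_le using add_increasing add_increasing2 zero_le by metis
  qed
  then show "\<exists>b. \<forall>i<l + 1. f i < b" by blast
qed simp

definition sq :: "'a::rca0 \<Rightarrow> ('a \<Rightarrow> 'a) \<Rightarrow> 'a" where
  "sq l f = (THE s. fseq s \<and> (\<forall>i y. at s i y \<longleftrightarrow> i < l \<and> y = f i))"

lemma sq:
  assumes "cf f" shows "fseq (sq l f)" "at (sq l f) i y \<longleftrightarrow> i < l \<and> y = f i"
proof -
  obtain b where b: "\<forall>i<l. pr i (f i) < b"
    using ex_bound[OF cf_pr[OF cf_id assms]] by blast
  have "rec (\<lambda>x. is_pr x \<and> p1 x < l \<and> p2 x = f (p1 x))" by (intro computable cf_comp[OF assms])
  from ex_fin[OF this, of b] b obtain s where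
    "fin s" "\<And>x. elem x s \<longleftrightarrow> is_pr x \<and> p1 x < l \<and> p2 x = f (p1 x)"
    by (metis pr_p)
  then have s: "fseq s \<and> (\<forall>i y. at s i y \<longleftrightarrow> i < l \<and> y = f i)"
    by (auto simp: fseq_def at_def is_pr_def)
  have "fseq (sq l f) \<and> (\<forall>i y. at (sq l f) i y \<longleftrightarrow> i < l \<and> y = f i)"
    unfolding sq_def by (rule theI, rule s) (metis fseq_inject s)
  then show "fseq (sq l f)" "at (sq l f) i y \<longleftrightarrow> i < l \<and> y = f i" by blast+
qed

text \<open>Recognises a code by conditions that can be bounded by \<open>s\<close> and
  \<open>l\<close>, unlike the length clause of \<open>fseq\<close>. This is what makes
  \<open>sq\<close> recursive in its parameters.\<close>

lemma sq_eqI: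
  assumes "fin s" "\<And>x. elem x s \<Longrightarrow> is_pr x \<and> p1 x < l \<and> p2 x = f (p1 x)"
    "\<And>i. i < l \<Longrightarrow> at s i (f i)"
  shows "s = sq l f"
proof -
  have a: "at s i y \<longleftrightarrow> i < l \<and> y = f i" for i y
    using assms(2)[of "pr i y"] assms(3)[of i] by (auto simp: at_def)
  have "\<forall>x. elem x s \<longrightarrow> (\<exists>i y. x = pr i y)"
    using assms(2) unfolding is_pr_def by blast
  then have s: "fseq s \<and> (\<forall>i y. at s i y \<longleftrightarrow> i < l \<and> y = f i)"
    unfolding fseq_def a using assms(1) by auto
  show ?thesis unfolding sq_def
    by (rule the_equality[symmetric], rule s) (metis fseq_inject s)
qed

lemma cf_sq:
  assumes "cf l" "cf (\<lambda>p. f (p1 p) (p2 p))"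
  shows "cf (\<lambda>x. sq (l x) (f x))"
proof -
  have f: "cf (\<lambda>x. f (g x) (h x))" if "cf g" "cf h" for g h
    using cf_comp[OF assms(2) cf_pr[OF that]] by simp
  let ?P = "\<lambda>x s. fin s \<and> (\<forall>y<s. elem y s \<longrightarrow> is_pr y \<and> p1 y < l x \<and> p2 y = f x (p1 y))
    \<and> (\<forall>i<l x. at s i (f x i))"
  show ?thesis
  proof (rule cf_by_rec)
    show "rec (\<lambda>p. ?P (p1 p) (p2 p))"
      by (intro computable cf_comp[OF assms(1)] f)
    fix x s
    have fx: "cf (f x)" by (rule f[OF cf_const cf_id])
    show "?P x s \<longleftrightarrow> s = sq (l x) (f x)"
    proof
      show "?P x s \<Longrightarrow> s = sq (l x) (f x)" by (intro sq_eqI) (auto dest: elem_less)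
      assume "s = sq (l x) (f x)"
      then show "?P x s"
        using sq[OF fx, of "l x"] unfolding fseq_def at_def by (metis is_pr p1 p2)
    qed
  qed
qed

text \<open>Total on all numbers: 0 outside the domain, and the least candidate if \<open>s\<close>
  does not code a function.\<close>

definition ap :: "'a::rca0 \<Rightarrow> 'a \<Rightarrow> 'a" where
  "ap s i = (if \<exists>y<s. at s i y then THE y. at s i y \<and> (\<forall>z<y. \<not> at s i z) else 0)"

lemma ap_unfold: "y = ap s i \<longleftrightarrow> (at s i y \<and> (\<forall>z<y. \<not> at s i z)) \<or> (\<not> (\<exists>y<s. at s i y) \<and> y = 0)"
proof (cases "\<exists>y<s. at s i y")
  case True
  then have "\<exists>y. at s i y \<and> (\<forall>z<y. \<not> at s i z)"
    using ex_least[of "at s i"] rec_at[OF cf_const cf_const cf_id, of s i] by auto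
  then obtain z where z: "at s i z" "\<forall>y<z. \<not> at s i y" by blast
  then have "(THE y. at s i y \<and> (\<forall>z<y. \<not> at s i z)) = z"
    by (intro the_equality) (auto, meson linorder_neqE)
  then have "ap s i = z" using True by (simp add: ap_def)
  then show ?thesis using z True by (metis linorder_neqE)
qed (auto simp: ap_def dest: at_less)

lemma cf_ap [computable]:
  assumes "cf f" "cf g" shows "cf (\<lambda>x. ap (f x) (g x))"
proof (rule cf_by_rec)
  show "rec (\<lambda>p. (at (f (p1 p)) (g (p1 p)) (p2 p) \<and> (\<forall>z<p2 p. \<not> at (f (p1 p)) (g (p1 p)) z))
    \<or> (\<not> (\<exists>y<f (p1 p). at (f (p1 p)) (g (p1 p)) y) \<and> p2 p = 0))"
    by (intro computable cf_comp[OF assms(1)] cf_comp[OF assms(2)])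
qed (simp add: ap_unfold)

lemma ap_eqI: "fseq s \<Longrightarrow> at s i y \<Longrightarrow> ap s i = y"
  using ap_unfold[of y s i] unfolding fseq_def by (metis less_irrefl)

lemma ap_sq: "cf f \<Longrightarrow> i < l \<Longrightarrow> ap (sq l f) i = f i"
  using ap_eqI sq by blast

subsection \<open>Primitive recursion\<close>

text \<open>\<open>V s i\<close> says that \<open>s\<close> records the history up to
  \<open>i\<close>. Histories exist by Sigma01 induction and agree where they overlap, so a
  recursive choice of histories gives a single function.\<close>

lemma primitive_recursion:
  assumes h: "cf (\<lambda>p. h (p1 p) (p2 p))"
  shows "\<exists>g. cf g \<and> g 0 = (a::'a::rca0) \<and> (\<forall>i. g (i + 1) = h i (g i))"
proof -
  have h': "cf (\<lambda>x. h (f x) (g x))" if "cf f" "cf g" for f g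
    using cf_comp[OF h cf_pr[OF that]] by simp
  define V where "V s i \<longleftrightarrow> ap s 0 = a \<and> (\<forall>j<i. ap s (j + 1) = h j (ap s j))" for s i
  have V: "rec (\<lambda>x. V (f x) (g x))" if "cf f" "cf g" for f g
    unfolding V_def by (intro computable h' cf_comp[OF that(1)] cf_comp[OF that(2)] that)
  have ex: "\<exists>s. V s i" for i
  proof (rule re_induct[of _ i])
    show "re (\<lambda>i. \<exists>s. V s i)" by (intro enumerable re_rec V computable)
    show "\<exists>s. V s 0"
      by (rule exI[of _ "sq 1 (\<lambda>_. a)"]) (simp add: V_def ap_sq[OF cf_const])
    fix i assume "\<exists>s. V s i"
    then obtain s where s: "V s i" by blast
    let ?f = "\<lambda>j. if j \<le> i then ap s j else h i (ap s i)"
    have f: "cf ?f" by (intro computable h')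
    let ?t = "sq (i + 1 + 1) ?f"
    have t: "ap ?t j = ?f j" if "j \<le> i + 1" for j
      using that by (simp only: ap_sq[OF f] less_add_one_le)
    have "ap ?t (j + 1) = h j (ap ?t j)" if "j < i + 1" for j
    proof (cases "j = i")
      case True
      then show ?thesis using t[of i] t[of "i + 1"] by (simp add: add_one_le_iff)
    next
      case False
      then have "j < i" using that by (simp add: less_add_one_iff)
      moreover from this have "j \<le> i + 1" by (simp add: add_increasing2 less_imp_le)
      ultimately show ?thesis using t[of j] t[of "j + 1"] s
        by (simp add: add_one_le_iff less_imp_le V_def)
    qed
    then have "V ?t (i + 1)" using s t[of 0] by (simp add: V_def)
    then show "\<exists>s. V s (i + 1)" by blast
  qed
  have agree: "ap s j = ap t j" if s: "V s i" and t: "V t i'" and j: "j \<le> i" "j \<le> i'" for s t i i' j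
  proof -
    have "j \<le> i \<and> j \<le> i' \<longrightarrow> ap s j = ap t j"
    proof (rule rec_induct[of _ j])
      show "rec (\<lambda>j. j \<le> i \<and> j \<le> i' \<longrightarrow> ap s j = ap t j)" by (intro computable)
    qed (use s t in \<open>auto simp: V_def add_one_le_iff\<close>)
    then show ?thesis using j by blast
  qed
  obtain S where S: "cf S" "\<And>i. V (S i) i"
    using rec_choice[of "\<lambda>i s. V s i", OF V[OF cf_p2[OF cf_id] cf_p1[OF cf_id]] ex] by blast
  show ?thesis
  proof (intro exI conjI allI)
    show "cf (\<lambda>i. ap (S i) i)" by (intro computable S(1))
    show "ap (S 0) 0 = a" using S(2)[of 0] by (simp add: V_def)
    fix i
    have "ap (S (i + 1)) (i + 1) = h i (ap (S (i + 1)) i)"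
      using S(2)[of "i + 1"] by (simp add: V_def less_add_one_le)
    also have "ap (S (i + 1)) i = ap (S i) i"
      by (rule agree[OF S(2) S(2)]) auto
    finally show "ap (S (i + 1)) (i + 1) = h i (ap (S i) i)" .
  qed
qed

subsection \<open>Embeddings of initial segments\<close>

type_synonym 'a brel = "'a \<Rightarrow> 'a \<Rightarrow> bool"

definition is_fun :: "('a \<Rightarrow> bool) \<Rightarrow> ('a \<Rightarrow> bool) \<Rightarrow> 'a brel \<Rightarrow> bool" where
  "is_fun A B f \<longleftrightarrow> (\<forall>x y. f x y \<longrightarrow> A x \<and> B y) \<and> (\<forall>x. A x \<longrightarrow> (\<exists>y. f x y \<and> (\<forall>z. f x z \<longrightarrow> z = y)))"

definition is_emb :: "('a \<Rightarrow> bool) \<Rightarrow> 'a brel \<Rightarrow> ('a \<Rightarrow> bool) \<Rightarrow> 'a brel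
    \<Rightarrow> 'a brel \<Rightarrow> bool" where
  "is_emb A LA B LB f \<longleftrightarrow> is_fun A B f \<and> (\<forall>x x' y y'. LA x x' \<and> f x y \<and> f x' y' \<longrightarrow> LB y y')"

definition seg_less :: "'a::rca0 \<Rightarrow> 'a \<Rightarrow> 'a \<Rightarrow> bool" where
  "seg_less n x y \<longleftrightarrow> x < y \<and> y < n"

definition emb :: "'a::rca0 \<Rightarrow> 'a \<Rightarrow> 'a \<Rightarrow> bool" where
  "emb m n s \<longleftrightarrow> fseq s \<and> is_emb (\<lambda>x. x < m) (seg_less m) (\<lambda>x. x < n) (seg_less n) (at s)"

lemma emb_iff: "emb m n s \<longleftrightarrow> fseq s \<and> (\<forall>i y. at s i y \<longleftrightarrow> i < m \<and> y = ap s i)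
  \<and> (\<forall>i<m. ap s i < n) \<and> (\<forall>j<m. \<forall>i<j. ap s i < ap s j)"
proof
  assume e: "emb m n s"
  then have s: "fseq s" by (simp add: emb_def)
  have at: "at s i y \<longleftrightarrow> i < m \<and> y = ap s i" for i y
    using e ap_eqI[OF s] unfolding emb_def is_emb_def is_fun_def by metis
  have "ap s i < n" if "i < m" for i
    using e at[of i "ap s i"] that unfolding emb_def is_emb_def is_fun_def by simp
  moreover have "ap s i < ap s j" if "i < j" "j < m" for i j
  proof -
    have "at s i (ap s i)" "at s j (ap s j)" using at that less_trans by blast+
    then show ?thesis using e that unfolding emb_def is_emb_def seg_less_def by blast
  qed
  ultimately show "fseq s \<and> (\<forall>i y. at s i y \<longleftrightarrow> i < m \<and> y = ap s i)
    \<and> (\<forall>i<m. ap s i < n) \<and> (\<forall>j<m. \<forall>i<j. ap s i < ap s j)"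
    using s at by blast
qed (auto simp: emb_def is_emb_def is_fun_def seg_less_def)

lemma emb_fseq: "emb m n s \<Longrightarrow> fseq s"
  and emb_at: "emb m n s \<Longrightarrow> at s i y \<longleftrightarrow> i < m \<and> y = ap s i"
  and emb_less: "emb m n s \<Longrightarrow> i < m \<Longrightarrow> ap s i < n"
  and emb_mono: "emb m n s \<Longrightarrow> i < j \<Longrightarrow> j < m \<Longrightarrow> ap s i < ap s j"
  by (simp_all add: emb_iff)

lemma emb_less_iff: "emb m n s \<Longrightarrow> i < m \<Longrightarrow> j < m \<Longrightarrow> ap s i < ap s j \<longleftrightarrow> i < j"
  by (cases i j rule: linorder_cases) (auto dest: emb_mono[of m n s i j] emb_mono[of m n s j i])

lemma emb_inject: "emb m n s \<Longrightarrow> i < m \<Longrightarrow> j < m \<Longrightarrow> ap s i = ap s j \<longleftrightarrow> i = j"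
  by (cases i j rule: linorder_cases) (auto dest: emb_mono[of m n s i j] emb_mono[of m n s j i])

text \<open>The unbounded length clause of \<open>fseq\<close> is avoided by comparing
  \<open>s\<close> with a sequence of the given length \<open>m\<close>.\<close>

lemma rec_emb [computable]:
  assumes "cf f" "cf g" "cf h" shows "rec (\<lambda>x. emb (f x) (g x) (h x))"
proof -
  have "emb m n s \<longleftrightarrow> fin s \<and> (\<forall>x<s. elem x s \<longrightarrow> is_pr x \<and> p1 x < m \<and> p2 x = ap s (p1 x))
    \<and> (\<forall>i<m. at s i (ap s i)) \<and> (\<forall>i<m. ap s i < n) \<and> (\<forall>j<m. \<forall>i<j. ap s i < ap s j)" (is "_ \<longleftrightarrow> ?R") for m n s :: 'a
  proof
    have c: "cf (ap s)" using cf_ap[OF cf_const cf_id, of s] by simp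
    show "emb m n s \<Longrightarrow> ?R"
      unfolding emb_iff fseq_def at_def by (metis is_pr p1 p2)
    assume R: "?R"
    then have "s = sq m (ap s)" by (intro sq_eqI) (auto dest: elem_less)
    then show "emb m n s" unfolding emb_iff using R sq[OF c, of m] by metis
  qed
  then show ?thesis
    by (simp, intro computable cf_comp[OF assms(1)] cf_comp[OF assms(2)] cf_comp[OF assms(3)] assms)
qed

lemma emb_sq:
  assumes "cf f" "\<And>i. i < m \<Longrightarrow> f i < n" "\<And>i j. i < j \<Longrightarrow> j < m \<Longrightarrow> f i < f j"
  shows "emb m n (sq m f)"
proof -
  note s = sq[OF assms(1)] ap_sq[OF assms(1)]
  have "ap (sq m f) i < ap (sq m f) j" if "i < j" "j < m" for i j
    using assms(3)[OF that] s(3)[of i m] s(3)[of j m] that by (simp add: less_trans[OF that])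
  then show ?thesis unfolding emb_iff using assms(2) s by auto
qed

lemma emb_ext:
  "emb m n s \<Longrightarrow> emb m n' t \<Longrightarrow> (\<And>i. i < m \<Longrightarrow> ap s i = ap t i) \<Longrightarrow> s = t"
  by (rule fseq_inject) (auto simp: emb_iff)

lemma emb_widen: "emb m n s \<Longrightarrow> (\<And>i. i < m \<Longrightarrow> ap s i < n') \<Longrightarrow> emb m n' s"
  by (simp add: emb_iff)

section \<open>Ranges, factorisation and enumeration\<close>

definition rng :: "'a::rca0 \<Rightarrow> 'a \<Rightarrow> bool" where
  "rng s y \<longleftrightarrow> (\<exists>i. at s i y)"

lemma rng_iff: "emb m n s \<Longrightarrow> rng s y \<longleftrightarrow> (\<exists>i<m. y = ap s i)"
  by (auto simp: rng_def emb_at)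

lemma rng_less: "emb m n s \<Longrightarrow> rng s y \<Longrightarrow> y < n"
  by (auto simp: rng_iff emb_less)

lemma rec_rng [computable]: assumes "cf f" "cf g" shows "rec (\<lambda>x. rng (f x) (g x))"
proof -
  have "rng s y \<longleftrightarrow> (\<exists>i<s. at s i y)" for s y :: 'a
    unfolding rng_def by (meson at_less)
  then show ?thesis by (simp, intro computable cf_comp[OF assms(1)] cf_comp[OF assms(2)] assms)
qed

lemma cf_ap': "cf (ap s)"
  using cf_ap[OF cf_const cf_id, of s] by simp

lemma ap_sq_comp: "i < k \<Longrightarrow> ap (sq k (\<lambda>i. ap t (ap s i))) i = ap t (ap s i)"
  by (rule ap_sq[OF cf_comp[OF cf_ap' cf_ap']])

lemma emb_comp:
  assumes "emb k m s" "emb m n t" shows "emb k n (sq k (\<lambda>i. ap t (ap s i)))"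
  using assms by (intro emb_sq cf_comp[OF cf_ap' cf_ap'])
    (auto intro: emb_less emb_mono)

abbreviation "idm m \<equiv> sq m (\<lambda>i. i)"

lemma emb_id: "m \<le> n \<Longrightarrow> emb m n (idm m)"
  by (rule emb_sq[OF cf_id]) auto

text \<open>\<open>w\<close> looks up the position at which \<open>s\<close> takes a given value of
  \<open>t\<close>; it increases because \<open>s\<close> and \<open>t\<close> do.\<close>

lemma emb_factor:
  assumes s: "emb m n s" and t: "emb k n t" and r: "\<And>y. rng t y \<Longrightarrow> rng s y"
  shows "\<exists>w. emb k m w \<and> (\<forall>i<k. ap s (ap w i) = ap t i)"
proof -
  have "\<exists>j. i < k \<longrightarrow> j < m \<and> ap s j = ap t i" for i
    using r rng_iff[OF s] rng_iff[OF t] by metis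
  moreover have "rec (\<lambda>p. p1 p < k \<longrightarrow> p2 p < m \<and> ap s (p2 p) = ap t (p1 p))"
    by (intro computable)
  ultimately obtain f where f: "cf f" "\<And>i. i < k \<longrightarrow> f i < m \<and> ap s (f i) = ap t i"
    using rec_choice[of "\<lambda>i j. i < k \<longrightarrow> j < m \<and> ap s j = ap t i"] by blast
  have "f i < f j" if "i < j" "j < k" for i j
    using f(2)[of i] f(2)[of j] that emb_less_iff[OF s, of "f i" "f j"] emb_mono[OF t that] by auto
  then have "emb k m (sq k f)" using f(2) by (intro emb_sq[OF f(1)]) auto
  then show ?thesis using f ap_sq[OF f(1)] by metis
qed

lemma emb_ge: "emb k m w \<Longrightarrow> i < k \<Longrightarrow> i \<le> ap w i"
proof -
  assume w: "emb k m w"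
  have "i < k \<longrightarrow> i \<le> ap w i"
  proof (rule rec_induct[of _ i])
    show "rec (\<lambda>i. i < k \<longrightarrow> i \<le> ap w i)" by (intro computable)
    fix i assume IH: "i < k \<longrightarrow> i \<le> ap w i"
    show "i + 1 < k \<longrightarrow> i + 1 \<le> ap w (i + 1)"
    proof
      assume k: "i + 1 < k"
      have "i < i + 1" by simp
      then have "ap w i < ap w (i + 1)" "i < k" using emb_mono[OF w _ k] k less_trans by blast+
      then show "i + 1 \<le> ap w (i + 1)" using IH unfolding add_one_le_iff by auto
    qed
  qed simp
  then show "i < k \<Longrightarrow> i \<le> ap w i" by blast
qed

text \<open>If \<open>m\<close> were below \<open>k\<close>, the value of \<open>w\<close> at
  \<open>m\<close> would be both below \<open>m\<close> and, by \<open>emb_ge\<close>, at least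
  \<open>m\<close>.\<close>

lemma emb_le: "emb k m w \<Longrightarrow> k \<le> m"
  using emb_ge[of k m w m] emb_less[of k m w m] by (meson leD leI)

text \<open>Each embedding factors through the other, by \<open>w\<close> and \<open>v\<close>. As
  \<open>s\<close> is injective, \<open>w\<close> after \<open>v\<close> is the identity; neither
  decreases an argument, so \<open>v\<close> is the identity as well.\<close>

lemma emb_unique:
  assumes s: "emb m n s" and t: "emb k n t" and r: "\<And>y. rng s y \<longleftrightarrow> rng t y"
  shows "m = k" "s = t"
proof -
  obtain w where w: "emb k m w" "\<And>i. i < k \<Longrightarrow> ap s (ap w i) = ap t i"
    using emb_factor[OF s t] r by blast
  obtain v where v: "emb m k v" "\<And>i. i < m \<Longrightarrow> ap t (ap v i) = ap s i"
    using emb_factor[OF t s] r by blast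
  show mk: "m = k" using emb_le[OF w(1)] emb_le[OF v(1)] by simp
  show "s = t"
  proof (rule emb_ext[OF s])
    show "emb m n t" using t mk by simp
    fix i assume i: "i < m"
    have "ap v i < k" using emb_less[OF v(1) i] .
    have "ap s (ap w (ap v i)) = ap s i" using w(2) v(2) i \<open>ap v i < k\<close> by simp
    then have "ap w (ap v i) = i"
      using emb_inject[OF s] emb_less[OF w(1) \<open>ap v i < k\<close>] i by blast
    moreover have "ap v i \<le> ap w (ap v i)" using emb_ge[OF w(1) \<open>ap v i < k\<close>] .
    ultimately have "ap v i = i" using emb_ge[OF v(1) i] by simp
    then show "ap s i = ap t i" using v(2)[OF i] by simp
  qed
qed

text \<open>Sigma01 induction on \<open>j\<close> appends \<open>j\<close> to the enumeration of the
  smaller elements if it satisfies \<open>P\<close>. The bound \<open>y < n\<close> keeps the matrix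
  recursive.\<close>

lemma ex_enum:
  assumes P: "rec P" "\<And>x. P x \<Longrightarrow> x < n"
  shows "\<exists>l e. emb l n e \<and> (\<forall>y. rng e y \<longleftrightarrow> P y)"
proof -
  have "\<exists>l e. emb l n e \<and> (\<forall>y<n. rng e y \<longleftrightarrow> P y \<and> y < j)" for j
  proof (rule re_induct[of _ j])
    show "re (\<lambda>j. \<exists>l e. emb l n e \<and> (\<forall>y<n. rng e y \<longleftrightarrow> P y \<and> y < j))"
      by (intro enumerable re_rec computable rec_comp[OF P(1)])
    have "emb 0 n (idm 0)" by (rule emb_id) simp
    then show "\<exists>l e. emb l n e \<and> (\<forall>y<n. rng e y \<longleftrightarrow> P y \<and> y < 0)"
      using rng_iff[of 0 n "idm 0"] by (metis not_less_zero)
    fix j assume "\<exists>l e. emb l n e \<and> (\<forall>y<n. rng e y \<longleftrightarrow> P y \<and> y < j)"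
    then obtain l e where e: "emb l n e" "\<And>y. rng e y \<longleftrightarrow> P y \<and> y < j" using rng_less P(2) by metis
    show "\<exists>l e. emb l n e \<and> (\<forall>y<n. rng e y \<longleftrightarrow> P y \<and> y < j + 1)"
    proof (cases "P j")
      case True
      let ?f = "\<lambda>i. if i < l then ap e i else j"
      have f: "cf ?f" by (intro computable)
      have l: "ap e i < j" if "i < l" for i using e rng_iff[OF e(1)] that by blast
      have em: "emb (l + 1) n (sq (l + 1) ?f)"
      proof (rule emb_sq[OF f])
        show "?f i < n" for i using emb_less[OF e(1)] P(2)[OF True] by simp
        show "?f i < ?f k" if "i < k" "k < l + 1" for i k
          using that emb_mono[OF e(1)] l by (auto simp: less_add_one_iff)
      qed
      have "rng (sq (l + 1) ?f) y \<longleftrightarrow> rng e y \<or> y = j" for y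
        unfolding rng_iff[OF em] rng_iff[OF e(1)] using ap_sq[OF f, of _ "l + 1"]
        by (auto simp: less_add_one_iff)
      then have "\<forall>y<n. rng (sq (l + 1) ?f) y \<longleftrightarrow> P y \<and> y < j + 1"
        using True e(2) by (auto simp: less_add_one_iff)
      then show ?thesis using em by blast
    next
      case False
      then have "P y \<and> y < j + 1 \<longleftrightarrow> P y \<and> y < j" for y by (auto simp: less_add_one_iff)
      then show ?thesis using e by auto
    qed
  qed
  then show ?thesis using P(2) rng_less by metis
qed

lemma cf_pred [computable]:
  assumes "cf f" shows "cf (\<lambda>x. f x - 1)"
proof -
  have e: "y = a - 1 \<longleftrightarrow> a = 0 \<and> y = 0 \<or> a = y + 1" for y a :: 'a
    using nonzero_add_one[of a] rca0_diff_less[of 0 "1 :: 'a"]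
    by (cases "a = 0") (auto simp: add_eq_0_iff_both_eq_0)
  show ?thesis
    by (rule cf_by_rec[of "\<lambda>x y. f x = 0 \<and> y = 0 \<or> f x = y + 1"])
      (intro computable cf_comp[OF assms], simp add: e)
qed

text \<open>For \<open>y < n\<close> this is the coface map of simplicial sets, the embedding of
  \<open>n - 1\<close> in \<open>n\<close> that misses just \<open>y\<close>.\<close>

definition skip :: "'a::rca0 \<Rightarrow> 'a \<Rightarrow> 'a" where
  "skip n y = sq (n - 1) (\<lambda>i. if i < y then i else i + 1)"

lemma cf_skip [computable]: assumes "cf f" "cf g" shows "cf (\<lambda>x. skip (f x) (g x))"
  unfolding skip_def
  by (rule cf_sq) (intro computable cf_comp[OF assms(2)] assms)+

lemma skip:
  assumes "y < n" shows "emb (n - 1) n (skip n y)" "rng (skip n y) z \<longleftrightarrow> z < n \<and> z \<noteq> y"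
proof -
  obtain m where m: "n = m + 1" using assms nonzero_add_one[of n] not_less_zero by blast
  let ?f = "\<lambda>i. if i < y then i else i + 1"
  have f: "cf ?f" by (intro computable)
  show e: "emb (n - 1) n (skip n y)"
    unfolding skip_def m by (rule emb_sq[OF f]) (auto simp: less_add_one_le add_one_le_iff)
  have "(\<exists>i<m. z = ?f i) \<longleftrightarrow> z < n \<and> z \<noteq> y"
  proof
    assume "z < n \<and> z \<noteq> y"
    then consider "z < y" | w where "z = w + 1" "y \<le> w"
      using nonzero_add_one[of z] by (metis less_add_one_le linorder_neqE not_less_zero)
    then show "\<exists>i<m. z = ?f i"
    proof cases
      case 1
      then show ?thesis using assms unfolding m by (auto simp: less_add_one_le)
    next
      case 2
      then show ?thesis using \<open>z < n \<and> _\<close> unfolding m by (intro exI[of _ w]) auto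
    qed
  next
    assume "\<exists>i<m. z = ?f i"
    then show "z < n \<and> z \<noteq> y"
      using assms unfolding m by (auto simp: less_add_one_le add_one_le_iff split: if_splits)
  qed
  then show "rng (skip n y) z \<longleftrightarrow> z < n \<and> z \<noteq> y"
    unfolding rng_iff[OF e] using ap_sq[OF f, of _ m] by (auto simp: skip_def m)
qed

section \<open>The sentence in a model\<close>

subsection \<open>Translation of named-variable formulas\<close>

text \<open>
  A world assigns values to the levels of the variables in scope. A term or formula that is built
  from bound variables at some depth has the same value at all greater depths, so its value is
  characterised in all extensions of the world at hand.
\<close>

datatype 'a world = World (num_val: "nat \<Rightarrow> 'a") (num_depth: nat)
  (set_val: "nat \<Rightarrow> 'a set") (set_depth: nat) (num_free: "nat \<Rightarrow> 'a") (set_free: "nat \<Rightarrow> 'a set")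

definition num_env :: "'a world \<Rightarrow> nat \<Rightarrow> 'a" where
  "num_env w i = (if i < num_depth w then num_val w (num_depth w - Suc i) else num_free w (i - num_depth w))"

definition set_env :: "'a world \<Rightarrow> nat \<Rightarrow> 'a set" where
  "set_env w i = (if i < set_depth w then set_val w (set_depth w - Suc i) else set_free w (i - set_depth w))"

definition extends :: "'a world \<Rightarrow> 'a world \<Rightarrow> bool" where
  "extends w w' \<longleftrightarrow> num_depth w \<le> num_depth w' \<and> set_depth w \<le> set_depth w'
    \<and> (\<forall>i<num_depth w. num_val w' i = num_val w i) \<and> (\<forall>i<set_depth w. set_val w' i = set_val w i)"

definition valT :: "'a::rca0 world \<Rightarrow> nterm \<Rightarrow> 'a \<Rightarrow> bool" where
  "valT w t v \<longleftrightarrow> (\<forall>w'. extends w w' \<longrightarrow> tval (num_env w') (t (num_depth w')) = v)"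

definition valS :: "'a::rca0 world \<Rightarrow> sterm \<Rightarrow> 'a set \<Rightarrow> bool" where
  "valS w X A \<longleftrightarrow> (\<forall>w'. extends w w' \<longrightarrow> set_env w' (X (set_depth w')) = A)"

definition valF :: "'a::rca0 world \<Rightarrow> frm \<Rightarrow> bool \<Rightarrow> bool" where
  "valF w p P \<longleftrightarrow> (\<forall>w'. extends w w' \<longrightarrow>
    (sat (num_env w') (set_env w') (p (num_depth w') (set_depth w')) \<longleftrightarrow> P))"

definition valR :: "'a::rca0 world \<Rightarrow> rel \<Rightarrow> 'a brel \<Rightarrow> bool" where
  "valR w f r \<longleftrightarrow> (\<forall>w' s t u v. extends w w' \<longrightarrow> valT w' s u \<longrightarrow> valT w' t v \<longrightarrow> valF w' (f s t) (r u v))"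

definition valO :: "'a::rca0 world \<Rightarrow> ord \<Rightarrow> ('a \<Rightarrow> bool) \<Rightarrow> 'a brel \<Rightarrow> bool" where
  "valO w A e l \<longleftrightarrow> valR w (lss A) l \<and> (\<forall>w' t v. extends w w' \<longrightarrow> valT w' t v \<longrightarrow> valF w' (elt A t) (e v))"

named_theorems tr

lemma extends_refl [simp, tr]: "extends w w"
  by (auto simp: extends_def)

lemma extends_trans: "extends v w \<Longrightarrow> extends u v \<Longrightarrow> extends u w"
  by (auto simp: extends_def)

lemma valT_back: "extends v w \<Longrightarrow> valT v t x \<Longrightarrow> valT w t x"
  unfolding valT_def using extends_trans by blast

lemma valS_back: "extends v w \<Longrightarrow> valS v X A \<Longrightarrow> valS w X A"
  unfolding valS_def using extends_trans by blast

lemma valR_back: "extends v w \<Longrightarrow> valR v f r \<Longrightarrow> valR w f r"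
  unfolding valR_def by (intro allI impI) (drule (1) extends_trans[rotated], simp)

lemma valO_back: "extends v w \<Longrightarrow> valO v B e l \<Longrightarrow> valO w B e l"
  unfolding valO_def by (intro conjI allI impI, simp add: valR_back) (drule (1) extends_trans[rotated], simp)

text \<open>Facts about variables bound further outside are carried by these rules into the worlds
  of inner quantifiers.\<close>

lemmas weaken = valT_back valS_back valR_back valO_back extends_trans

lemma valT_intros [tr]:
  "valT w \<^bold>0 0" "valT w \<^bold>1 1" "valT w s x \<Longrightarrow> valT w t y \<Longrightarrow> valT w (s \<^bold>+ t) (x + y)"
  "valT w s x \<Longrightarrow> valT w t y \<Longrightarrow> valT w (s \<^bold>* t) (x * y)"
  by (simp_all add: valT_def t_zero_def t_one_def t_add_def t_mul_def)

lemma valT_pair [tr]: "valT w s x \<Longrightarrow> valT w t y \<Longrightarrow> valT w \<^bold>\<langle>s, t\<^bold>\<rangle> (pr x y)"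
  unfolding t_pair_def pr_def by (intro tr)

lemma valF_connectives [tr]:
  "valF w p P \<Longrightarrow> valF w q Q \<Longrightarrow> valF w (p \<^bold>\<longrightarrow> q) (P \<longrightarrow> Q)"
  "valF w p P \<Longrightarrow> valF w q Q \<Longrightarrow> valF w (p \<^bold>\<and> q) (P \<and> Q)"
  "valF w p P \<Longrightarrow> valF w q Q \<Longrightarrow> valF w (p \<^bold>\<or> q) (P \<or> Q)"
  "valF w p P \<Longrightarrow> valF w q Q \<Longrightarrow> valF w (p \<^bold>\<longleftrightarrow> q) (P \<longleftrightarrow> Q)"
  "valF w p P \<Longrightarrow> valF w (\<^bold>\<not> p) (\<not> P)"
  by (auto simp: valF_def f_imp_def f_and_def f_or_def f_iff_def f_not_def)

lemma valF_atoms [tr]: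
  "valT w s x \<Longrightarrow> valT w t y \<Longrightarrow> valF w (s \<^bold>= t) (x = y)"
  "valT w s x \<Longrightarrow> valT w t y \<Longrightarrow> valF w (s \<^bold>< t) (x < y)"
  "valT w s x \<Longrightarrow> valS w X A \<Longrightarrow> valF w (s \<^bold>\<in> X) (x \<in> A)"
  by (auto simp: valF_def valT_def valS_def f_eq_def f_less_def f_mem_def)

text \<open>The semantic side of entering a quantifier: the new variable occupies the level given by
  the current depth, where it is found in all further extensions.\<close>

lemma push_num:
  fixes w :: "'a::rca0 world"
  obtains w' where "extends w w'" "valT w' (\<lambda>d. Var (d - Suc (num_depth w))) v"
    "num_env w' = case_nat v (num_env w)" "set_env w' = set_env w"
    "num_depth w' = Suc (num_depth w)" "set_depth w' = set_depth w"
proof -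
  obtain \<nu> n \<mu> m e E where w: "w = World \<nu> n \<mu> m e E" by (cases w)
  let ?w = "World (\<nu>(n := v)) (Suc n) \<mu> m e E"
  have "num_env ?w = case_nat v (num_env w)"
    by (rule ext) (auto simp: num_env_def w split: nat.split)
  then show ?thesis
    by (intro that[of ?w]) (auto simp: w extends_def valT_def num_env_def set_env_def fun_eq_iff)
qed

lemma push_set:
  fixes w :: "'a::rca0 world"
  obtains w' where "extends w w'" "valS w' (\<lambda>d. d - Suc (set_depth w)) A"
    "num_env w' = num_env w" "set_env w' = case_nat A (set_env w)"
    "num_depth w' = num_depth w" "set_depth w' = Suc (set_depth w)"
proof -
  obtain \<nu> n \<mu> m e E where w: "w = World \<nu> n \<mu> m e E" by (cases w)
  let ?w = "World \<nu> n (\<mu>(m := A)) (Suc m) e E"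
  have "set_env ?w = case_nat A (set_env w)"
    by (rule ext) (auto simp: set_env_def w split: nat.split)
  then show ?thesis
    by (intro that[of ?w]) (auto simp: w extends_def valS_def num_env_def set_env_def fun_eq_iff)
qed

text \<open>The premise allows arbitrary terms, which lets the rule descend through higher-order
  syntax; it is applied to the bound variable in a world with one more level.\<close>

lemma valF_alln [tr]:
  assumes "\<And>w' t v. extends w w' \<Longrightarrow> valT w' t v \<Longrightarrow> valF w' (p t) (P v)"
  shows "valF w (f_alln p) (\<forall>v. P v)"
  unfolding valF_def
proof (intro allI impI)
  fix w' assume w': "extends w w'"
  let ?x = "\<lambda>d. Var (d - Suc (num_depth w'))"
  have "sat (case_nat v (num_env w')) (set_env w') (p ?x (Suc (num_depth w')) (set_depth w')) \<longleftrightarrow> P v" for v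
  proof -
    obtain w'' where w'': "extends w' w''" "valT w'' ?x v"
      "num_env w'' = case_nat v (num_env w')" "set_env w'' = set_env w'"
      "num_depth w'' = Suc (num_depth w')" "set_depth w'' = set_depth w'" by (rule push_num)
    from assms[OF extends_trans[OF w''(1) w'] w''(2)] show ?thesis
      unfolding valF_def using extends_refl[of w''] w''(3-6) by metis
  qed
  then show "sat (num_env w') (set_env w') (f_alln p (num_depth w') (set_depth w')) \<longleftrightarrow> (\<forall>v. P v)"
    by (simp add: f_alln_def)
qed

lemma valF_alls [tr]:
  assumes "\<And>w' X A. extends w w' \<Longrightarrow> valS w' X A \<Longrightarrow> valF w' (p X) (P A)"
  shows "valF w (f_alls p) (\<forall>A\<in>SS. P A)"
  unfolding valF_def
proof (intro allI impI)
  fix w' assume w': "extends w w'"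
  let ?x = "\<lambda>d. d - Suc (set_depth w')"
  have "sat (num_env w') (case_nat A (set_env w')) (p ?x (num_depth w') (Suc (set_depth w'))) \<longleftrightarrow> P A"
    if A: "A \<in> SS" for A
  proof -
    obtain w'' where w'': "extends w' w''" "valS w'' ?x A"
      "num_env w'' = num_env w'" "set_env w'' = case_nat A (set_env w')"
      "num_depth w'' = num_depth w'" "set_depth w'' = Suc (set_depth w')" by (rule push_set)
    from assms[OF extends_trans[OF w''(1) w'] w''(2)] show ?thesis
      unfolding valF_def using extends_refl[of w''] w''(3-6) by metis
  qed
  then show "sat (num_env w') (set_env w') (f_alls p (num_depth w') (set_depth w')) \<longleftrightarrow> (\<forall>A\<in>SS. P A)"
    by (simp add: f_alls_def)
qed

lemma f_exn_alln: "f_exn p = (\<^bold>\<not> (\<^bold>\<forall>x. \<^bold>\<not> p x))"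
  by (simp add: f_exn_def f_alln_def f_not_def)

lemma f_exs_alls: "f_exs p = (\<^bold>\<not> (\<^bold>\<forall>\<^sub>S X. \<^bold>\<not> p X))"
  by (simp add: f_exs_def f_alls_def f_not_def)

lemma valF_exn [tr]:
  assumes "\<And>w' t v. extends w w' \<Longrightarrow> valT w' t v \<Longrightarrow> valF w' (p t) (P v)"
  shows "valF w (f_exn p) (\<exists>v. P v)"
  unfolding f_exn_alln using valF_connectives(5)[OF valF_alln[OF valF_connectives(5)[OF assms]]] by simp

lemma valF_exs [tr]:
  assumes "\<And>w' X A. extends w w' \<Longrightarrow> valS w' X A \<Longrightarrow> valF w' (p X) (P A)"
  shows "valF w (f_exs p) (\<exists>A\<in>SS. P A)"
  unfolding f_exs_alls using valF_connectives(5)[OF valF_alls[OF valF_connectives(5)[OF assms]]] by simp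

lemma valR_apply:
  "valR v f r \<Longrightarrow> extends v w \<Longrightarrow> valT w s x \<Longrightarrow> valT w t y \<Longrightarrow> valF w (f s t) (r x y)"
  unfolding valR_def by blast

lemma valR_intro:
  assumes "\<And>w' s t x y. extends w w' \<Longrightarrow> valT w' s x \<Longrightarrow> valT w' t y \<Longrightarrow> valF w' (f s t) (r x y)"
  shows "valR w f r"
  unfolding valR_def using assms by blast

lemma valO_elt: "valO v A e l \<Longrightarrow> extends v w \<Longrightarrow> valT w t x \<Longrightarrow> valF w (elt A t) (e x)"
  unfolding valO_def by blast

lemma valO_lss:
  "valO v A e l \<Longrightarrow> extends v w \<Longrightarrow> valT w s x \<Longrightarrow> valT w t y \<Longrightarrow> valF w (lss A s t) (l x y)"
  unfolding valO_def using valR_apply by blast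

lemma valO_intro:
  assumes "\<And>w' t x. extends w w' \<Longrightarrow> valT w' t x \<Longrightarrow> valF w' (p t) (e x)"
    "\<And>w' s t x y. extends w w' \<Longrightarrow> valT w' s x \<Longrightarrow> valT w' t y \<Longrightarrow> valF w' (q s t) (l x y)"
  shows "valO w (Ord p q) e l"
  unfolding valO_def valR_def using assms by simp

section \<open>Translation of finite sets, orders and maps\<close>

lemma valF_triple [tr]: "valT w a x \<Longrightarrow> valF w (is_triple a) (triple x)"
  unfolding is_triple_def triple_def
  by (assumption | rule tr  | (rule weaken, assumption))+

lemma valF_elem [tr]: "valT w s x \<Longrightarrow> valT w a y \<Longrightarrow> valF w (s \<^bold>\<epsilon> a) (elem x y)"
  unfolding f_elem_def elem_def
  by (assumption | rule tr  | (rule weaken, assumption))+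

lemma valF_finset [tr]: "valT w a x \<Longrightarrow> valF w (finset a) (fin x)"
  unfolding finset_def fin_def
  by (assumption | rule tr  | (rule weaken, assumption))+

lemma valF_finseq [tr]: "valT w s x \<Longrightarrow> valF w (finseq s) (fseq x)"
  unfolding finseq_def fseq_def at_def
  by (assumption | rule tr  | (rule weaken, assumption))+

definition is_lin :: "('a \<Rightarrow> bool) \<Rightarrow> 'a brel \<Rightarrow> bool" where
  "is_lin A L \<longleftrightarrow> (\<forall>x. \<not> L x x) \<and> (\<forall>x y. L x y \<longrightarrow> A x \<and> A y)
    \<and> (\<forall>x y z. L x y \<and> L y z \<longrightarrow> L x z) \<and> (\<forall>x y. A x \<and> A y \<longrightarrow> L x y \<or> x = y \<or> L y x)"

definition cmp :: "'a brel \<Rightarrow> 'a brel \<Rightarrow> 'a \<Rightarrow> 'a \<Rightarrow> bool" where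
  "cmp f g x z \<longleftrightarrow> (\<exists>y. f x y \<and> g y z)"

definition sm :: "'a brel \<Rightarrow> 'a brel \<Rightarrow> bool" where
  "sm f g \<longleftrightarrow> (\<forall>x y. f x y \<longleftrightarrow> g x y)"

lemma valF_linear_order [tr]:
  assumes A: "valO w A e l"
  shows "valF w (linear_order A) (is_lin e l)"
  unfolding linear_order_def is_lin_def
  by (assumption | rule tr A valO_elt[OF A] valO_lss[OF A] | (rule weaken, assumption))+

lemma valF_is_function [tr]:
  assumes A: "valO w A e l" and B: "valO w B e' l'" and f: "valR w f r"
  shows "valF w (is_function A B f) (is_fun e e' r)"
  unfolding is_function_def is_fun_def f_ex1n_def
  by (assumption | rule tr A B f valO_elt[OF A] valO_elt[OF B] valR_apply[OF f] | (rule weaken, assumption))+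

lemma valF_embedding [tr]:
  assumes A: "valO w A e l" and B: "valO w B e' l'" and f: "valR w f r"
  shows "valF w (embedding A B f) (is_emb e l e' l' r)"
  unfolding embedding_def is_emb_def
  by (assumption | rule tr A B f valO_lss[OF A] valO_lss[OF B] valR_apply[OF f] | (rule weaken, assumption))+

lemma valR_compose [tr]:
  assumes f: "valR w f r" and g: "valR w g r'"
  shows "valR w (compose f g) (cmp r r')"
  unfolding compose_def cmp_def[abs_def]
  by (rule valR_intro, (assumption | rule tr f g valR_apply[OF f] valR_apply[OF g] | (rule weaken, assumption))+)

lemma valF_same [tr]:
  assumes f: "valR w f r" and g: "valR w g r'"
  shows "valF w (same f g) (sm r r')"
  unfolding same_def sm_def
  by (assumption | rule tr f g valR_apply[OF f] valR_apply[OF g] | (rule weaken, assumption))+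

lemma valO_set_ord [tr]: "valS w X A \<Longrightarrow> valO w (set_ord X) (\<lambda>x. pr x x \<in> A) (\<lambda>x y. pr x y \<in> A \<and> \<not> x = y)"
  unfolding set_ord_def
  by (rule valO_intro, (assumption | rule tr  | (rule weaken, assumption))+)

lemma valR_set_map [tr]: "valS w X A \<Longrightarrow> valR w (set_map X) (\<lambda>x y. pr x y \<in> A)"
  unfolding set_map_def
  by (rule valR_intro, (assumption | rule tr  | (rule weaken, assumption))+)

lemma valR_seq_map [tr]: "valT w s x \<Longrightarrow> valR w (seq_map s) (at x)"
  unfolding seq_map_def at_def[abs_def]
  by (rule valR_intro, (assumption | rule tr  | (rule weaken, assumption))+)

lemma valO_omega [tr]: "valO w omega (\<lambda>x. x = x) (\<lambda>x y. x < y)"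
  unfolding omega_def
  by (rule valO_intro, (assumption | rule tr  | (rule weaken, assumption))+)

lemma valO_nat_ord [tr]: "valT w b n \<Longrightarrow> valO w (nat_ord b) (\<lambda>x. x < n) (seg_less n)"
  unfolding nat_ord_def seg_less_def[abs_def]
  by (rule valO_intro, (assumption | rule tr  | (rule weaken, assumption))+)

lemma valF_mor [tr]: "valT w a m \<Longrightarrow> valT w b n \<Longrightarrow> valT w s x \<Longrightarrow> valF w (mor a b s) (emb m n x)"
  unfolding mor_def emb_def
  by (assumption | rule tr  | (rule weaken, assumption))+

section \<open>Meaning of the notions of the theorem in a model\<close>

abbreviation (input) "setE X \<equiv> \<lambda>x. pr x x \<in> X"
abbreviation (input) "setL X \<equiv> \<lambda>x y. pr x y \<in> X \<and> \<not> x = y"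
abbreviation (input) "setR F \<equiv> \<lambda>x y. pr x y \<in> F"

text \<open>This and the next definitions follow the formulas connective by connective, because the
  translation rules are matched structurally. More convenient characterisations are derived
  afterwards.\<close>

definition pb_nat :: "'a::rca0 \<Rightarrow> 'a \<Rightarrow> 'a \<Rightarrow> 'a \<Rightarrow> 'a \<Rightarrow> 'a \<Rightarrow> 'a \<Rightarrow> 'a \<Rightarrow> bool" where
  "pb_nat l a b c p q f g \<longleftrightarrow> emb l a p \<and> emb l b q \<and> emb a c f \<and> emb b c g
    \<and> sm (cmp (at p) (at f)) (cmp (at q) (at g))
    \<and> (\<forall>x h k. emb x a h \<and> emb x b k \<and> sm (cmp (at h) (at f)) (cmp (at k) (at g)) \<longrightarrow>
        (\<exists>u. (emb x l u \<and> sm (cmp (at u) (at p)) (at h) \<and> sm (cmp (at u) (at q)) (at k))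
          \<and> (\<forall>v. emb x l v \<and> sm (cmp (at v) (at p)) (at h) \<and> sm (cmp (at v) (at q)) (at k) \<longrightarrow> v = u)))"

definition pb_lo :: "('a::rca0 \<Rightarrow> bool) \<Rightarrow> 'a brel \<Rightarrow> ('a \<Rightarrow> bool) \<Rightarrow> 'a brel
    \<Rightarrow> ('a \<Rightarrow> bool) \<Rightarrow> 'a brel \<Rightarrow> ('a \<Rightarrow> bool) \<Rightarrow> 'a brel
    \<Rightarrow> 'a brel \<Rightarrow> 'a brel \<Rightarrow> 'a brel \<Rightarrow> 'a brel \<Rightarrow> bool" where
  "pb_lo L lL A lA B lB C lC p q f g \<longleftrightarrow>
    is_emb L lL A lA p \<and> is_emb L lL B lB q \<and> is_emb A lA C lC f \<and> is_emb B lB C lC g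
    \<and> sm (cmp p f) (cmp q g)
    \<and> (\<forall>X\<in>SS. \<forall>H\<in>SS. \<forall>K\<in>SS. is_lin (setE X) (setL X)
        \<and> is_emb (setE X) (setL X) A lA (setR H)
        \<and> is_emb (setE X) (setL X) B lB (setR K)
        \<and> sm (cmp (setR H) f) (cmp (setR K) g) \<longrightarrow>
        (\<exists>U\<in>SS. (is_emb (setE X) (setL X) L lL (setR U)
            \<and> sm (cmp (setR U) p) (setR H)
            \<and> sm (cmp (setR U) q) (setR K))
          \<and> (\<forall>V\<in>SS. is_emb (setE X) (setL X) L lL (setR V)
            \<and> sm (cmp (setR V) p) (setR H)
            \<and> sm (cmp (setR V) q) (setR K) \<longrightarrow>
              sm (setR V) (setR U))))"

definition inD :: "'a::rca0 set \<Rightarrow> 'a \<Rightarrow> 'a \<Rightarrow> bool" where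
  "inD D b x \<longleftrightarrow> pr 0 (pr b x) \<in> D"

definition lessD :: "'a::rca0 set \<Rightarrow> 'a \<Rightarrow> 'a \<Rightarrow> 'a \<Rightarrow> bool" where
  "lessD D b x y \<longleftrightarrow> inD D b x \<and> inD D b y \<and> x < y"

definition Dm :: "'a::rca0 set \<Rightarrow> 'a \<Rightarrow> 'a \<Rightarrow> 'a \<Rightarrow> 'a \<Rightarrow> bool" where
  "Dm D n s x y \<longleftrightarrow> pr 1 (pr (pr s n) (pr x y)) \<in> D"

definition functor_in :: "'a::rca0 set \<Rightarrow> bool" where
  "functor_in D \<longleftrightarrow> (\<forall>b. is_lin (inD D b) (lessD D b))
    \<and> (\<forall>m n s. emb m n s \<longrightarrow> is_emb (inD D m) (lessD D m) (inD D n) (lessD D n) (Dm D n s))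
    \<and> (\<forall>m s. emb m m s \<and> (\<forall>i. i < m \<longrightarrow> at s i i) \<longrightarrow> (\<forall>x. inD D m x \<longrightarrow> Dm D m s x x))
    \<and> (\<forall>k m n s t u. emb k m s \<and> emb m n t \<and> emb k n u \<and> sm (at u) (cmp (at s) (at t)) \<longrightarrow>
        sm (Dm D n u) (cmp (Dm D m s) (Dm D n t)))"

definition pullbacks_in :: "'a::rca0 set \<Rightarrow> bool" where
  "pullbacks_in D \<longleftrightarrow> (\<forall>l a b c p q f g. pb_nat l a b c p q f g \<longrightarrow>
    pb_lo (inD D l) (lessD D l) (inD D a) (lessD D a) (inD D b) (lessD D b) (inD D c) (lessD D c)
      (Dm D a p) (Dm D b q) (Dm D c f) (Dm D c g))"

definition dilator_in :: "'a::rca0 set \<Rightarrow> bool" where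
  "dilator_in D \<longleftrightarrow> functor_in D \<and> (\<forall>b x y. inD D b x \<and> y < x \<longrightarrow> inD D b y)
    \<and> pullbacks_in D \<and> inD D 0 0 \<and> (\<forall>b s. emb 0 b s \<longrightarrow> Dm D b s 0 0)"

definition supp_in :: "'a::rca0 set \<Rightarrow> 'a set \<Rightarrow> 'a \<Rightarrow> 'a \<Rightarrow> 'a \<Rightarrow> bool" where
  "supp_in D Z n x a \<longleftrightarrow> inD D n x \<and> fin a \<and> pr n (pr x a) \<in> Z"

definition supports_in :: "'a::rca0 set \<Rightarrow> 'a set \<Rightarrow> bool" where
  "supports_in D Z \<longleftrightarrow>
    (\<forall>n x. inD D n x \<longrightarrow> (\<exists>a. supp_in D Z n x a \<and> (\<forall>b. supp_in D Z n x b \<longrightarrow> b = a)))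
    \<and> (\<forall>n x a i. supp_in D Z n x a \<and> elem i a \<longrightarrow> i < n)
    \<and> (\<forall>m n s x y a b. emb m n s \<and> Dm D n s x y \<and> supp_in D Z m x a \<and> supp_in D Z n y b \<longrightarrow>
        (\<forall>j. elem j b \<longleftrightarrow> (\<exists>i. elem i a \<and> at s i j)))
    \<and> (\<forall>m n s y b. emb m n s \<and> supp_in D Z n y b \<and> (\<forall>j. elem j b \<longrightarrow> (\<exists>i. at s i j)) \<longrightarrow>
        (\<exists>x. Dm D n s x y))"

definition enum_in :: "'a::rca0 \<Rightarrow> 'a \<Rightarrow> 'a \<Rightarrow> bool" where
  "enum_in a l e \<longleftrightarrow> fin a \<and> fseq e \<and> is_emb (\<lambda>x. x < l) (seg_less l) (\<lambda>x. x = x) (\<lambda>x y. x < y) (at e)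
    \<and> (\<forall>x. elem x a \<longleftrightarrow> (\<exists>i. at e i x))"

definition incl_in :: "'a::rca0 \<Rightarrow> 'a \<Rightarrow> 'a \<Rightarrow> 'a \<Rightarrow> 'a \<Rightarrow> bool" where
  "incl_in a c l n s \<longleftrightarrow> emb l n s
    \<and> (\<exists>e e'. enum_in a l e \<and> enum_in c n e' \<and> sm (cmp (at s) (at e')) (at e))"

definition ext_elt_in :: "'a::rca0 set \<Rightarrow> 'a set \<Rightarrow> 'a \<Rightarrow> bool" where
  "ext_elt_in D Z x \<longleftrightarrow> (\<exists>a y l e b. x = pr a y \<and> enum_in a l e \<and> supp_in D Z l y b
    \<and> (\<forall>i. elem i b \<longleftrightarrow> i < l))"

definition ext_less_in :: "'a::rca0 set \<Rightarrow> 'a set \<Rightarrow> 'a \<Rightarrow> 'a \<Rightarrow> bool" where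
  "ext_less_in D Z x y \<longleftrightarrow> ext_elt_in D Z x \<and> ext_elt_in D Z y
    \<and> (\<exists>a x' b y' c k l n s t x'' y''. x = pr a x' \<and> y = pr b y'
        \<and> fin c \<and> (\<forall>z. elem z c \<longleftrightarrow> elem z a \<or> elem z b)
        \<and> incl_in a c k n s \<and> Dm D n s x' x'' \<and> incl_in b c l n t \<and> Dm D n t y' y'' \<and> x'' < y'')"

definition wf_in :: "('a::rca0 \<Rightarrow> bool) \<Rightarrow> 'a brel \<Rightarrow> bool" where
  "wf_in A L \<longleftrightarrow> \<not> (\<exists>F\<in>SS. is_fun (\<lambda>x. x = x) A (setR F)
    \<and> (\<forall>i x y. pr i x \<in> F \<and> pr (i + 1) y \<in> F \<longrightarrow> L y x))"

definition goodstein_in :: "'a::rca0 set \<Rightarrow> 'a set \<Rightarrow> 'a \<Rightarrow> 'a set \<Rightarrow> bool" where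
  "goodstein_in D B m G \<longleftrightarrow> is_fun (\<lambda>x. x = x) (\<lambda>x. x = x) (setR G) \<and> pr 0 m \<in> G
    \<and> (\<forall>i x y. pr i x \<in> G \<and> pr (i + 1) y \<in> G \<longrightarrow> (x = 0 \<and> y = 0)
      \<or> (\<not> x = 0 \<and> (\<exists>p q c z. pr i p \<in> B \<and> pr (i + 1) q \<in> B
          \<and> emb p q c \<and> (\<forall>n. n < p \<longrightarrow> at c n n) \<and> Dm D q c x z
          \<and> (z = y + 1 \<or> (z = 0 \<and> y = 0)))))"

definition all_terminate_in :: "'a::rca0 set \<Rightarrow> bool" where
  "all_terminate_in D \<longleftrightarrow> (\<forall>B\<in>SS. \<forall>m. is_fun (\<lambda>x. x = x) (\<lambda>x. x = x) (setR B)
    \<and> (\<forall>i j x y. i < j \<and> pr i x \<in> B \<and> pr j y \<in> B \<longrightarrow> x < y \<or> x = y)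
    \<and> (\<exists>x. pr 0 x \<in> B \<and> 0 < x \<and> inD D x m) \<longrightarrow>
    (\<exists>G\<in>SS. goodstein_in D B m G \<and> (\<exists>i. pr i 0 \<in> G)))"

definition ext_wf_in :: "'a::rca0 set \<Rightarrow> bool" where
  "ext_wf_in D \<longleftrightarrow> (\<exists>Z\<in>SS. supports_in D Z \<and> wf_in (ext_elt_in D Z) (ext_less_in D Z))"

section \<open>Translation of the notions of the theorem\<close>

lemma valF_pullback_Nat [tr]: 
  "\<lbrakk>valT w l' l; valT w a' a; valT w b' b; valT w c' c; valT w p' p; valT w q' q;
    valT w f' f; valT w g' g\<rbrakk>
    \<Longrightarrow> valF w (pullback_Nat l' a' b' c' p' q' f' g') (pb_nat l a b c p q f g)"
  unfolding pullback_Nat_def pb_nat_def f_ex1n_def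
  by (assumption | rule tr | (rule weaken, assumption))+

lemma valF_pullback_LO [tr]:
  assumes L: "valO w L' L lL" and A: "valO w A' A lA" and B: "valO w B' B lB" and C: "valO w C' C lC" and p: "valR w p' p" and q: "valR w q' q" and f: "valR w f' f" and g: "valR w g' g"
  shows "valF w (pullback_LO L' A' B' C' p' q' f' g') (pb_lo L lL A lA B lB C lC p q f g)"
  unfolding pullback_LO_def pb_lo_def Let_def
  by (assumption | rule tr A B C L f g p q valO_elt[OF L] valO_lss[OF L] valO_elt[OF A] valO_lss[OF A] valO_elt[OF B] valO_lss[OF B] valO_elt[OF C] valO_lss[OF C] valR_apply[OF p] valR_apply[OF q] valR_apply[OF f] valR_apply[OF g] | (rule weaken, assumption))+

lemma valF_in_D [tr]: 
  "\<lbrakk>valS w D' D; valT w b' b; valT w x' x\<rbrakk>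
    \<Longrightarrow> valF w (in_D D' b' x') (inD D b x)"
  unfolding in_D_def inD_def
  by (assumption | rule tr | (rule weaken, assumption))+

lemma valO_D_ord [tr]: "valS w D' D \<Longrightarrow> valT w b' b \<Longrightarrow> valO w (D_ord D' b') (inD D b) (lessD D b)"
  unfolding D_ord_def lessD_def[abs_def]
  by (rule valO_intro, (assumption | rule tr | (rule weaken, assumption))+)

lemma valR_D_map [tr]: 
  "\<lbrakk>valS w D' D; valT w n' n; valT w s' s\<rbrakk>
    \<Longrightarrow> valR w (D_map D' n' s') (Dm D n s)"
  unfolding D_map_def Dm_def[abs_def]
  by (rule valR_intro, (assumption | rule tr | (rule weaken, assumption))+)

lemma valF_D_map [tr]: 
  "\<lbrakk>valS w D' D; valT w n' n; valT w s' s; valT w x' x; valT w y' y\<rbrakk>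
    \<Longrightarrow> valF w (D_map D' n' s' x' y') (Dm D n s x y)"
  unfolding D_map_def Dm_def
  by (assumption | rule tr | (rule weaken, assumption))+

lemma valF_seq_map [tr]: 
  "\<lbrakk>valT w s' s; valT w x' x; valT w y' y\<rbrakk>
    \<Longrightarrow> valF w (seq_map s' x' y') (at s x y)"
  unfolding seq_map_def at_def
  by (assumption | rule tr | (rule weaken, assumption))+

lemma valF_set_map [tr]: 
  "\<lbrakk>valS w X A; valT w x' x; valT w y' y\<rbrakk>
    \<Longrightarrow> valF w (set_map X x' y') (pr x y \<in> A)"
  unfolding set_map_def
  by (assumption | rule tr | (rule weaken, assumption))+

lemma valF_functor [tr]: "valS w D' D \<Longrightarrow> valF w (functor_Nat_LO D') (functor_in D)"
  unfolding functor_Nat_LO_def functor_in_def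
  by (assumption | rule tr | (rule weaken, assumption))+

lemma valF_preserves_pullbacks [tr]: "valS w D' D \<Longrightarrow> valF w (preserves_pullbacks D') (pullbacks_in D)"
  unfolding preserves_pullbacks_def pullbacks_in_def
  by (assumption | rule tr | (rule weaken, assumption))+

lemma valF_goodstein_dilator [tr]: "valS w D' D \<Longrightarrow> valF w (goodstein_dilator D') (dilator_in D)"
  unfolding goodstein_dilator_def dilator_in_def
  by (assumption | rule tr | (rule weaken, assumption))+

lemma valF_supp [tr]: 
  "\<lbrakk>valS w D' D; valS w Z' Z; valT w n' n; valT w x' x; valT w a' a\<rbrakk>
    \<Longrightarrow> valF w (supp D' Z' n' x' a') (supp_in D Z n x a)"
  unfolding supp_def supp_in_def
  by (assumption | rule tr | (rule weaken, assumption))+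

lemma valF_supports [tr]: "valS w D' D \<Longrightarrow> valS w Z' Z \<Longrightarrow> valF w (support_transformation D' Z') (supports_in D Z)"
  unfolding support_transformation_def supports_in_def f_ex1n_def
  by (assumption | rule tr | (rule weaken, assumption))+

lemma valF_enum [tr]: 
  "\<lbrakk>valT w a' a; valT w l' l; valT w e' e\<rbrakk>
    \<Longrightarrow> valF w (enum omega a' l' e') (enum_in a l e)"
  unfolding enum_def enum_in_def
  by (assumption | rule tr | (rule weaken, assumption))+

lemma valF_incl [tr]: 
  "\<lbrakk>valT w a' a; valT w c' c; valT w l' l; valT w n' n; valT w s' s\<rbrakk>
    \<Longrightarrow> valF w (incl omega a' c' l' n' s') (incl_in a c l n s)"
  unfolding incl_def incl_in_def
  by (assumption | rule tr | (rule weaken, assumption))+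

lemma valF_ext_elt [tr]: 
  "\<lbrakk>valS w D' D; valS w Z' Z; valT w x' x\<rbrakk>
    \<Longrightarrow> valF w (ext_elt D' Z' omega x') (ext_elt_in D Z x)"
  unfolding ext_elt_def ext_elt_in_def
  by (assumption | rule tr | (rule weaken, assumption))+

lemma valF_ext_less [tr]: 
  "\<lbrakk>valS w D' D; valS w Z' Z; valT w x' x; valT w y' y\<rbrakk>
    \<Longrightarrow> valF w (ext_less D' Z' omega x' y') (ext_less_in D Z x y)"
  unfolding ext_less_def ext_less_in_def
  by (assumption | rule tr | (rule weaken, assumption))+

lemma valO_extension [tr]: "valS w D' D \<Longrightarrow> valS w Z' Z \<Longrightarrow> valO w (extension D' Z' omega) (ext_elt_in D Z) (ext_less_in D Z)"
  unfolding extension_def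
  by (rule valO_intro, (assumption | rule tr | (rule weaken, assumption))+)

lemma valF_well_founded [tr]:
  assumes A: "valO w A e l"
  shows "valF w (well_founded A) (wf_in e l)"
  unfolding well_founded_def wf_in_def
  by (assumption | rule tr A valO_elt[OF A] valO_lss[OF A] | (rule weaken, assumption))+

lemma valF_goodstein_seq [tr]: 
  "\<lbrakk>valS w D' D; valS w B' B; valT w m' m; valS w G' G\<rbrakk>
    \<Longrightarrow> valF w (goodstein_seq D' B' m' G') (goodstein_in D B m G)"
  unfolding goodstein_seq_def goodstein_in_def
  by (assumption | rule tr | (rule weaken, assumption))+

lemma valF_extended_goodstein [tr]: "valS w D' D \<Longrightarrow> valF w (extended_goodstein D') (all_terminate_in D)"
  unfolding extended_goodstein_def all_terminate_in_def
  by (assumption | rule tr | (rule weaken, assumption))+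

lemma valF_extension_omega_wf [tr]: "valS w D' D \<Longrightarrow> valF w (extension_omega_wf D') (ext_wf_in D)"
  unfolding extension_omega_wf_def ext_wf_in_def
  by (assumption | rule tr | (rule weaken, assumption))+

lemma sat_goal:
  assumes "\<And>D :: model set. D \<in> SS \<Longrightarrow> dilator_in D \<Longrightarrow> all_terminate_in D \<longleftrightarrow> ext_wf_in D"
  shows "RCA0 \<turnstile> goal"
proof (rule goal_if_sat)
  fix e :: "nat \<Rightarrow> model" and E :: "nat \<Rightarrow> model set"
  let ?w = "World undefined 0 undefined 0 e E"
  have "valF ?w (\<^bold>\<forall>\<^sub>S D. goodstein_dilator D \<^bold>\<longrightarrow> (extended_goodstein D \<^bold>\<longleftrightarrow> extension_omega_wf D))
    (\<forall>D\<in>(SS :: model set set). dilator_in D \<longrightarrow> (all_terminate_in D \<longleftrightarrow> ext_wf_in D))"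
    by (rule tr | assumption)+
  moreover have "num_env ?w = e" "set_env ?w = E" by (simp_all add: fun_eq_iff num_env_def set_env_def)
  ultimately show "sat e E goal"
    unfolding valF_def goal_def sentence_def using assms by (auto dest: spec[of _ ?w])
qed

section \<open>Dilators in a model\<close>

lemma cmp_at: "emb k m s \<Longrightarrow> emb m n t \<Longrightarrow> cmp (at s) (at t) i z \<longleftrightarrow> i < k \<and> z = ap t (ap s i)"
  by (auto simp: cmp_def emb_at emb_less)

lemma sm_at:
  "emb k m s \<Longrightarrow> emb m n t \<Longrightarrow> emb k n u \<Longrightarrow> (\<And>i. i < k \<Longrightarrow> ap u i = ap t (ap s i))
    \<Longrightarrow> sm (cmp (at s) (at t)) (at u)"
  by (auto simp: sm_def cmp_at emb_at)

lemma sm_cmp_at: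
  assumes "emb x a h" "emb a c f" "emb x b k" "emb b c g"
  shows "sm (cmp (at h) (at f)) (cmp (at k) (at g)) \<longleftrightarrow> (\<forall>i<x. ap f (ap h i) = ap g (ap k i))"
  unfolding sm_def cmp_at[OF assms(1,2)] cmp_at[OF assms(3,4)] by auto

lemma singleton_SS: "{c :: 'a::rca0} \<in> SS"
  unfolding SS_iff_rec by simp (intro computable)

lemma ex_function:
  assumes "A \<in> SS" "is_fun (\<lambda>x. x = x) E (setR A)"
  shows "\<exists>f. cf f \<and> (\<forall>x y. pr x y \<in> A \<longleftrightarrow> y = f x) \<and> (\<forall>x. E (f x))"
proof -
  have "\<exists>y. pr x y \<in> A \<and> (\<forall>z. pr x z \<in> A \<longrightarrow> z = y)" for x
    using assms(2) by (simp add: is_fun_def)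
  then obtain f where f: "\<And>x. pr x (f x) \<in> A \<and> (\<forall>z. pr x z \<in> A \<longrightarrow> z = f x)" by metis
  then have "pr x y \<in> A \<longleftrightarrow> y = f x" for x y by blast
  moreover from this have "cf f"
    by (intro cf_by_rec[of "\<lambda>x y. pr x y \<in> A" f]) (intro computable assms(1), simp)
  ultimately show ?thesis using assms(2) unfolding is_fun_def by blast
qed

text \<open>Elements of a finite set are smaller than its code, so an enumeration into omega is also
  a morphism of Nat with the code as codomain.\<close>

lemma enum_in_iff: "enum_in a l e \<longleftrightarrow> fin a \<and> emb l a e \<and> (\<forall>x. elem x a \<longleftrightarrow> rng e x)"
proof
  assume e: "enum_in a l e"
  then have s: "fseq e" and r: "\<And>x. elem x a \<longleftrightarrow> rng e x" by (auto simp: enum_in_def rng_def)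
  have at: "at e i y \<longleftrightarrow> i < l \<and> y = ap e i" for i y
    using e ap_eqI[OF s] unfolding enum_in_def is_emb_def is_fun_def by metis
  have "ap e i < a" if "i < l" for i
    using at[of i "ap e i"] r[of "ap e i"] that elem_less unfolding rng_def by blast
  moreover have "ap e i < ap e j" if "i < j" "j < l" for i j
  proof -
    have "at e i (ap e i)" "at e j (ap e j)" using at that less_trans by blast+
    then show ?thesis using e that unfolding enum_in_def is_emb_def seg_less_def by blast
  qed
  ultimately have "emb l a e" unfolding emb_iff using s at by blast
  then show "fin a \<and> emb l a e \<and> (\<forall>x. elem x a \<longleftrightarrow> rng e x)" using e r by (simp add: enum_in_def)
next
  assume "fin a \<and> emb l a e \<and> (\<forall>x. elem x a \<longleftrightarrow> rng e x)"
  then have e: "fin a" "emb l a e" "\<And>x. elem x a \<longleftrightarrow> rng e x" by blast+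
  have "is_emb (\<lambda>x. x < l) (seg_less l) (\<lambda>x. x = x) (\<lambda>x y. x < y) (at e)"
    unfolding is_emb_def is_fun_def seg_less_def emb_at[OF e(2)] using emb_mono[OF e(2)] by auto
  then show "enum_in a l e" using e emb_fseq[OF e(2)] by (simp add: enum_in_def rng_def)
qed

lemma rec_enum_in [computable]:
  assumes "cf f" "cf g" "cf h" shows "rec (\<lambda>x. enum_in (f x) (g x) (h x))"
proof -
  have "enum_in a l e \<longleftrightarrow> fin a \<and> emb l a e \<and> (\<forall>x<a. elem x a \<longleftrightarrow> rng e x)" for a l e :: 'a
    unfolding enum_in_iff using elem_less rng_less by blast
  then show ?thesis
    by (simp, intro computable cf_comp[OF assms(1)] cf_comp[OF assms(2)] cf_comp[OF assms(3)] assms)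
qed

lemma ex_enum_in: "fin a \<Longrightarrow> \<exists>l e. enum_in a l e"
  using ex_enum[of "\<lambda>x. elem x a" a] rec_elem[OF cf_id cf_const, of a] elem_less
  unfolding enum_in_iff by metis

lemma enum_in_emb: "enum_in a l e \<Longrightarrow> (\<And>x. elem x a \<Longrightarrow> x < n) \<Longrightarrow> emb l n e"
  unfolding enum_in_iff by (metis emb_widen rng_iff)

lemma enum_in_unique: "enum_in a l e \<Longrightarrow> enum_in a l' e' \<Longrightarrow> l = l' \<and> e = e'"
  unfolding enum_in_iff using emb_unique by metis

locale model_dilator =
  fixes D :: "'a::rca0 set"
  assumes D_SS: "D \<in> SS" and dilator: "dilator_in D"
begin

section \<open>The functor laws\<close>

lemma rec_inD: "cf f \<Longrightarrow> cf g \<Longrightarrow> rec (\<lambda>x. inD D (f x) (g x))"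
  unfolding inD_def by (intro computable D_SS)

lemma rec_Dm: "cf f \<Longrightarrow> cf g \<Longrightarrow> cf h \<Longrightarrow> cf k \<Longrightarrow> rec (\<lambda>x. Dm D (f x) (g x) (h x) (k x))"
  unfolding Dm_def by (intro computable D_SS)

lemma D_emb: "emb m n s \<Longrightarrow> is_emb (inD D m) (lessD D m) (inD D n) (lessD D n) (Dm D n s)"
  using dilator unfolding dilator_in_def functor_in_def by blast

lemma D_total: "emb m n s \<Longrightarrow> inD D m x \<Longrightarrow> \<exists>y. Dm D n s x y"
  using D_emb unfolding is_emb_def is_fun_def by blast

lemma D_dom: "emb m n s \<Longrightarrow> Dm D n s x y \<Longrightarrow> inD D m x"
  and D_cod: "emb m n s \<Longrightarrow> Dm D n s x y \<Longrightarrow> inD D n y"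
  using D_emb unfolding is_emb_def is_fun_def by blast+

lemma D_fun: "emb m n s \<Longrightarrow> Dm D n s x y \<Longrightarrow> Dm D n s x y' \<Longrightarrow> y = y'"
  using D_emb[of m n s] unfolding is_emb_def is_fun_def by metis

lemma D_mono: "emb m n s \<Longrightarrow> Dm D n s x y \<Longrightarrow> Dm D n s x' y' \<Longrightarrow> x < x' \<Longrightarrow> y < y'"
  using D_emb[of m n s] D_dom[of m n s] unfolding is_emb_def lessD_def by blast

lemma D_less_iff: "emb m n s \<Longrightarrow> Dm D n s x y \<Longrightarrow> Dm D n s x' y' \<Longrightarrow> x < x' \<longleftrightarrow> y < y'"
  using D_mono[of m n s x y x' y'] D_mono[of m n s x' y' x y] D_fun[of m n s x y y']
  by (cases x x' rule: linorder_cases) auto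

lemma D_inj: "emb m n s \<Longrightarrow> Dm D n s x y \<Longrightarrow> Dm D n s x' y \<Longrightarrow> x = x'"
  using D_mono[of m n s x y x' y] D_mono[of m n s x' y x y]
  by (cases x x' rule: linorder_cases) auto

lemma D_initial: "inD D b x \<Longrightarrow> y \<le> x \<Longrightarrow> inD D b y"
  using dilator unfolding dilator_in_def by (metis order_le_imp_less_or_eq)

lemma D_zero: "emb 0 b s \<Longrightarrow> Dm D b s 0 0"
  using dilator unfolding dilator_in_def by blast

lemma D_id: "inD D m x \<Longrightarrow> Dm D m (idm m) x x"
proof -
  have "\<forall>i<m. at (idm m) i i" by (simp add: sq(2)[OF cf_id])
  then show "inD D m x \<Longrightarrow> Dm D m (idm m) x x"
    using dilator emb_id[of m m] unfolding dilator_in_def functor_in_def by blast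
qed

lemma D_comp:
  assumes "emb k m s" "emb m n t" "emb k n u" "\<And>i. i < k \<Longrightarrow> ap u i = ap t (ap s i)"
  shows "Dm D n u x z \<longleftrightarrow> (\<exists>y. Dm D m s x y \<and> Dm D n t y z)"
proof -
  have "sm (at u) (cmp (at s) (at t))" using sm_at[OF assms] by (auto simp: sm_def)
  then have "sm (Dm D n u) (cmp (Dm D m s) (Dm D n t))"
    using assms(1-3) dilator unfolding dilator_in_def functor_in_def by blast
  then show ?thesis by (simp add: sm_def cmp_def)
qed

text \<open>A least argument at which an embedding of initial segments decreases would be mapped to a smaller one.\<close>

lemma D_ge: assumes s: "emb m n s" and "Dm D n s x y" shows "x \<le> y"
proof (rule ccontr)
  assume "\<not> x \<le> y"
  then have "y < x" by simp
  then have "\<exists>y<x. Dm D n s x y" using assms(2) by blast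
  moreover have "rec (\<lambda>x. \<exists>y<x. Dm D n s x y)" by (intro computable rec_Dm)
  ultimately obtain x where x: "\<exists>y<x. Dm D n s x y" "\<forall>x'<x. \<not> (\<exists>y<x'. Dm D n s x' y)"
    using ex_least[of "\<lambda>x. \<exists>y<x. Dm D n s x y"] by blast
  then obtain y where y: "y < x" "Dm D n s x y" by blast
  then have "inD D m y" using D_initial[OF D_dom[OF s y(2)]] by simp
  then obtain z where z: "Dm D n s y z" using D_total[OF s] by blast
  then have "z < y" using D_mono[OF s z y(2) y(1)] by simp
  then show False using x(2) y(1) z by blast
qed

definition in_ran :: "'a \<Rightarrow> 'a \<Rightarrow> 'a \<Rightarrow> bool" where
  "in_ran n s y \<longleftrightarrow> (\<exists>x. Dm D n s x y)"

lemma ran_mono: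
  assumes "emb m n s" "emb k n t" "\<And>y. rng t y \<Longrightarrow> rng s y" "in_ran n t x"
  shows "in_ran n s x"
proof -
  obtain w where w: "emb k m w" "\<And>i. i < k \<Longrightarrow> ap s (ap w i) = ap t i"
    using emb_factor[OF assms(1-3)] by blast
  then show ?thesis using D_comp[OF w(1) assms(1,2)] assms(4) unfolding in_ran_def by metis
qed

text \<open>The common composite of a cone has its range inside both ranges, hence factors through
  \<open>r\<close>. Injectivity of \<open>f\<close> and \<open>g\<close> identifies the components
  of the factorisation, that of \<open>p\<close> its uniqueness.\<close>

lemma pullback_inter:
  assumes f: "emb a c f" and g: "emb b c g" and r: "emb l c r"
    and rng: "\<And>y. rng r y \<longleftrightarrow> rng f y \<and> rng g y"
    and p: "emb l a p" "\<And>i. i < l \<Longrightarrow> ap f (ap p i) = ap r i"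
    and q: "emb l b q" "\<And>i. i < l \<Longrightarrow> ap g (ap q i) = ap r i"
  shows "pb_nat l a b c p q f g"
  unfolding pb_nat_def
proof (intro conjI allI impI p q f g)
  show "sm (cmp (at p) (at f)) (cmp (at q) (at g))"
    using p q by (simp add: sm_cmp_at[OF p(1) f q(1) g])
  fix x h k
  assume "emb x a h \<and> emb x b k \<and> sm (cmp (at h) (at f)) (cmp (at k) (at g))"
  then have h: "emb x a h" and k: "emb x b k"
    and hk: "\<And>i. i < x \<Longrightarrow> ap f (ap h i) = ap g (ap k i)"
    using sm_cmp_at[OF _ f _ g, of x h k] by auto
  let ?t = "sq x (\<lambda>i. ap f (ap h i))"
  have t: "emb x c ?t" by (rule emb_comp[OF h f])
  have "rng r y" if y: "rng ?t y" for y
  proof -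
    obtain i where i: "i < x" "y = ap f (ap h i)" using y ap_sq_comp unfolding rng_iff[OF t] by metis
    then show ?thesis
      using hk emb_less[OF h] emb_less[OF k] unfolding rng rng_iff[OF f] rng_iff[OF g] by metis
  qed
  then obtain u where u: "emb x l u" "\<And>i. i < x \<Longrightarrow> ap r (ap u i) = ap f (ap h i)"
    using emb_factor[OF r t] ap_sq_comp by metis
  have up: "ap p (ap u i) = ap h i" and uq: "ap q (ap u i) = ap k i" if i: "i < x" for i
  proof -
    have ui: "ap u i < l" using emb_less[OF u(1) i] .
    have "ap f (ap p (ap u i)) = ap f (ap h i)" using p(2)[OF ui] u(2)[OF i] by simp
    then show "ap p (ap u i) = ap h i"
      using emb_inject[OF f] emb_less[OF p(1) ui] emb_less[OF h i] by blast
    have "ap g (ap q (ap u i)) = ap g (ap k i)" using q(2)[OF ui] u(2)[OF i] hk[OF i] by simp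
    then show "ap q (ap u i) = ap k i"
      using emb_inject[OF g] emb_less[OF q(1) ui] emb_less[OF k i] by blast
  qed
  show "\<exists>u. (emb x l u \<and> sm (cmp (at u) (at p)) (at h) \<and> sm (cmp (at u) (at q)) (at k))
      \<and> (\<forall>v. emb x l v \<and> sm (cmp (at v) (at p)) (at h) \<and> sm (cmp (at v) (at q)) (at k) \<longrightarrow> v = u)"
  proof (intro exI conjI allI impI)
    show "emb x l u" by (rule u(1))
    show "sm (cmp (at u) (at p)) (at h)" using up by (intro sm_at[OF u(1) p(1) h]) simp
    show "sm (cmp (at u) (at q)) (at k)" using uq by (intro sm_at[OF u(1) q(1) k]) simp
    fix v assume v: "emb x l v \<and> sm (cmp (at v) (at p)) (at h) \<and> sm (cmp (at v) (at q)) (at k)"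
    show "v = u"
    proof (rule emb_ext)
      show "emb x l v" "emb x l u" using v u(1) by simp_all
      fix i assume i: "i < x"
      have "cmp (at v) (at p) i (ap h i)"
        using v i unfolding sm_def emb_at[OF h] by blast
      then have "ap p (ap v i) = ap p (ap u i)"
        using cmp_at[of x l v a p] v p(1) up[OF i] by auto
      then show "ap v i = ap u i"
        using emb_inject[OF p(1)] emb_less[OF u(1) i] emb_less[of x l v, OF _ i] v by blast
    qed
  qed
qed

text \<open>
  The universal property of the pullback in the category of linear orders is applied to a
  one-point order, whose embeddings into an order are the elements of that order.
\<close>

lemma ran_inter:
  assumes f: "emb a c f" and g: "emb b c g" and r: "emb l c r"
    and rng: "\<And>y. rng r y \<longleftrightarrow> rng f y \<and> rng g y"
    and "in_ran c f x" "in_ran c g x"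
  shows "in_ran c r x"
proof -
  obtain p where p: "emb l a p" "\<And>i. i < l \<Longrightarrow> ap f (ap p i) = ap r i"
    using emb_factor[OF f r] rng by blast
  obtain q where q: "emb l b q" "\<And>i. i < l \<Longrightarrow> ap g (ap q i) = ap r i"
    using emb_factor[OF g r] rng by blast
  obtain y z where y: "Dm D c f y x" and z: "Dm D c g z x" using assms(5,6) unfolding in_ran_def by blast
  have "pb_lo (inD D l) (lessD D l) (inD D a) (lessD D a) (inD D b) (lessD D b) (inD D c) (lessD D c)
      (Dm D a p) (Dm D b q) (Dm D c f) (Dm D c g)"
    using pullback_inter[OF f g r rng p q] dilator unfolding dilator_in_def pullbacks_in_def by blast
  note pb = this[unfolded pb_lo_def, THEN conjunct2, THEN conjunct2, THEN conjunct2, THEN conjunct2, THEN conjunct2]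
  \<comment> \<open>\<open>{pr 0 0}\<close> codes the order with sole element 0, and
    \<open>{pr 0 y}\<close> and \<open>{pr 0 z}\<close> code the maps that pick out \<open>y\<close>
    and \<open>z\<close>.\<close>
  have "is_lin (setE {pr 0 (0::'a)}) (setL {pr 0 0})"
    by (auto simp: is_lin_def)
  moreover have "is_emb (setE {pr 0 0}) (setL {pr 0 0})
      (inD D a) (lessD D a) (setR {pr 0 y})"
    using D_dom[OF f y] by (auto simp: is_emb_def is_fun_def)
  moreover have "is_emb (setE {pr 0 0}) (setL {pr 0 0})
      (inD D b) (lessD D b) (setR {pr 0 z})"
    using D_dom[OF g z] by (auto simp: is_emb_def is_fun_def)
  moreover have "sm (cmp (setR {pr 0 y}) (Dm D c f)) (cmp (setR {pr 0 z}) (Dm D c g))"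
  proof -
    have "Dm D c f y w \<longleftrightarrow> w = x" "Dm D c g z w \<longleftrightarrow> w = x" for w
      using y z D_fun[OF f y] D_fun[OF g z] by blast+
    then show ?thesis by (simp add: sm_def cmp_def)
  qed
  ultimately obtain U where
    U: "is_emb (setE {pr 0 0}) (setL {pr 0 0}) (inD D l) (lessD D l) (setR U)"
    and Up: "sm (cmp (setR U) (Dm D a p)) (setR {pr 0 y})"
    using pb[rule_format, OF singleton_SS[of "pr 0 0"] singleton_SS[of "pr 0 y"] singleton_SS[of "pr 0 z"]]
    by blast
  obtain v where "pr 0 v \<in> U"
    using U unfolding is_emb_def is_fun_def by auto
  \<comment> \<open>The mediating map picks \<open>w\<close> with D(p)(w) = y, whence D(r)(w) =
    D(f)(y) = x.\<close>
  moreover obtain w where w: "pr 0 w \<in> U" "Dm D a p w y"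
    using Up unfolding sm_def cmp_def by auto
  ultimately show ?thesis
    using D_comp[OF p(1) f r, of w x] p(2) y unfolding in_ran_def by metis
qed

subsection \<open>Supports\<close>

text \<open>By \<open>D_ge\<close> a preimage of \<open>x\<close> is at most \<open>x\<close>; the
  bounded search makes the support recursive.\<close>

definition in_sp :: "'a \<Rightarrow> 'a \<Rightarrow> 'a \<Rightarrow> bool" where
  "in_sp n x y \<longleftrightarrow> y < n \<and> \<not> (\<exists>z<x + 1. Dm D n (skip n y) z x)"

lemma rec_sp:
  assumes "cf f" "cf g" "cf h" shows "rec (\<lambda>x. in_sp (f x) (g x) (h x))"
  unfolding in_sp_def
  by (intro computable rec_Dm assms cf_comp[OF assms(1)] cf_comp[OF assms(2)] cf_comp[OF assms(3)])

lemma sp_iff: "in_sp n x y \<longleftrightarrow> y < n \<and> \<not> in_ran n (skip n y) x"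
  unfolding in_sp_def in_ran_def less_add_one_le using D_ge skip(1) by blast

text \<open>Starting from the identity, the points below \<open>j\<close> outside the range of
  \<open>s\<close> are removed one by one. Each is outside the support, so \<open>ran_inter\<close>
  applies to the map that skips it.\<close>

lemma ran_if_supp:
  assumes s: "emb m n s" and x: "inD D n x" and in_sp: "\<And>y. in_sp n x y \<Longrightarrow> rng s y"
  shows "in_ran n s x"
proof -
  have "\<exists>l u z. emb l n u \<and> (\<forall>y<n. rng u y \<longleftrightarrow> rng s y \<or> j \<le> y) \<and> Dm D n u z x" for j
  proof (rule re_induct[of _ j])
    show "re (\<lambda>j. \<exists>l u z. emb l n u \<and> (\<forall>y<n. rng u y \<longleftrightarrow> rng s y \<or> j \<le> y) \<and> Dm D n u z x)"
      by (intro enumerable re_rec computable rec_Dm)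
    have "rng (idm n) y" if "y < n" for y
      using that unfolding rng_def by (simp add: sq(2)[OF cf_id])
    then show "\<exists>l u z. emb l n u \<and> (\<forall>y<n. rng u y \<longleftrightarrow> rng s y \<or> 0 \<le> y) \<and> Dm D n u z x"
      using D_id[OF x] emb_id[of n n] by auto
    fix j assume "\<exists>l u z. emb l n u \<and> (\<forall>y<n. rng u y \<longleftrightarrow> rng s y \<or> j \<le> y) \<and> Dm D n u z x"
    then obtain l u z where u: "emb l n u" "\<And>y. y < n \<Longrightarrow> rng u y \<longleftrightarrow> rng s y \<or> j \<le> y" "Dm D n u z x"
      by blast
    show "\<exists>l u z. emb l n u \<and> (\<forall>y<n. rng u y \<longleftrightarrow> rng s y \<or> j + 1 \<le> y) \<and> Dm D n u z x"
    proof (cases "j < n \<and> \<not> rng s j")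
      case True
      then have j: "in_ran n (skip n j) x" using in_sp sp_iff by blast
      have "rec (\<lambda>y. y < n \<and> (rng s y \<or> j + 1 \<le> y))" by (intro computable)
      then obtain l' v where v: "emb l' n v" "\<And>y. rng v y \<longleftrightarrow> y < n \<and> (rng s y \<or> j + 1 \<le> y)"
        using ex_enum[of "\<lambda>y. y < n \<and> (rng s y \<or> j + 1 \<le> y)" n] by blast
      have "rng v y \<longleftrightarrow> rng u y \<and> rng (skip n j) y" for y
        using v(2)[of y] u(2)[of y] skip(2)[of j n y] rng_less[OF u(1), of y] True
        by (auto simp: add_one_le_iff)
      then have "in_ran n v x"
        using ran_inter[OF u(1) skip(1) v(1)] True j u(3) unfolding in_ran_def by blast
      then show ?thesis using v unfolding in_ran_def by blast
    next
      case False
      then have "rng s y \<or> j + 1 \<le> y \<longleftrightarrow> rng s y \<or> j \<le> y" if "y < n" for y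
        unfolding add_one_le_iff using that False by (auto simp: order_le_less)
      then show ?thesis using u by blast
    qed
  qed
  \<comment> \<open>At \<open>j = n\<close> nothing but the range of \<open>s\<close> is
    left.\<close>
  then obtain l u z where u: "emb l n u" "\<forall>y<n. rng u y \<longleftrightarrow> rng s y \<or> n \<le> y" "Dm D n u z x" by blast
  then have "rng s y" if "rng u y" for y using that rng_less[OF u(1) that] by (auto simp: not_le[symmetric])
  then show ?thesis using ran_mono[OF s u(1)] u(3) unfolding in_ran_def by blast
qed

text \<open>A point outside the range of \<open>s\<close> is not in the support of \<open>y\<close>,
  since \<open>s\<close> factors through the map that skips it. For \<open>j = s(i)\<close>,
  skipping \<open>j\<close> in \<open>n\<close> matches skipping \<open>i\<close> in
  \<open>m\<close>, by \<open>ran_mono\<close> in one direction and by \<open>ran_inter\<close> with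
  injectivity in the other.\<close>

lemma sp_natural:
  assumes s: "emb m n s" and xy: "Dm D n s x y"
  shows "in_sp n y j \<longleftrightarrow> (\<exists>i. in_sp m x i \<and> at s i j)"
proof -
  \<comment> \<open>\<open>?t i\<close> is \<open>s\<close> after the map that skips
    \<open>i\<close>. Its range is the intersection of the range of \<open>s\<close> with that of
    the map that skips \<open>s(i)\<close>.\<close>
  let ?t = "\<lambda>i. sq (m - 1) (\<lambda>k. ap s (ap (skip m i) k))"
  have t: "emb (m - 1) n (?t i)" if "i < m" for i by (rule emb_comp[OF skip(1)[OF that] s])
  have rt: "rng (?t i) k \<longleftrightarrow> rng s k \<and> k \<noteq> ap s i" if i: "i < m" for i k
  proof -
    have "rng (?t i) k \<longleftrightarrow> (\<exists>h. rng (skip m i) h \<and> k = ap s h)"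
      unfolding rng_iff[OF t[OF i]] rng_iff[OF skip(1)[OF i]] using ap_sq_comp by metis
    also have "\<dots> \<longleftrightarrow> rng s k \<and> k \<noteq> ap s i"
      unfolding skip(2)[OF i] rng_iff[OF s] by (auto simp: emb_inject[OF s _ i])
    finally show ?thesis .
  qed
  have tD: "Dm D n (?t i) z w \<longleftrightarrow> (\<exists>v. Dm D m (skip m i) z v \<and> Dm D n s v w)" if "i < m" for i z w
    by (rule D_comp[OF skip(1)[OF that] s t[OF that]]) (rule ap_sq_comp)
  show ?thesis
  proof
    assume j: "in_sp n y j"
    then have jn: "j < n" and nr: "\<not> in_ran n (skip n j) y" by (auto simp: sp_iff)
    have "rng s j"
    proof (rule ccontr)
      assume "\<not> rng s j"
      then have "rng (skip n j) k" if "rng s k" for k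
        using that rng_less[OF s that] by (auto simp: skip(2)[OF jn])
      then show False
        using ran_mono[OF skip(1)[OF jn] s] xy nr unfolding in_ran_def by blast
    qed
    then obtain i where i: "i < m" "j = ap s i" unfolding rng_iff[OF s] by blast
    have "\<not> in_ran m (skip m i) x"
    proof
      assume "in_ran m (skip m i) x"
      then have "in_ran n (?t i) y" using tD[OF i(1)] xy unfolding in_ran_def by blast
      moreover have "rng (skip n j) k" if "rng (?t i) k" for k
        using that rng_less[OF s, of k] unfolding rt[OF i(1)] i(2)[symmetric] skip(2)[OF jn] by blast
      ultimately show False using ran_mono[OF skip(1)[OF jn] t[OF i(1)]] nr by blast
    qed
    then show "\<exists>i. in_sp m x i \<and> at s i j" using i emb_at[OF s] sp_iff by blast
  next
    assume "\<exists>i. in_sp m x i \<and> at s i j"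
    then obtain i where i: "i < m" "j = ap s i" and nr: "\<not> in_ran m (skip m i) x"
      using emb_at[OF s] sp_iff by blast
    have jn: "j < n" using emb_less[OF s] i by simp
    have "\<not> in_ran n (skip n j) y"
    proof
      assume a: "in_ran n (skip n j) y"
      have "rng (?t i) k \<longleftrightarrow> rng s k \<and> rng (skip n j) k" for k
        using rng_less[OF s, of k] unfolding rt[OF i(1)] i(2)[symmetric] skip(2)[OF jn] by blast
      then have "in_ran n (?t i) y"
        using ran_inter[OF s skip(1)[OF jn] t[OF i(1)]] a xy unfolding in_ran_def by blast
      then obtain z v where "Dm D m (skip m i) z v" "Dm D n s v y"
        using tD[OF i(1)] unfolding in_ran_def by blast
      then show False using D_inj[OF s _ xy] nr unfolding in_ran_def by blast
    qed
    then show "in_sp n y j" using jn sp_iff by blast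
  qed
qed

lemma ex_supports: "\<exists>Z\<in>SS. supports_in D Z"
proof -
  \<comment> \<open>Elements of \<open>a\<close> are below \<open>a\<close> and the support is below
    \<open>n\<close>, so the bound \<open>n + a\<close> loses nothing and keeps the family
    recursive.\<close>
  let ?P = "\<lambda>n x a. inD D n x \<and> fin a \<and> (\<forall>i<n + a. elem i a \<longleftrightarrow> in_sp n x i)"
  let ?Z = "{p. is_pr p \<and> is_pr (p2 p) \<and> ?P (p1 p) (p1 (p2 p)) (p2 (p2 p))}"
  have "?Z \<in> SS"
    unfolding rec_def[symmetric] by (intro computable rec_inD rec_sp)
  have "(\<forall>i<n + a. elem i a \<longleftrightarrow> in_sp n x i) \<longleftrightarrow> (\<forall>i. elem i a \<longleftrightarrow> in_sp n x i)" for n a x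
  proof -
    have "i < n + a" if "elem i a \<or> in_sp n x i" for i
    proof -
      have "i < n \<or> i < a" using that elem_less unfolding in_sp_def by blast
      moreover have "n \<le> n + a" "a \<le> n + a" by simp_all
      ultimately show ?thesis using less_le_trans by blast
    qed
    then show ?thesis by blast
  qed
  then have S: "supp_in D ?Z n x a \<longleftrightarrow> inD D n x \<and> fin a \<and> (\<forall>i. elem i a \<longleftrightarrow> in_sp n x i)" for n x a
    unfolding supp_in_def by auto
  have "supports_in D ?Z"
    unfolding supports_in_def S
  proof (intro conjI allI impI; (elim conjE)?)
    fix n x assume x: "inD D n x"
    have "rec (\<lambda>i. in_sp n x i)" by (intro rec_sp computable)
    then obtain a where a: "fin a" "\<forall>i. elem i a \<longleftrightarrow> in_sp n x i"
      using ex_fin[of "\<lambda>i. in_sp n x i" n] unfolding in_sp_def by blast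
    then show "\<exists>a. (inD D n x \<and> fin a \<and> (\<forall>i. elem i a \<longleftrightarrow> in_sp n x i))
        \<and> (\<forall>b. inD D n x \<and> fin b \<and> (\<forall>i. elem i b \<longleftrightarrow> in_sp n x i) \<longrightarrow> b = a)"
    proof (intro exI conjI allI impI; (elim conjE)?)
      fix b assume "fin b" "\<forall>i. elem i b \<longleftrightarrow> in_sp n x i"
      then show "b = a" using a by (intro fin_inject) simp_all
    qed (use x a in simp_all)
  next
    fix n x a i assume "\<forall>i. elem i a \<longleftrightarrow> in_sp n x i" "elem i a"
    then show "i < n" unfolding in_sp_def by blast
  next
    fix m n s x y a b j
    assume "emb m n s" "Dm D n s x y" "\<forall>i. elem i a \<longleftrightarrow> in_sp m x i" "\<forall>i. elem i b \<longleftrightarrow> in_sp n y i"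
    then show "elem j b \<longleftrightarrow> (\<exists>i. elem i a \<and> at s i j)" using sp_natural by simp
  next
    fix m n s y b
    assume "emb m n s" "inD D n y" "\<forall>i. elem i b \<longleftrightarrow> in_sp n y i" "\<forall>j. elem j b \<longrightarrow> (\<exists>i. at s i j)"
    then show "\<exists>x. Dm D n s x y" using ran_if_supp unfolding in_ran_def rng_def by blast
  qed
  with \<open>?Z \<in> SS\<close> show ?thesis by blast
qed

end

context model_dilator
begin

subsection \<open>The order on the extension\<close>

text \<open>Relates the maps between cardinalities to morphisms into a common \<open>n\<close>: the
  enumerations hidden in \<open>incl_in\<close> are the given ones by uniqueness, and
  \<open>e\<close> is \<open>e'\<close> after \<open>s\<close>.\<close>

lemma incl_in_comp:
  assumes e: "enum_in a k e" and e': "enum_in c l e'" and c: "\<And>i. elem i c \<Longrightarrow> i < n"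
    and incl: "incl_in a c k' l' s"
  shows "k' = k" "l' = l" "emb k l s" "Dm D n e x z \<longleftrightarrow> (\<exists>y. Dm D l s x y \<and> Dm D n e' y z)"
proof -
  obtain d d' where d: "emb k' l' s" "enum_in a k' d" "enum_in c l' d'" "sm (cmp (at s) (at d')) (at d)"
    using incl unfolding incl_in_def by blast
  then have eq: "k' = k" "d = e" "l' = l" "d' = e'" using enum_in_unique e e' by blast+
  show "k' = k" "l' = l" by fact+
  show s: "emb k l s" using d(1) eq by simp
  have em': "emb l n e'" by (rule enum_in_emb[OF e' c])
  have ap: "ap e i = ap e' (ap s i)" if "i < k" for i
  proof -
    have "cmp (at s) (at e') i (ap e' (ap s i))" using cmp_at[OF s em'] that by blast
    then have "at e i (ap e' (ap s i))" using d(4) eq unfolding sm_def by blast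
    then show ?thesis using ap_eqI e unfolding enum_in_iff by (metis emb_fseq)
  qed
  have em: "emb k n e"
    by (rule emb_widen[of k a]) (use e ap emb_less[OF s] emb_less[OF em'] in \<open>auto simp: enum_in_iff\<close>)
  show "Dm D n e x z \<longleftrightarrow> (\<exists>y. Dm D l s x y \<and> Dm D n e' y z)"
    by (rule D_comp[OF s em' em ap])
qed

lemma ex_incl_in:
  assumes e: "enum_in a k e" and e': "enum_in c l e'" and ac: "\<And>i. elem i a \<Longrightarrow> elem i c"
  shows "\<exists>s. incl_in a c k l s"
proof -
  have em': "emb l c e'" using e' by (simp add: enum_in_iff)
  have em: "emb k c e" by (rule enum_in_emb[OF e]) (use ac elem_less in blast)
  obtain s where s: "emb k l s" "\<And>i. i < k \<Longrightarrow> ap e' (ap s i) = ap e i"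
    using emb_factor[OF em' em] ac e e' unfolding enum_in_iff by blast
  have "sm (cmp (at s) (at e')) (at e)" by (rule sm_at[OF s(1) em' em]) (simp add: s(2))
  then show ?thesis using s(1) e e' unfolding incl_in_def by blast
qed

text \<open>
  Two elements can be compared after embedding them into \<open>D(n)\<close> for any \<open>n\<close> that bounds their
  first components, since the embedding of the union into \<open>n\<close> reflects the order.
\<close>

lemma ext_less_iff:
  assumes x: "ext_elt_in D Z (pr a x)" and y: "ext_elt_in D Z (pr b y)"
    and a: "enum_in a k d" "\<And>i. elem i a \<Longrightarrow> i < n" and x': "Dm D n d x x'"
    and b: "enum_in b l e" "\<And>i. elem i b \<Longrightarrow> i < n" and y': "Dm D n e y y'"
  shows "ext_less_in D Z (pr a x) (pr b y) \<longleftrightarrow> x' < y'"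
proof -
  have "rec (\<lambda>i. elem i a \<or> elem i b)" by (intro computable)
  then obtain c where c: "fin c" "\<forall>i. elem i c \<longleftrightarrow> elem i a \<or> elem i b"
    using ex_fin[of "\<lambda>i. elem i a \<or> elem i b" n] a(2) b(2) by blast
  then have cn: "\<And>i. elem i c \<Longrightarrow> i < n" using a(2) b(2) by blast
  obtain m f where f: "enum_in c m f" using ex_enum_in[OF c(1)] by blast
  then have emf: "emb m n f" using enum_in_emb cn by blast
  have emd: "emb k n d" and eme: "emb l n e" using enum_in_emb a b by blast+
  \<comment> \<open>Whatever data witness the comparison, they agree with the enumerations fixed
    here, and D(f) for the enumeration \<open>f\<close> of the union reflects the order.\<close>
  have less: "x'' < y'' \<longleftrightarrow> x' < y'"
    if s: "incl_in a c k' m' s" "Dm D m' s x x''" and t: "incl_in b c l' m' t" "Dm D m' t y y''"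
    for k' l' m' s t x'' y''
  proof -
    have s2: "m' = m" "emb k m s" "emb l m t"
      using incl_in_comp[OF a(1) f cn s(1)] incl_in_comp[OF b(1) f cn t(1)] by simp_all
    obtain v where v: "Dm D m s x v" "Dm D n f v x'"
      using incl_in_comp(4)[OF a(1) f cn s(1)] x' by blast
    obtain w where w: "Dm D m t y w" "Dm D n f w y'"
      using incl_in_comp(4)[OF b(1) f cn t(1)] y' by blast
    have "v = x''" "w = y''"
      using D_fun[OF s2(2) v(1)] D_fun[OF s2(3) w(1)] s(2) t(2) s2(1) by simp_all
    then show ?thesis using D_less_iff[OF emf v(2) w(2)] by simp
  qed
  show ?thesis
  proof
    assume "ext_less_in D Z (pr a x) (pr b y)"
    then obtain c' k' l' m' s t x'' y'' where h: "fin c'" "\<forall>z. elem z c' \<longleftrightarrow> elem z a \<or> elem z b"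
      "incl_in a c' k' m' s" "Dm D m' s x x''" "incl_in b c' l' m' t" "Dm D m' t y y''" "x'' < y''"
      unfolding ext_less_in_def by auto
    then have "c' = c" using fin_inject[OF h(1) c(1)] c(2) by simp
    then show "x' < y'" using less h(3-7) by blast
  next
    assume xy: "x' < y'"
    obtain s t where st: "incl_in a c k m s" "incl_in b c l m t"
      using ex_incl_in[OF a(1) f] ex_incl_in[OF b(1) f] c(2) by blast
    obtain v w where vw: "Dm D m s x v" "Dm D m t y w"
      using incl_in_comp(4)[OF a(1) f cn st(1)] incl_in_comp(4)[OF b(1) f cn st(2)] x' y' by blast
    then have "v < w" using less st xy by blast
    then show "ext_less_in D Z (pr a x) (pr b y)"
      unfolding ext_less_in_def using x y c st vw by blast
  qed
qed

lemma ext_eltD: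
  assumes "ext_elt_in D Z x"
  shows "is_pr x" "\<exists>l e w. enum_in (p1 x) l e \<and> supp_in D Z l (p2 x) w"
proof -
  obtain a y l e w where "x = pr a y" "enum_in a l e" "supp_in D Z l y w"
    using assms unfolding ext_elt_in_def by blast
  then show "is_pr x" "\<exists>l e w. enum_in (p1 x) l e \<and> supp_in D Z l (p2 x) w" by auto
qed

lemma supports_inD:
  assumes "supports_in D Z"
  shows "inD D n x \<Longrightarrow> \<exists>a. supp_in D Z n x a"
    and "supp_in D Z n x a \<Longrightarrow> elem i a \<Longrightarrow> i < n"
    and "emb m n s \<Longrightarrow> Dm D n s x y \<Longrightarrow> supp_in D Z m x a \<Longrightarrow> supp_in D Z n y b
      \<Longrightarrow> elem j b \<longleftrightarrow> (\<exists>i. elem i a \<and> at s i j)"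
    and "emb m n s \<Longrightarrow> supp_in D Z n y b \<Longrightarrow> (\<And>j. elem j b \<Longrightarrow> \<exists>i. at s i j) \<Longrightarrow> \<exists>x. Dm D n s x y"
proof -
  note c = assms[unfolded supports_in_def]
  show "inD D n x \<Longrightarrow> \<exists>a. supp_in D Z n x a" using c[THEN conjunct1] by blast
  show "supp_in D Z n x a \<Longrightarrow> elem i a \<Longrightarrow> i < n" using c[THEN conjunct2, THEN conjunct1] by blast
  show "emb m n s \<Longrightarrow> Dm D n s x y \<Longrightarrow> supp_in D Z m x a \<Longrightarrow> supp_in D Z n y b
      \<Longrightarrow> elem j b \<longleftrightarrow> (\<exists>i. elem i a \<and> at s i j)"
    using c[THEN conjunct2, THEN conjunct2, THEN conjunct1] by blast
  show "emb m n s \<Longrightarrow> supp_in D Z n y b \<Longrightarrow> (\<And>j. elem j b \<Longrightarrow> \<exists>i. at s i j) \<Longrightarrow> \<exists>x. Dm D n s x y"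
    using c[THEN conjunct2, THEN conjunct2, THEN conjunct2] by blast
qed

text \<open>The enumeration of the support has the support as its range, so the last property of
  supports provides a preimage.\<close>

lemma normal_form:
  assumes Z: "supports_in D Z" and x: "inD D n x"
  shows "\<exists>a y l e. supp_in D Z n x a \<and> enum_in a l e \<and> Dm D n e y x"
proof -
  obtain a where a: "supp_in D Z n x a" using supports_inD(1)[OF Z x] by blast
  then obtain l e where e: "enum_in a l e" using ex_enum_in unfolding supp_in_def by blast
  have "emb l n e"
    by (rule enum_in_emb[OF e supports_inD(2)[OF Z a]])
  moreover have "\<exists>i. at e i j" if "elem j a" for j using e that by (simp add: enum_in_iff rng_def)
  ultimately have "\<exists>y. Dm D n e y x" by (rule supports_inD(4)[OF Z _ a])
  then show ?thesis using a e by blast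
qed

text \<open>By naturality, \<open>e\<close> maps the support of \<open>y\<close> onto
  \<open>a\<close>, which is the full range of \<open>e\<close>; by injectivity that support is all
  of \<open>l\<close>.\<close>

lemma normal_form_elt:
  assumes Z: "supports_in D Z" and a: "supp_in D Z n x a" and e: "enum_in a l e" and y: "Dm D n e y x"
  shows "ext_elt_in D Z (pr a y)" "elem i a \<Longrightarrow> i < n"
proof -
  show an: "elem i a \<Longrightarrow> i < n" for i by (rule supports_inD(2)[OF Z a])
  have em: "emb l n e" by (rule enum_in_emb[OF e an])
  obtain w where w: "supp_in D Z l y w" using supports_inD(1)[OF Z D_dom[OF em y]] by blast
  have nat: "elem j a \<longleftrightarrow> (\<exists>i. elem i w \<and> at e i j)" for j
    by (rule supports_inD(3)[OF Z em y w a])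
  have "elem i w \<longleftrightarrow> i < l" for i
  proof
    show "elem i w \<Longrightarrow> i < l" by (rule supports_inD(2)[OF Z w])
    assume i: "i < l"
    then have "elem (ap e i) a" using e rng_iff[OF em] unfolding enum_in_iff by blast
    then obtain i' where "elem i' w" "at e i' (ap e i)" using nat by blast
    then show "elem i w" using emb_at[OF em] emb_inject[OF em _ i] by auto
  qed
  then show "ext_elt_in D Z (pr a y)" unfolding ext_elt_in_def using e w by blast
qed

subsection \<open>Goodstein sequences\<close>

text \<open>The code of a morphism does not determine its codomain, so the composite of
  \<open>e\<close> with an inclusion is again coded by \<open>e\<close>.\<close>

lemma D_incl:
  assumes "emb l m e" "m \<le> n" "Dm D m e y x" "Dm D n (idm m) x z"
  shows "Dm D n e y z"
proof -
  have "emb l n e" using assms(1,2) emb_less[OF assms(1)] by (intro emb_widen[OF assms(1)]) (blast intro: less_le_trans)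
  moreover have "ap e i = ap (idm m) (ap e i)" if "i < l" for i
    by (rule ap_sq[OF cf_id emb_less[OF assms(1) that], symmetric])
  ultimately show ?thesis using D_comp[OF assms(1) emb_id[OF assms(2)]] assms(3,4) by blast
qed

lemma inD_zero: "inD D b 0"
  using D_cod[OF emb_id D_zero[OF emb_id]] by simp

text \<open>The 0 of \<open>D(m)\<close> comes from \<open>D(0)\<close> along the empty map, which
  remains the empty map after the inclusion.\<close>

lemma D_incl_zero: "m \<le> n \<Longrightarrow> Dm D n (idm m) 0 0"
proof -
  assume mn: "m \<le> n"
  obtain z where z: "Dm D n (idm m) 0 z" using D_total[OF emb_id[OF mn] inD_zero] by blast
  have e: "emb 0 b (idm 0)" for b :: 'a by (rule emb_id) simp
  have "Dm D n (idm 0) 0 z" by (rule D_incl[OF e mn D_zero[OF e] z])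
  then have "z = 0" using D_fun[OF e _ D_zero[OF e]] by blast
  then show ?thesis using z by simp
qed

abbreviation (input) goodstein_step :: "('a \<Rightarrow> 'a) \<Rightarrow> ('a \<Rightarrow> 'a) \<Rightarrow> 'a \<Rightarrow> bool" where
  "goodstein_step b g i \<equiv> g i = 0 \<and> g (i + 1) = 0
    \<or> g i \<noteq> 0 \<and> Dm D (b (i + 1)) (idm (b i)) (g i) (g (i + 1) + 1)"

lemma ex_goodstein:
  assumes b: "cf b" "\<And>i. b i \<le> b (i + 1)" and m: "inD D (b 0) m"
  shows "\<exists>g. cf g \<and> g 0 = m \<and> (\<forall>i. inD D (b i) (g i))
    \<and> (\<forall>i. goodstein_step b g i)"
proof -
  let ?c = "\<lambda>i. idm (b i)"
  have c: "emb (b i) (b (i + 1)) (?c i)" for i by (rule emb_id[OF b(2)])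
  have cf_c: "cf (\<lambda>x. ?c (f x))" if "cf f" for f
    by (rule cf_sq[of "\<lambda>x. b (f x)" "\<lambda>_ j. j"]) (intro computable cf_comp[OF b(1)] that)+
  \<comment> \<open>\<open>p\<close> codes an index and the current value, \<open>y\<close> is the
    next value. Pairs that violate \<open>inD\<close> get the value 0, because the choice principle
    asks for a total relation.\<close>
  let ?P = "\<lambda>p y. (p2 p = 0 \<or> \<not> inD D (b (p1 p)) (p2 p)) \<and> y = 0
    \<or> p2 p \<noteq> 0 \<and> inD D (b (p1 p)) (p2 p) \<and> Dm D (b (p1 p + 1)) (?c (p1 p)) (p2 p) (y + 1)"
  have "\<exists>y. ?P p y" for p
  proof (cases "p2 p = 0 \<or> \<not> inD D (b (p1 p)) (p2 p)")
    case False
    then obtain z where z: "Dm D (b (p1 p + 1)) (?c (p1 p)) (p2 p) z" using D_total[OF c] by blast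
    \<comment> \<open>The current value is positive and its image is no smaller by
      \<open>D_ge\<close>, so a predecessor exists.\<close>
    then have "z \<noteq> 0" using D_ge[OF c z] False by auto
    then show ?thesis using z False nonzero_add_one by blast
  qed blast
  moreover have "rec (\<lambda>q. ?P (p1 q) (p2 q))"
    by (intro computable rec_inD rec_Dm cf_c cf_comp[OF b(1)])
  ultimately obtain h where h: "cf h" "\<And>p. ?P p (h p)" using rec_choice[of ?P] by blast
  have "cf (\<lambda>p. h (pr (p1 p) (p2 p)))" by (intro computable cf_comp[OF h(1)])
  then obtain g where g: "cf g" "g 0 = m" "\<And>i. g (i + 1) = h (pr i (g i))"
    using primitive_recursion[of "\<lambda>i x. h (pr i x)" m] by blast
  have step: "?P (pr i (g i)) (g (i + 1))" for i using h(2)[of "pr i (g i)"] unfolding g(3) .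
  have D: "inD D (b i) (g i)" for i
  proof (rule rec_induct[of "\<lambda>i. inD D (b i) (g i)" i])
    show "rec (\<lambda>i. inD D (b i) (g i))" by (intro rec_inD b(1) g(1))
    show "inD D (b 0) (g 0)" using m g(2) by simp
    fix i assume "inD D (b i) (g i)"
    then consider "g (i + 1) = 0" | "Dm D (b (i + 1)) (?c i) (g i) (g (i + 1) + 1)"
      using step[of i] by auto
    then show "inD D (b (i + 1)) (g (i + 1))"
    proof cases
      case 2
      then show ?thesis using D_initial[OF D_cod[OF c 2]] by simp
    qed (simp add: inD_zero)
  qed
  show ?thesis using g(1,2) D step by (intro exI[of _ g]) auto
qed

text \<open>Evaluated in D(b(i+1)), the normal form of g(i) gives the image of g(i) under the
  inclusion, which is g(i+1) + 1, while that of g(i+1) gives g(i+1); \<open>ext_less_iff\<close>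
  turns this into a descent.\<close>

lemma terminate_if_wf:
  assumes Z: "Z \<in> SS" "supports_in D Z" "wf_in (ext_elt_in D Z) (ext_less_in D Z)"
    and b: "cf b" "\<And>i. b i \<le> b (i + 1)"
    and g: "cf g" "\<And>i. inD D (b i) (g i)" "\<And>i. goodstein_step b g i"
  shows "\<exists>i. g i = 0"
proof (rule ccontr)
  assume nz: "\<nexists>i. g i = 0"
  \<comment> \<open>The enumerations are quantified without bound, so the condition is treated as
    recursively enumerable and \<open>re_choice\<close> is used.\<close>
  let ?Q = "\<lambda>i x. \<exists>l e. supp_in D Z (b i) (g i) (p1 x) \<and> enum_in (p1 x) l e \<and> Dm D (b i) e (p2 x) (g i)
    \<and> is_pr x"
  have "\<exists>x. ?Q i x" for i
    using normal_form[OF Z(2) g(2)[of i]] by (metis is_pr p1 p2)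
  moreover have "re (\<lambda>q. ?Q (p1 q) (p2 q))"
    unfolding supp_in_def
    by (intro enumerable re_rec computable rec_inD rec_Dm Z(1) cf_comp[OF b(1)] cf_comp[OF g(1)])
  ultimately obtain f where f: "cf f" "\<And>i. ?Q i (f i)" using re_choice[of ?Q] by blast
  have elt: "ext_elt_in D Z (f i)" for i
  proof -
    obtain l e where "supp_in D Z (b i) (g i) (p1 (f i))" "enum_in (p1 (f i)) l e"
      "Dm D (b i) e (p2 (f i)) (g i)" "is_pr (f i)" using f(2) by blast
    then show ?thesis using normal_form_elt(1)[OF Z(2)] pr_p by metis
  qed
  have "ext_less_in D Z (f (i + 1)) (f i)" for i
  proof -
    obtain l e where e: "supp_in D Z (b i) (g i) (p1 (f i))" "enum_in (p1 (f i)) l e"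
      "Dm D (b i) e (p2 (f i)) (g i)" "is_pr (f i)" using f(2) by blast
    obtain k d where d: "supp_in D Z (b (i + 1)) (g (i + 1)) (p1 (f (i + 1)))"
      "enum_in (p1 (f (i + 1))) k d" "Dm D (b (i + 1)) d (p2 (f (i + 1))) (g (i + 1))" "is_pr (f (i + 1))"
      using f(2) by blast
    note el = normal_form_elt(2)[OF Z(2) e(1-3)] and dl = normal_form_elt(2)[OF Z(2) d(1-3)]
    have "emb l (b i) e" by (rule enum_in_emb[OF e(2) el])
    moreover have "Dm D (b (i + 1)) (idm (b i)) (g i) (g (i + 1) + 1)" using g(3) nz by blast
    ultimately have "Dm D (b (i + 1)) e (p2 (f i)) (g (i + 1) + 1)"
      using D_incl[OF _ b(2) e(3)] by blast
    moreover have "elem j (p1 (f i)) \<Longrightarrow> j < b (i + 1)" for j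
      using el b(2) less_le_trans by blast
    ultimately have "ext_less_in D Z (pr (p1 (f (i + 1))) (p2 (f (i + 1)))) (pr (p1 (f i)) (p2 (f i)))"
      using ext_less_iff[OF _ _ d(2) dl d(3) e(2), of Z "p2 (f i)" "g (i + 1) + 1"] elt[of i] elt[of "i + 1"] pr_p[OF e(4)] pr_p[OF d(4)]
      by simp
    then show ?thesis using pr_p[OF e(4)] pr_p[OF d(4)] by simp
  qed
  then have "graph f \<in> SS \<and> is_fun (\<lambda>x. x = x) (ext_elt_in D Z) (setR (graph f))
    \<and> (\<forall>i x y. pr i x \<in> graph f \<and> pr (i + 1) y \<in> graph f \<longrightarrow> ext_less_in D Z y x)"
    using f(1) elt by (auto simp: cf_def is_fun_def)
  then show False using Z(3) unfolding wf_in_def by blast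
qed

lemma all_terminate_if_wf:
  assumes "ext_wf_in D" shows "all_terminate_in D"
  unfolding all_terminate_in_def
proof (intro ballI allI impI; elim conjE exE)
  fix B m x0
  assume B: "B \<in> SS" "is_fun (\<lambda>x. x = x) (\<lambda>x. x = x) (setR B)"
    "\<forall>i j x y. i < j \<and> pr i x \<in> B \<and> pr j y \<in> B \<longrightarrow> x < y \<or> x = y" "pr 0 x0 \<in> B" "inD D x0 m"
  obtain Z where Z: "Z \<in> SS" "supports_in D Z" "wf_in (ext_elt_in D Z) (ext_less_in D Z)"
    using assms unfolding ext_wf_in_def by blast
  obtain b where b: "cf b" "\<And>x y. pr x y \<in> B \<longleftrightarrow> y = b x" using ex_function[OF B(1,2)] by blast
  have mono: "b i \<le> b (i + 1)" for i
    using B(3) b(2) by (metis less_add_one_iff order_le_less)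
  have "inD D (b 0) m" using B(4,5) by (simp add: b(2))
  from ex_goodstein[OF b(1) mono this] obtain g where g: "cf g" "g 0 = m" "\<And>i. inD D (b i) (g i)"
    and step: "\<And>i. goodstein_step b g i"
    by blast
  have "goodstein_in D B m (graph g)"
    unfolding goodstein_in_def graph b(2)
  proof (intro conjI allI impI)
    show "is_fun (\<lambda>x. x = x) (\<lambda>x. x = x) (\<lambda>x y. y = g x)" by (simp add: is_fun_def)
    show "m = g 0" using g(2) by simp
    fix i x y assume xy: "x = g i \<and> y = g (i + 1)"
    show "x = 0 \<and> y = 0 \<or> \<not> x = 0 \<and> (\<exists>p q c z. p = b i \<and> q = b (i + 1) \<and> emb p q c
        \<and> (\<forall>n. n < p \<longrightarrow> at c n n) \<and> Dm D q c x z \<and> (z = y + 1 \<or> z = 0 \<and> y = 0))"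
    proof (cases "x = 0")
      case True
      then show ?thesis using step[of i] xy by auto
    next
      case False
      then have "Dm D (b (i + 1)) (idm (b i)) x (y + 1)" using step[of i] xy by simp
      moreover have "\<forall>n. n < b i \<longrightarrow> at (idm (b i)) n n" by (simp add: sq(2)[OF cf_id])
      ultimately show ?thesis using False emb_id[OF mono] by blast
    qed
  qed
  moreover have "\<exists>i. pr i 0 \<in> graph g"
    using terminate_if_wf[OF Z b(1) mono g(1,3) step] by (metis graph)
  moreover have "graph g \<in> SS" using g(1) by (simp add: cf_def)
  ultimately show "\<exists>G\<in>SS. goodstein_in D B m G \<and> (\<exists>i. pr i 0 \<in> G)" by blast
qed

lemma wf_if_all_terminate:
  assumes terminates: "all_terminate_in D" shows "ext_wf_in D"
proof -
  obtain Z where Z: "Z \<in> SS" "supports_in D Z" using ex_supports by blast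
  have "wf_in (ext_elt_in D Z) (ext_less_in D Z)"
    unfolding wf_in_def
  proof (rule notI, elim bexE conjE)
    fix F
    assume F: "F \<in> SS" "is_fun (\<lambda>x. x = x) (ext_elt_in D Z) (setR F)"
      "\<forall>i x y. pr i x \<in> F \<and> pr (i + 1) y \<in> F \<longrightarrow> ext_less_in D Z y x"
    obtain f where f: "cf f" "\<And>x y. pr x y \<in> F \<longleftrightarrow> y = f x" and elt: "\<And>i. ext_elt_in D Z (f i)"
      using ex_function[OF F(1,2)] by blast
    have desc: "ext_less_in D Z (f (i + 1)) (f i)" for i using F(3) f(2) by blast
    \<comment> \<open>\<open>b(i)\<close> is the least strict bound of the entries up to
      \<open>i\<close>; leastness yields monotonicity.\<close>
    have "rec (\<lambda>q. \<forall>j<p1 q + 1. f j < p2 q)" by (intro computable cf_comp[OF f(1)])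
    moreover have "\<exists>w. \<forall>j<i + 1. f j < w" for i by (rule ex_bound[OF f(1)])
    ultimately obtain b where b: "cf b" "\<And>i. \<forall>j<i + 1. f j < b i"
      and least: "\<And>i w. w < b i \<Longrightarrow> \<not> (\<forall>j<i + 1. f j < w)"
      using rec_choice[of "\<lambda>i w. \<forall>j<i + 1. f j < w"] by blast
    have mono: "b i \<le> b k" if "i \<le> k" for i k
    proof (rule ccontr)
      assume "\<not> b i \<le> b k"
      then have "\<not> (\<forall>j<i + 1. f j < b k)" by (intro least) simp
      then show False using b(2)[of k] that unfolding less_add_one_le by (meson order_trans)
    qed
    have step: "b i \<le> b (i + 1)" for i by (rule mono) simp
    have fb: "f i < b i" for i using b(2)[of i] by (simp add: less_add_one_le)
    let ?Q = "\<lambda>i y. \<exists>l e. enum_in (p1 (f i)) l e \<and> Dm D (b i) e (p2 (f i)) y"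
    \<comment> \<open>An element is below the code of its set, which is at most the code of the
      pair.\<close>
    have bd: "j < b i" if "elem j (p1 (f i))" for i j
      using less_trans[OF less_le_trans[OF elem_less[OF that] p_le(1)] fb] .
    have ispr: "is_pr (f i)" for i by (rule ext_eltD(1)[OF elt])
    have "\<exists>y. ?Q i y" for i
    proof -
      obtain l e w where e: "enum_in (p1 (f i)) l e" "supp_in D Z l (p2 (f i)) w"
        using ext_eltD(2)[OF elt] by blast
      have "\<exists>y. Dm D (b i) e (p2 (f i)) y"
        by (rule D_total[OF enum_in_emb[OF e(1) bd]]) (use e(2) in \<open>simp_all add: supp_in_def\<close>)
      then show ?thesis using e(1) by blast
    qed
    moreover have "re (\<lambda>q. ?Q (p1 q) (p2 q))"
      by (intro enumerable re_rec computable rec_Dm cf_comp[OF b(1)] cf_comp[OF f(1)])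
    ultimately obtain t where t: "cf t" "\<And>i. ?Q i (t i)" using re_choice[of ?Q] by blast
    have t_in: "inD D (b i) (t i)" for i
      using t(2)[of i] D_cod[OF enum_in_emb[OF _ bd]] by blast
    have less: "t (i + 1) < z" if z: "Dm D (b (i + 1)) (idm (b i)) (t i) z" for i z
    proof -
      obtain l e where e: "enum_in (p1 (f i)) l e" "Dm D (b i) e (p2 (f i)) (t i)" using t(2) by blast
      obtain k d where d: "enum_in (p1 (f (i + 1))) k d" "Dm D (b (i + 1)) d (p2 (f (i + 1))) (t (i + 1))"
        using t(2) by blast
      have "Dm D (b (i + 1)) e (p2 (f i)) z"
        by (rule D_incl[OF enum_in_emb[OF e(1) bd] step e(2) z])
      moreover have "elem j (p1 (f i)) \<Longrightarrow> j < b (i + 1)" for j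
        using bd step less_le_trans by blast
      ultimately show ?thesis
        using ext_less_iff[OF _ _ d(1) bd d(2) e(1), of Z "p2 (f i)" z]
          elt[of i] elt[of "i + 1"] desc[of i] pr_p[OF ispr] by simp
    qed
    \<comment> \<open>Otherwise the inclusion would map \<open>t i\<close> to 0, and the next value
      would be below 0.\<close>
    have nz: "t i \<noteq> 0" for i
      using less[of i 0] D_incl_zero[OF step, of i] not_less_zero by auto
    have B: "graph b \<in> SS" "is_fun (\<lambda>x. x = x) (\<lambda>x. x = x) (setR (graph b))"
      "\<forall>i j x y. i < j \<and> pr i x \<in> graph b \<and> pr j y \<in> graph b \<longrightarrow> x < y \<or> x = y"
      "\<exists>x. pr 0 x \<in> graph b \<and> 0 < x \<and> inD D x (t 0)"
      using b(1) mono t_in[of 0] le_less_trans[OF zero_le fb, of 0]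
      by (auto simp: cf_def is_fun_def order_le_less[symmetric])
    then obtain G i0 where G: "G \<in> SS" "goodstein_in D (graph b) (t 0) G" "pr i0 0 \<in> G"
      using terminates unfolding all_terminate_in_def by blast
    note G2 = G(2)[unfolded goodstein_in_def]
    obtain g where g: "cf g" "\<And>x y. pr x y \<in> G \<longleftrightarrow> y = g x"
      using ex_function[OF G(1) G2[THEN conjunct1]] by blast
    note G_step = G2[THEN conjunct2, THEN conjunct2, unfolded g(2) graph, rule_format, OF conjI[OF refl refl]]
    have "t i \<le> g i \<and> inD D (b i) (g i)" for i
    proof (rule rec_induct[of "\<lambda>i. t i \<le> g i \<and> inD D (b i) (g i)" i])
      show "rec (\<lambda>i. t i \<le> g i \<and> inD D (b i) (g i))" by (intro computable rec_inD t(1) g(1) b(1))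
      show "t 0 \<le> g 0 \<and> inD D (b 0) (g 0)"
        using G2[THEN conjunct2, THEN conjunct1] t_in[of 0] unfolding g(2) by simp
      fix i assume IH: "t i \<le> g i \<and> inD D (b i) (g i)"
      have "\<not> g i = 0" using IH nz[of i] by auto
      then obtain c z where c: "emb (b i) (b (i + 1)) c" "\<forall>n. n < b i \<longrightarrow> at c n n"
        "Dm D (b (i + 1)) c (g i) z" "z = g (i + 1) + 1 \<or> z = 0 \<and> g (i + 1) = 0"
        using G_step[of i] by blast
      \<comment> \<open>The definition of the sequence admits any code of the inclusion, but there
        is just one.\<close>
      have "c = idm (b i)"
        by (rule emb_ext[OF c(1) emb_id[OF step]]) (use c(1,2) in \<open>simp add: emb_at ap_sq[OF cf_id]\<close>)
      then obtain w where w: "Dm D (b (i + 1)) c (t i) w" "t (i + 1) < w"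
        using D_total[OF c(1) t_in] less by blast
      \<comment> \<open>\<open>t (i + 1) < w \<le> z\<close> makes \<open>z\<close> positive, which
        excludes truncated subtraction, and with \<open>z = g (i + 1) + 1\<close> it gives the
        induction step.\<close>
      then have "w \<le> z" using D_less_iff[OF c(1) c(3) w(1)] IH by (simp add: not_less[symmetric])
      then have tz: "t (i + 1) < z" using w(2) by simp
      then have z: "z = g (i + 1) + 1" using c(4) not_less_zero by auto
      moreover have "inD D (b (i + 1)) (g (i + 1))"
        using D_initial[OF D_cod[OF c(1,3)]] z by simp
      ultimately show "t (i + 1) \<le> g (i + 1) \<and> inD D (b (i + 1)) (g (i + 1))"
        using tz by (simp add: less_add_one_le)
    qed
    then have "t i0 \<le> g i0" by blast
    then show False using nz[of i0] G(3) g(2) by auto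
  qed
  then show ?thesis unfolding ext_wf_in_def using Z by blast
qed

end

theorem theorem2p10:
  shows "RCA0 \<turnstile> sentence
    (\<^bold>\<forall>\<^sub>S D. goodstein_dilator D \<^bold>\<longrightarrow> (extended_goodstein D \<^bold>\<longleftrightarrow> extension_omega_wf D))"
proof -
  have "all_terminate_in D \<longleftrightarrow> ext_wf_in D" if "D \<in> SS" "dilator_in D" for D :: "model set"
  proof -
    interpret model_dilator D using that by unfold_locales
    show ?thesis using all_terminate_if_wf wf_if_all_terminate by blast
  qed
  then show ?thesis using sat_goal unfolding goal_def by blast
qed

end
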